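(* Let $\mathcal Y$ be an antisymmetric coherent configuration and $L$ a transitive permutation group of odd order. Then $gb(\mathcal Y\uparrow L)\le\max\{gb(\mathcal Y),b\}$ where $b=gb(\mathrm{Inv}(L))$. Moreover, if $\mathcal Y$ is not complete, then $b(\mathcal Y\uparrow L)\le b(\mathcal Y)+\max\{0,\,b-\lceil(b(\mathcal Y)-1)/2\rceil\}$.
   Context: A coherent configuration on a finite set $\Omega$ is $(\Omega,S)$ with $S$ a partition of $\Omega\times\Omega$ such that $1_\Omega$ is a union of elements of $S$, $s^*=\{(\beta,\alpha):(\alpha,\beta)\in s\}\in S$, and for $r,s,t\in S$ the number $|\{\gamma:(\alpha,\gamma)\in r,(\gamma,\beta)\in s\}|$ is independent of $(\alpha,\beta)\in t$; relations are unions of elements of $S$, fibers are sets $\Gamma$ with $1_\Gamma\in S$; antisymmetric: every $s\in S$ with $s=s^*$ lies in $1_\Omega$; complete: all elements of $S$ are singletons. A fission is a configuration on the same set whose relations include those of the given one. For $\Pi\subseteq2^\Omega$ the $\Pi$-fission is the smallest fission in which each member of $\Pi$ is a union of fibers; $\Pi$ is a generalized base if the $\Pi$-fission is complete; $B\subseteq\Omega$ is a base if $\{\{\beta\}:\beta\in B\}$ is a generalized base; $gb$ and $b$ are the minimal sizes. $\mathrm{Inv}(L)=(\Delta,\text{orbits of }L\text{ on }\Delta^2)$. Exponentiation: for $\mathcal Y=(\Gamma,T)$ and $L\le\mathrm{Sym}(\Delta)$, $\Delta=\{1,\dots,m\}$, with $t_1\otimes\dots\otimes t_m=\{(\alpha,\beta)\in\Gamma^m\times\Gamma^m:(\alpha_i,\beta_i)\in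 t_i\ \forall i\}$ and $L$ acting on $\Gamma^m$ by permuting coordinates, $\mathcal Y\uparrow L=(\Gamma^m,\{\bigcup_{l\in L}t^l:t=t_1\otimes\dots\otimes t_m,\ t_i\in T\})$. *)

theory Defs
  imports Complex_Main "HOL-Library.Disjoint_Sets" "HOL-Library.FuncSet" "HOL-Combinatorics.Permutations"
begin

definition coherent_config :: "'a set \<Rightarrow> 'a rel set \<Rightarrow> bool" where
  "coherent_config \<Omega> S \<longleftrightarrow>
     finite \<Omega> \<and>
     partition_on (\<Omega> \<times> \<Omega>) S \<and>
     (\<exists>S0 \<subseteq> S. \<Union>S0 = Id_on \<Omega>) \<and>
     (\<forall>s\<in>S. converse s \<in> S) \<and>
     (\<forall>r\<in>S. \<forall>s\<in>S. \<forall>t\<in>S. \<forall>a b a' b'. (a, b) \<in> t \<longrightarrow> (a', b') \<in> t \<longrightarrow>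
        card {c. (a, c) \<in> r \<and> (c, b) \<in> s} = card {c. (a', c) \<in> r \<and> (c, b') \<in> s})"

definition cc_relation :: "'a rel set \<Rightarrow> 'a rel \<Rightarrow> bool" where
  "cc_relation S r \<longleftrightarrow> (\<exists>S0 \<subseteq> S. r = \<Union>S0)"

definition fibers :: "'a rel set \<Rightarrow> 'a set set" where
  "fibers S = {\<Gamma>. Id_on \<Gamma> \<in> S}"

definition cc_antisymmetric :: "'a set \<Rightarrow> 'a rel set \<Rightarrow> bool" where
  "cc_antisymmetric \<Omega> S \<longleftrightarrow> (\<forall>s\<in>S. s = converse s \<longrightarrow> s \<subseteq> Id_on \<Omega>)"

definition cc_complete :: "'a rel set \<Rightarrow> bool" where
  "cc_complete S \<longleftrightarrow> (\<forall>s\<in>S. \<exists>x. s = {x})"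

definition fission :: "'a set \<Rightarrow> 'a rel set \<Rightarrow> 'a rel set \<Rightarrow> bool" where
  "fission \<Omega> S S' \<longleftrightarrow> coherent_config \<Omega> S' \<and> (\<forall>r. cc_relation S r \<longrightarrow> cc_relation S' r)"

definition unions_of_fibers :: "'a rel set \<Rightarrow> 'a set set \<Rightarrow> bool" where
  "unions_of_fibers S' PP \<longleftrightarrow> (\<forall>P\<in>PP. \<exists>F \<subseteq> fibers S'. P = \<Union>F)"

definition is_Pi_fission :: "'a set \<Rightarrow> 'a rel set \<Rightarrow> 'a set set \<Rightarrow> 'a rel set \<Rightarrow> bool" where
  "is_Pi_fission \<Omega> S PP S' \<longleftrightarrow>
     fission \<Omega> S S' \<and> unions_of_fibers S' PP \<and>
     (\<forall>S''. fission \<Omega> S S'' \<and> unions_of_fibers S'' PP \<longrightarrow>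
        (\<forall>r. cc_relation S' r \<longrightarrow> cc_relation S'' r))"

definition generalized_base :: "'a set \<Rightarrow> 'a rel set \<Rightarrow> 'a set set \<Rightarrow> bool" where
  "generalized_base \<Omega> S PP \<longleftrightarrow> PP \<subseteq> Pow \<Omega> \<and> (\<exists>S'. is_Pi_fission \<Omega> S PP S' \<and> cc_complete S')"

definition cc_base :: "'a set \<Rightarrow> 'a rel set \<Rightarrow> 'a set \<Rightarrow> bool" where
  "cc_base \<Omega> S B \<longleftrightarrow> B \<subseteq> \<Omega> \<and> generalized_base \<Omega> S ((\<lambda>x. {x}) ` B)"

definition gb :: "'a set \<Rightarrow> 'a rel set \<Rightarrow> nat" where
  "gb \<Omega> S = (LEAST n. \<exists>PP. generalized_base \<Omega> S PP \<and> card PP = n)"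

definition bnum :: "'a set \<Rightarrow> 'a rel set \<Rightarrow> nat" where
  "bnum \<Omega> S = (LEAST n. \<exists>B. cc_base \<Omega> S B \<and> card B = n)"

definition perm_group_on :: "nat \<Rightarrow> (nat \<Rightarrow> nat) set \<Rightarrow> bool" where
  "perm_group_on m L \<longleftrightarrow> (\<forall>l\<in>L. l permutes {1..m}) \<and> id \<in> L \<and>
     (\<forall>p\<in>L. \<forall>q\<in>L. p \<circ> q \<in> L) \<and> (\<forall>p\<in>L. inv p \<in> L)"

definition transitive_on :: "nat \<Rightarrow> (nat \<Rightarrow> nat) set \<Rightarrow> bool" where
  "transitive_on m L \<longleftrightarrow> (\<forall>i\<in>{1..m}. \<forall>j\<in>{1..m}. \<exists>l\<in>L. l i = j)"

definition Inv_rels :: "nat \<Rightarrow> (nat \<Rightarrow> nat) set \<Rightarrow> nat rel set" where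
  "Inv_rels m L = {{(l i, l j) | l. l \<in> L} | i j. i \<in> {1..m} \<and> j \<in> {1..m}}"

definition tuples :: "nat \<Rightarrow> 'a set \<Rightarrow> (nat \<Rightarrow> 'a) set" where
  "tuples m \<Gamma> = PiE {1..m} (\<lambda>_. \<Gamma>)"

definition perm_tuple :: "(nat \<Rightarrow> nat) \<Rightarrow> (nat \<Rightarrow> 'a) \<Rightarrow> (nat \<Rightarrow> 'a)" where
  "perm_tuple l x = (\<lambda>i. x (inv l i))"

definition perm_rel :: "(nat \<Rightarrow> nat) \<Rightarrow> (nat \<Rightarrow> 'a) rel \<Rightarrow> (nat \<Rightarrow> 'a) rel" where
  "perm_rel l t = {(perm_tuple l a, perm_tuple l b) | a b. (a, b) \<in> t}"

definition tensor :: "nat \<Rightarrow> 'a set \<Rightarrow> (nat \<Rightarrow> 'a rel) \<Rightarrow> (nat \<Rightarrow> 'a) rel" where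
  "tensor m \<Gamma> ts = {(a, b). a \<in> tuples m \<Gamma> \<and> b \<in> tuples m \<Gamma> \<and> (\<forall>i\<in>{1..m}. (a i, b i) \<in> ts i)}"

definition exp_rels :: "nat \<Rightarrow> 'a set \<Rightarrow> 'a rel set \<Rightarrow> (nat \<Rightarrow> nat) set \<Rightarrow> (nat \<Rightarrow> 'a) rel set" where
  "exp_rels m \<Gamma> T L = {\<Union>l\<in>L. perm_rel l (tensor m \<Gamma> ts) | ts. \<forall>i\<in>{1..m}. ts i \<in> T}"

end

theory Submission
  imports Defs
begin

text \<open>
  A family of subsets is a generalized base iff every coherent fission \<open>Z\<close> in which its members are
  unions of fibers is complete, so \<open>Z\<close> is arbitrary throughout and the task is to recover structure
  from the relations of \<open>Z\<close>, which are closed under Boolean operations and counting.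

  Start from a product set \<open>B = Q 1 \<times> \<dots> \<times> Q m\<close> visible in \<open>Z\<close> and let \<open>e i\<close> be the tuples that leave
  \<open>B\<close> in coordinate \<open>i\<close> only. Hamming distances show that the partition into the sets \<open>e i\<close> is
  visible, and antisymmetry (which makes the types of pairs leaving \<open>Q i\<close> non-constant) shows that
  the orbits of \<open>L\<close> on pairs of indices are visible. Hence \<open>Z\<close> induces a fission of \<open>Inv(L)\<close> on the
  indices. It is complete as soon as the members of a generalized base of \<open>Inv(L)\<close> are visible, and
  then every single coordinate is visible. Now \<open>Z\<close> induces in each coordinate a fission of the given
  configuration on \<open>\<Gamma>\<close>, and it remains to make a (generalized) base of that visible in every coordinate.

  For generalized bases, encode \<open>P \<subseteq> \<Gamma>\<close> and a set \<open>D\<close> of indices by one product set, with factor \<open>P\<close>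
  in the coordinates from \<open>D\<close> and the symmetric difference of \<open>P\<close> and a fiber \<open>\<Phi>\<close> elsewhere. By antisymmetry
  \<open>card \<Phi>\<close> is odd, so the two factors have different sizes. For bases, two base points \<open>\<beta>\<close>, \<open>\<beta>'\<close> encode
  a set \<open>D\<close> for free: use the tuples with entries \<open>\<beta>\<close> (resp. \<open>\<beta>'\<close>) on \<open>D\<close> and \<open>\<beta>'\<close> (resp. \<open>\<beta>\<close>) off \<open>D\<close>,
  since \<open>(\<beta>, \<beta>')\<close> and \<open>(\<beta>', \<beta>)\<close> have different types. Each further \<open>D\<close> costs one more tuple.
\<close>

section \<open>Relations of a coherent configuration\<close>

text \<open>Encoded through the diagonal so that every closure property of relations applies to sets
  as well. By \<open>unions_of_fibers_iff\<close> these are exactly the unions of fibers; such sets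
  are called visible in \<open>S\<close>.\<close>

definition cc_set :: "'a rel set \<Rightarrow> 'a set \<Rightarrow> bool" where
  "cc_set S A \<longleftrightarrow> cc_relation S (Id_on A)"

lemma cc_relation_Union:
  assumes "\<And>R. R \<in> RR \<Longrightarrow> cc_relation S R"
  shows "cc_relation S (\<Union>RR)"
proof -
  have sub: "\<exists>s\<in>S. p \<in> s \<and> s \<subseteq> R" if "R \<in> RR" "p \<in> R" for R p
    using assms[OF that(1)] that(2) unfolding cc_relation_def by auto
  have "\<Union>RR = \<Union>{s \<in> S. \<exists>R\<in>RR. s \<subseteq> R}" (is "_ = \<Union>?S0")
  proof
    show "\<Union>RR \<subseteq> \<Union>?S0"
    proof
      fix p assume "p \<in> \<Union>RR"
      then obtain R where "R \<in> RR" "p \<in> R" by auto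
      from sub[OF this] obtain s where "s \<in> S" "p \<in> s" "s \<subseteq> R" by (elim bexE conjE)
      then show "p \<in> \<Union>?S0" using \<open>R \<in> RR\<close> by auto
    qed
  qed auto
  moreover have "?S0 \<subseteq> S" by auto
  ultimately show ?thesis unfolding cc_relation_def by (intro exI[of _ ?S0] conjI)
qed

lemma cc_relation_basic: "s \<in> S \<Longrightarrow> cc_relation S s"
  unfolding cc_relation_def by (rule exI[of _ "{s}"]) auto

section \<open>Closure of relations under Boolean operations, composition and counting\<close>

locale coherent =
  fixes \<Omega> :: "'a set" and S :: "'a rel set"
  assumes coherent: "coherent_config \<Omega> S"
begin

lemma finite_points: "finite \<Omega>"
  using coherent by (simp add: coherent_config_def)

lemma part: "partition_on (\<Omega> \<times> \<Omega>) S"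
  using coherent by (simp add: coherent_config_def)

lemma basic_subset: "s \<in> S \<Longrightarrow> s \<subseteq> \<Omega> \<times> \<Omega>"
  using part by (auto simp: partition_on_def)

lemma basic_nonempty: "s \<in> S \<Longrightarrow> s \<noteq> {}"
  using part by (auto simp: partition_on_def)

lemma finite_basic: "finite S"
  by (rule finite_subset[of _ "Pow (\<Omega> \<times> \<Omega>)"]) (use basic_subset finite_points in auto)

lemma ex_basic: "p \<in> \<Omega> \<times> \<Omega> \<Longrightarrow> \<exists>s\<in>S. p \<in> s"
  using part by (auto simp: partition_on_def)

lemma basic_unique: "s \<in> S \<Longrightarrow> t \<in> S \<Longrightarrow> p \<in> s \<Longrightarrow> p \<in> t \<Longrightarrow> s = t"
  using part by (auto simp: partition_on_def disjoint_def)

text \<open>The basic relations are disjoint and cover everything, so a union of them is the same as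
  a saturated set of pairs. Closure properties are checked in this form.\<close>

lemma rel_iff:
  "cc_relation S R \<longleftrightarrow> R \<subseteq> \<Omega> \<times> \<Omega> \<and> (\<forall>s\<in>S. \<forall>p\<in>s. \<forall>q\<in>s. p \<in> R \<longrightarrow> q \<in> R)"
proof
  assume "cc_relation S R"
  then obtain S0 where S0: "S0 \<subseteq> S" "R = \<Union>S0" by (auto simp: cc_relation_def)
  show "R \<subseteq> \<Omega> \<times> \<Omega> \<and> (\<forall>s\<in>S. \<forall>p\<in>s. \<forall>q\<in>s. p \<in> R \<longrightarrow> q \<in> R)"
  proof (intro conjI ballI impI)
    show "R \<subseteq> \<Omega> \<times> \<Omega>" using S0 basic_subset by blast
    fix s p q assume "s \<in> S" "p \<in> s" "q \<in> s" "p \<in> R"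
    then obtain s' where "s' \<in> S0" "p \<in> s'" using S0 by auto
    then have "s' = s" using basic_unique S0 \<open>s \<in> S\<close> \<open>p \<in> s\<close> by blast
    then show "q \<in> R" using S0 \<open>s' \<in> S0\<close> \<open>q \<in> s\<close> by auto
  qed
next
  assume R: "R \<subseteq> \<Omega> \<times> \<Omega> \<and> (\<forall>s\<in>S. \<forall>p\<in>s. \<forall>q\<in>s. p \<in> R \<longrightarrow> q \<in> R)"
  have "R = \<Union>{s\<in>S. s \<subseteq> R}"
  proof
    show "R \<subseteq> \<Union>{s\<in>S. s \<subseteq> R}"
    proof
      fix p assume "p \<in> R"
      then have "p \<in> \<Omega> \<times> \<Omega>" using R by auto
      then obtain s where "s \<in> S" "p \<in> s" using ex_basic by force
      moreover have "s \<subseteq> R" using R \<open>p \<in> R\<close> \<open>s \<in> S\<close> \<open>p \<in> s\<close> by (meson subsetI)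
      ultimately show "p \<in> \<Union>{s\<in>S. s \<subseteq> R}" by blast
    qed
  qed auto
  moreover have "{s\<in>S. s \<subseteq> R} \<subseteq> S" by auto
  ultimately show "cc_relation S R" unfolding cc_relation_def by (intro exI[of _ "{s\<in>S. s \<subseteq> R}"] conjI)
qed

lemma relI: "R \<subseteq> \<Omega> \<times> \<Omega> \<Longrightarrow> (\<And>s p q. s \<in> S \<Longrightarrow> p \<in> s \<Longrightarrow> q \<in> s \<Longrightarrow> p \<in> R \<Longrightarrow> q \<in> R) \<Longrightarrow> cc_relation S R"
  unfolding rel_iff by (intro conjI ballI impI)

lemma relD:
  assumes "cc_relation S R" "s \<in> S" "p \<in> s" "q \<in> s" "p \<in> R"
  shows "q \<in> R"
  using assms(1)[unfolded rel_iff, THEN conjunct2, rule_format, OF assms(2-5)] .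

lemma rel_subset: "cc_relation S R \<Longrightarrow> R \<subseteq> \<Omega> \<times> \<Omega>"
  by (simp add: rel_iff)

lemma rel_full: "cc_relation S (\<Omega> \<times> \<Omega>)"
  using basic_subset by (auto simp: rel_iff)

lemma rel_empty: "cc_relation S {}"
  by (simp add: rel_iff)

lemma rel_Un: "cc_relation S R \<Longrightarrow> cc_relation S R' \<Longrightarrow> cc_relation S (R \<union> R')"
  using cc_relation_Union[of "{R, R'}"] by auto

lemma rel_Int: "cc_relation S R \<Longrightarrow> cc_relation S R' \<Longrightarrow> cc_relation S (R \<inter> R')"
  by (rule relI) (use rel_subset relD in \<open>blast+\<close>)

lemma rel_Diff: "cc_relation S R \<Longrightarrow> cc_relation S R' \<Longrightarrow> cc_relation S (R - R')"
  by (rule relI) (use rel_subset relD in \<open>blast+\<close>)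

lemma rel_UN: "(\<And>i. i \<in> I \<Longrightarrow> cc_relation S (f i)) \<Longrightarrow> cc_relation S (\<Union>i\<in>I. f i)"
  by (rule cc_relation_Union) auto

lemma rel_Id: "cc_relation S (Id_on \<Omega>)"
  using coherent unfolding coherent_config_def cc_relation_def by metis

lemma basic_converse: "s \<in> S \<Longrightarrow> s\<inverse> \<in> S"
  using coherent by (simp add: coherent_config_def)

lemma rel_converse: "cc_relation S R \<Longrightarrow> cc_relation S (R\<inverse>)"
  unfolding rel_iff
proof (intro conjI ballI impI)
  assume R: "R \<subseteq> \<Omega> \<times> \<Omega> \<and> (\<forall>s\<in>S. \<forall>p\<in>s. \<forall>q\<in>s. p \<in> R \<longrightarrow> q \<in> R)"
  then show "R\<inverse> \<subseteq> \<Omega> \<times> \<Omega>" by auto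
  fix s p q assume *: "s \<in> S" "p \<in> s" "q \<in> s" "p \<in> R\<inverse>"
  obtain a b c d where "p = (a,b)" "q = (c,d)" by fastforce
  then have "(b,a) \<in> s\<inverse>" "(d,c) \<in> s\<inverse>" "(b,a) \<in> R" using * by auto
  then have "(d,c) \<in> R" using R basic_converse[OF *(1)] by blast
  then show "q \<in> R\<inverse>" using \<open>q = (c,d)\<close> by simp
qed

lemma basic_card:
  assumes "r \<in> S" "s \<in> S" "t \<in> S" "(a,b) \<in> t" "(a',b') \<in> t"
  shows "card {c. (a,c) \<in> r \<and> (c,b) \<in> s} = card {c. (a',c) \<in> r \<and> (c,b') \<in> s}"
  using coherent assms unfolding coherent_config_def by blast

text \<open>Splitting by the basic relations inside \<open>R\<close> and \<open>R'\<close> gives a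
  sum of intersection numbers. The pieces are disjoint because a pair lies in only one basic
  relation.\<close>

lemma rel_card:
  assumes R: "cc_relation S R" and R': "cc_relation S R'"
    and t: "t \<in> S" "(a,b) \<in> t" "(a',b') \<in> t"
  shows "card {c. (a,c) \<in> R \<and> (c,b) \<in> R'} = card {c. (a',c) \<in> R \<and> (c,b') \<in> R'}"
proof -
  obtain S1 S2 where S1: "S1 \<subseteq> S" "R = \<Union>S1" and S2: "S2 \<subseteq> S" "R' = \<Union>S2"
    using R R' by (auto simp: cc_relation_def)
  have fin: "finite (S1 \<times> S2)" using S1 S2 finite_basic by (meson finite_SigmaI finite_subset)
  have eq: "card {c. (x,c) \<in> R \<and> (c,y) \<in> R'} =
      (\<Sum>(r,s)\<in>S1 \<times> S2. card {c. (x,c) \<in> r \<and> (c,y) \<in> s})" for x y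
  proof -
    let ?f = "\<lambda>(r,s). {c. (x,c) \<in> r \<and> (c,y) \<in> s}"
    have "{c. (x,c) \<in> R \<and> (c,y) \<in> R'} = (\<Union>p\<in>S1 \<times> S2. ?f p)" using S1 S2 by auto
    moreover have "card (\<Union>p\<in>S1 \<times> S2. ?f p) = (\<Sum>p\<in>S1 \<times> S2. card (?f p))"
    proof (rule card_UN_disjoint[OF fin])
      show "\<forall>p\<in>S1 \<times> S2. finite (?f p)"
      proof
        fix p assume "p \<in> S1 \<times> S2"
        then have "?f p \<subseteq> \<Omega>" using S1 S2 basic_subset by fastforce
        then show "finite (?f p)" using finite_points finite_subset by blast
      qed
      show "\<forall>p\<in>S1 \<times> S2. \<forall>q\<in>S1 \<times> S2. p \<noteq> q \<longrightarrow> ?f p \<inter> ?f q = {}"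
      proof (intro ballI impI equals0I)
        fix p q c assume *: "p \<in> S1 \<times> S2" "q \<in> S1 \<times> S2" "p \<noteq> q" "c \<in> ?f p \<inter> ?f q"
        obtain r s r' s' where "p = (r,s)" "q = (r',s')" by fastforce
        then have "r = r'" "s = s'"
          using * S1 S2 basic_unique[of r r' "(x,c)"] basic_unique[of s s' "(c,y)"] by auto
        then show False using * \<open>p = (r,s)\<close> \<open>q = (r',s')\<close> by simp
      qed
    qed
    ultimately show ?thesis by (simp add: case_prod_unfold)
  qed
  show ?thesis unfolding eq
  proof (rule sum.cong[OF refl], clarify)
    fix r s assume "r \<in> S1" "s \<in> S2"
    then show "card {c. (a,c) \<in> r \<and> (c,b) \<in> s} = card {c. (a',c) \<in> r \<and> (c,b') \<in> s}"
      using basic_card S1 S2 t by blast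
  qed
qed

text \<open>The counted number is constant on each basic relation by \<open>rel_card\<close>, so any
  property \<open>P\<close> of it cuts out a relation. Composition, degrees and the counting
  conditions of the induced configurations all rest on this.\<close>

lemma rel_count:
  assumes "cc_relation S R" "cc_relation S R'"
  shows "cc_relation S {(a,b). a \<in> \<Omega> \<and> b \<in> \<Omega> \<and> P (card {c. (a,c) \<in> R \<and> (c,b) \<in> R'})}"
  unfolding rel_iff
proof (intro conjI ballI impI)
  fix t p q
  assume *: "t \<in> S" "p \<in> t" "q \<in> t" "p \<in> {(a,b). a \<in> \<Omega> \<and> b \<in> \<Omega> \<and> P (card {c. (a,c) \<in> R \<and> (c,b) \<in> R'})}"
  obtain a b a' b' where "p = (a,b)" "q = (a',b')" by fastforce
  then show "q \<in> {(a,b). a \<in> \<Omega> \<and> b \<in> \<Omega> \<and> P (card {c. (a,c) \<in> R \<and> (c,b) \<in> R'})}"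
    using rel_card[OF assms *(1), of a b a' b'] * basic_subset[OF *(1)] by auto
qed auto

lemma rel_relcomp:
  assumes "cc_relation S R" "cc_relation S R'"
  shows "cc_relation S (R O R')"
proof -
  have "R O R' = {(a,b). a \<in> \<Omega> \<and> b \<in> \<Omega> \<and> card {c. (a,c) \<in> R \<and> (c,b) \<in> R'} \<noteq> 0}" (is "_ = ?A")
  proof -
    have fin: "finite {c. (a,c) \<in> R \<and> (c,b) \<in> R'}" for a b
      by (rule finite_subset[OF _ finite_points]) (use rel_subset[OF assms(1)] in auto)
    show ?thesis using rel_subset[OF assms(1)] rel_subset[OF assms(2)] fin
      by (auto simp: relcomp_unfold card_eq_0_iff)
  qed
  then show ?thesis using rel_count[OF assms, of "\<lambda>n. n \<noteq> 0"] by simp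
qed

lemma set_subset: "cc_set S A \<Longrightarrow> A \<subseteq> \<Omega>"
  using rel_subset unfolding cc_set_def by blast

text \<open>A point is in the domain iff some path along \<open>R\<close> and back returns to it, so
  the domain is read off the diagonal of a composition.\<close>

lemma set_Domain: "cc_relation S R \<Longrightarrow> cc_set S (Domain R)"
proof -
  assume R: "cc_relation S R"
  have "Id_on (Domain R) = Id_on \<Omega> \<inter> (R O R\<inverse>)" using rel_subset[OF R] by auto
  then show ?thesis unfolding cc_set_def
    using rel_Int[OF rel_Id rel_relcomp[OF R rel_converse[OF R]]] by simp
qed

lemma set_Range: "cc_relation S R \<Longrightarrow> cc_set S (Range R)"
  using set_Domain[of "R\<inverse>"] rel_converse by simp

text \<open>The out-degree of \<open>a\<close> is the number of closed paths from \<open>a\<close>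
  along \<open>R\<close> and back, which \<open>rel_count\<close> counts on the diagonal.\<close>

lemma set_degree: "cc_relation S R \<Longrightarrow> cc_set S {a \<in> \<Omega>. P (card (R `` {a}))}"
proof -
  assume R: "cc_relation S R"
  have "Id_on {a \<in> \<Omega>. P (card (R `` {a}))}
      = Id_on \<Omega> \<inter> {(a,b). a \<in> \<Omega> \<and> b \<in> \<Omega> \<and> P (card {c. (a,c) \<in> R \<and> (c,b) \<in> R\<inverse>})}"
    by (auto simp: Image_def Id_on_def)
  then show ?thesis unfolding cc_set_def
    using rel_Int[OF rel_Id rel_count[OF R rel_converse[OF R]]] by simp
qed

lemma set_full: "cc_set S \<Omega>"
  unfolding cc_set_def by (rule rel_Id)

lemma set_Un: "cc_set S A \<Longrightarrow> cc_set S B \<Longrightarrow> cc_set S (A \<union> B)"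
  and set_Int: "cc_set S A \<Longrightarrow> cc_set S B \<Longrightarrow> cc_set S (A \<inter> B)"
  and set_Diff: "cc_set S A \<Longrightarrow> cc_set S B \<Longrightarrow> cc_set S (A - B)"
proof -
  assume *: "cc_set S A" "cc_set S B"
  have "Id_on (A \<union> B) = Id_on A \<union> Id_on B" "Id_on (A \<inter> B) = Id_on A \<inter> Id_on B"
    "Id_on (A - B) = Id_on A - Id_on B" by auto
  then show "cc_set S (A \<union> B)" "cc_set S (A \<inter> B)" "cc_set S (A - B)"
    using * rel_Un rel_Int rel_Diff unfolding cc_set_def by simp_all
qed

lemma rel_restrict:
  assumes "cc_set S A" "cc_relation S R" "cc_set S B"
  shows "cc_relation S (R \<inter> A \<times> B)"
proof -
  have "R \<inter> A \<times> B = Id_on A O R O Id_on B" by auto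
  then show ?thesis using rel_relcomp assms unfolding cc_set_def by metis
qed

lemma rel_Times: "cc_set S A \<Longrightarrow> cc_set S B \<Longrightarrow> cc_relation S (A \<times> B)"
  using rel_restrict[OF _ rel_full, of A B] set_subset by (simp add: Int_absorb1 Sigma_mono)

text \<open>A basic relation inside a diagonal is the diagonal of its own domain, so that domain is
  a fiber.\<close>

lemma unions_of_fibers_iff: "unions_of_fibers S PP \<longleftrightarrow> (\<forall>P\<in>PP. cc_set S P)"
proof -
  have "(\<exists>F \<subseteq> fibers S. P = \<Union>F) \<longleftrightarrow> cc_set S P" for P
  proof
    assume "\<exists>F \<subseteq> fibers S. P = \<Union>F"
    then obtain F where F: "F \<subseteq> fibers S" "P = \<Union>F" by blast
    then have "Id_on P = \<Union>(Id_on ` F)" "Id_on ` F \<subseteq> S" by (auto simp: fibers_def)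
    then show "cc_set S P" unfolding cc_set_def cc_relation_def by blast
  next
    assume "cc_set S P"
    then obtain S0 where S0: "S0 \<subseteq> S" "Id_on P = \<Union>S0" unfolding cc_set_def cc_relation_def by blast
    have *: "Id_on (Domain s) = s" if "s \<in> S0" for s
    proof -
      have "s \<subseteq> Id_on P" using S0 that by auto
      then show ?thesis by (auto simp: Id_on_def)
    qed
    have "Domain ` S0 \<subseteq> fibers S" using * S0 by (auto simp: fibers_def)
    moreover have "P = \<Union>(Domain ` S0)"
    proof -
      have "P = Domain (Id_on P)" by auto
      also have "\<dots> = \<Union>(Domain ` S0)" unfolding S0(2) by auto
      finally show ?thesis .
    qed
    ultimately show "\<exists>F \<subseteq> fibers S. P = \<Union>F" by blast
  qed
  then show ?thesis by (simp add: unions_of_fibers_def)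
qed

text \<open>Visible points make every rectangle \<open>{a} \<times> {b}\<close> a relation, which
  leaves no room for a second pair in a basic relation.\<close>

lemma complete_iff: "cc_complete S \<longleftrightarrow> (\<forall>a\<in>\<Omega>. cc_set S {a})"
proof
  assume c: "cc_complete S"
  show "\<forall>a\<in>\<Omega>. cc_set S {a}"
  proof
    fix a assume "a \<in> \<Omega>"
    then obtain s where "s \<in> S" "(a,a) \<in> s" using ex_basic by blast
    then have "s = Id_on {a}" using c unfolding cc_complete_def by fastforce
    then show "cc_set S {a}" using cc_relation_basic \<open>s \<in> S\<close> unfolding cc_set_def by metis
  qed
next
  assume *: "\<forall>a\<in>\<Omega>. cc_set S {a}"
  show "cc_complete S" unfolding cc_complete_def
  proof
    fix s assume s: "s \<in> S"
    then obtain a b where ab: "(a,b) \<in> s" using basic_nonempty by fastforce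
    then have "a \<in> \<Omega>" "b \<in> \<Omega>" using basic_subset s by auto
    then have "cc_relation S ({a} \<times> {b})" using * rel_Times by blast
    then have "s \<subseteq> {(a,b)}" using s ab unfolding rel_iff by fastforce
    then show "\<exists>x. s = {x}" using ab by blast
  qed
qed

end

section \<open>Generalized bases as completeness of all admissible fissions; minimal sizes\<close>

lemma coherent_discrete:
  assumes "finite \<Omega>"
  shows "coherent_config \<Omega> ((\<lambda>p. {p}) ` (\<Omega> \<times> \<Omega>))"
proof -
  let ?S = "(\<lambda>p. {p}) ` (\<Omega> \<times> \<Omega>)"
  have "\<exists>S0\<subseteq>?S. \<Union>S0 = Id_on \<Omega>"
    by (rule exI[of _ "(\<lambda>p. {p}) ` Id_on \<Omega>"]) auto
  moreover have "partition_on (\<Omega> \<times> \<Omega>) ?S" by (auto simp: partition_on_def disjoint_def)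
  moreover have "\<forall>s\<in>?S. s\<inverse> \<in> ?S" by auto
  ultimately show ?thesis using assms unfolding coherent_config_def by auto
qed

text \<open>No smallest fission has to be constructed: if every admissible fission is complete, the
  discrete configuration is the smallest one, because in a complete configuration every set of pairs
  is a relation.\<close>

lemma generalized_base_iff:
  assumes "finite \<Omega>" and sub: "S \<subseteq> Pow (\<Omega> \<times> \<Omega>)"
  shows "generalized_base \<Omega> S PP \<longleftrightarrow> PP \<subseteq> Pow \<Omega> \<and>
    (\<forall>Z. fission \<Omega> S Z \<and> (\<forall>P\<in>PP. cc_set Z P) \<longrightarrow> cc_complete Z)"
proof
  assume g: "generalized_base \<Omega> S PP"
  then obtain S' where S': "is_Pi_fission \<Omega> S PP S'" "cc_complete S'" and P: "PP \<subseteq> Pow \<Omega>"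
    unfolding generalized_base_def by blast
  interpret S': coherent \<Omega> S' using S' by unfold_locales (auto simp: is_Pi_fission_def fission_def)
  show "PP \<subseteq> Pow \<Omega> \<and> (\<forall>Z. fission \<Omega> S Z \<and> (\<forall>P\<in>PP. cc_set Z P) \<longrightarrow> cc_complete Z)"
  proof (intro conjI allI impI P)
    fix Z assume Z: "fission \<Omega> S Z \<and> (\<forall>P\<in>PP. cc_set Z P)"
    interpret Z: coherent \<Omega> Z using Z by unfold_locales (auto simp: fission_def)
    have "unions_of_fibers Z PP" using Z Z.unions_of_fibers_iff by blast
    then have "cc_relation S' r \<Longrightarrow> cc_relation Z r" for r
      using S' Z unfolding is_Pi_fission_def by blast
    then show "cc_complete Z" using S'(2) unfolding Z.complete_iff S'.complete_iff cc_set_def by blast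
  qed
next
  assume *: "PP \<subseteq> Pow \<Omega> \<and> (\<forall>Z. fission \<Omega> S Z \<and> (\<forall>P\<in>PP. cc_set Z P) \<longrightarrow> cc_complete Z)"
  let ?S = "(\<lambda>p. {p}) ` (\<Omega> \<times> \<Omega>)"
  interpret D: coherent \<Omega> ?S using coherent_discrete[OF assms(1)] by unfold_locales
  have all: "cc_relation ?S r \<longleftrightarrow> r \<subseteq> \<Omega> \<times> \<Omega>" for r unfolding D.rel_iff by auto
  have "is_Pi_fission \<Omega> S PP ?S"
    unfolding is_Pi_fission_def
  proof (intro conjI allI impI)
    show "fission \<Omega> S ?S" unfolding fission_def all
      using D.coherent sub unfolding cc_relation_def by blast
    show "unions_of_fibers ?S PP" unfolding D.unions_of_fibers_iff cc_set_def all using * by auto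
    fix Z r assume Z: "fission \<Omega> S Z \<and> unions_of_fibers Z PP" and r: "cc_relation ?S r"
    interpret Z: coherent \<Omega> Z using Z by unfold_locales (auto simp: fission_def)
    have c: "cc_complete Z" using * Z Z.unions_of_fibers_iff by blast
    have "q = p" if "s \<in> Z" "p \<in> s" "q \<in> s" for s p q
      using c that unfolding cc_complete_def by fastforce
    then show "cc_relation Z r" using r unfolding all Z.rel_iff by blast
  qed
  moreover have "cc_complete ?S" by (auto simp: cc_complete_def)
  ultimately show "generalized_base \<Omega> S PP" using * unfolding generalized_base_def by blast
qed

text \<open>Makes the sets minimized by \<open>gb\<close> and \<open>bnum\<close> non-empty, so that
  the \<open>LEAST\<close> operators attain their values.\<close>

lemma singletons_generalized_base:
  assumes "finite \<Omega>" "S \<subseteq> Pow (\<Omega> \<times> \<Omega>)"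
  shows "generalized_base \<Omega> S ((\<lambda>x. {x}) ` \<Omega>)"
  unfolding generalized_base_iff[OF assms]
proof (intro conjI allI impI)
  fix Z assume Z: "fission \<Omega> S Z \<and> (\<forall>P\<in>(\<lambda>x. {x}) ` \<Omega>. cc_set Z P)"
  interpret Z: coherent \<Omega> Z using Z by unfold_locales (auto simp: fission_def)
  show "cc_complete Z" using Z unfolding Z.complete_iff by blast
qed auto

lemma gb_attained:
  assumes "finite \<Omega>" "S \<subseteq> Pow (\<Omega> \<times> \<Omega>)"
  obtains PP where "generalized_base \<Omega> S PP" "card PP = gb \<Omega> S"
proof -
  have "\<exists>n PP. generalized_base \<Omega> S PP \<and> card PP = n"
    using singletons_generalized_base[OF assms] by blast
  from LeastI_ex[OF this] show ?thesis using that unfolding gb_def by blast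
qed

lemma gb_le: "generalized_base \<Omega> S PP \<Longrightarrow> gb \<Omega> S \<le> card PP"
  unfolding gb_def by (rule Least_le) blast

lemma bnum_attained:
  assumes "finite \<Omega>" "S \<subseteq> Pow (\<Omega> \<times> \<Omega>)"
  obtains B where "cc_base \<Omega> S B" "card B = bnum \<Omega> S"
proof -
  have "\<exists>n B. cc_base \<Omega> S B \<and> card B = n"
    using singletons_generalized_base[OF assms] unfolding cc_base_def by blast
  from LeastI_ex[OF this] show ?thesis using that unfolding bnum_def by blast
qed

lemma bnum_le: "cc_base \<Omega> S B \<Longrightarrow> bnum \<Omega> S \<le> card B"
  unfolding bnum_def by (rule Least_le) blast

text \<open>The basic relations are the atoms of \<open>\<R>\<close>; the counting condition is only needed for atoms.\<close>

lemma coherent_of_algebra: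
  fixes \<R> :: "'a rel set"
  assumes fin: "finite \<Omega>" and sub: "\<And>R. R \<in> \<R> \<Longrightarrow> R \<subseteq> \<Omega> \<times> \<Omega>"
    and full: "\<Omega> \<times> \<Omega> \<in> \<R>" and Id: "Id_on \<Omega> \<in> \<R>"
    and Diff: "\<And>R R'. R \<in> \<R> \<Longrightarrow> R' \<in> \<R> \<Longrightarrow> R - R' \<in> \<R>"
    and conv: "\<And>R. R \<in> \<R> \<Longrightarrow> R\<inverse> \<in> \<R>"
    and count: "\<And>R R' t a b a' b'. R \<in> \<R> \<Longrightarrow> R' \<in> \<R> \<Longrightarrow> t \<in> \<R> \<Longrightarrow>
      (\<And>Q. Q \<in> \<R> \<Longrightarrow> R \<subseteq> Q \<or> R \<inter> Q = {}) \<Longrightarrow>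
      (\<And>Q. Q \<in> \<R> \<Longrightarrow> t \<subseteq> Q \<or> t \<inter> Q = {}) \<Longrightarrow> (a,b) \<in> t \<Longrightarrow> (a',b') \<in> t \<Longrightarrow>
      card {c. (a,c) \<in> R \<and> (c,b) \<in> R'} = card {c. (a',c) \<in> R \<and> (c,b') \<in> R'}"
  obtains S where "coherent_config \<Omega> S" "\<And>R. cc_relation S R \<longleftrightarrow> R \<in> \<R>"
proof -
  have Int: "R \<inter> R' \<in> \<R>" if "R \<in> \<R>" "R' \<in> \<R>" for R R'
  proof -
    have "R \<inter> R' = R - (R - R')" by blast
    then show ?thesis using Diff that by simp
  qed
  have Un: "R \<union> R' \<in> \<R>" if "R \<in> \<R>" "R' \<in> \<R>" for R R'
  proof -
    have "R \<union> R' = \<Omega> \<times> \<Omega> - ((\<Omega> \<times> \<Omega> - R) \<inter> (\<Omega> \<times> \<Omega> - R'))" using sub that by blast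
    then show ?thesis using Diff Int full that by simp
  qed
  have empty: "{} \<in> \<R>" using Diff[OF full full] by simp
  have fR: "finite \<R>" by (rule finite_subset[of _ "Pow (\<Omega> \<times> \<Omega>)"]) (use sub fin in auto)
  define atm where "atm p = \<Inter>{R \<in> \<R>. p \<in> R}" for p
  have INT: "\<Inter>A \<in> \<R>" if "finite A" "A \<noteq> {}" "A \<subseteq> \<R>" for A
    using that by (induction rule: finite_ne_induct) (auto intro: Int)
  have atm_in: "atm p \<in> \<R>" if "p \<in> \<Omega> \<times> \<Omega>" for p
    unfolding atm_def by (rule INT) (use fR full that in auto)
  have mem: "p \<in> atm p" for p by (simp add: atm_def)
  have atom: "atm p \<subseteq> Q \<or> atm p \<inter> Q = {}" if p: "p \<in> \<Omega> \<times> \<Omega>" and Q: "Q \<in> \<R>" for p Q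
  proof (cases "p \<in> Q")
    case True then show ?thesis using Q by (auto simp: atm_def)
  next
    case False
    then have "\<Omega> \<times> \<Omega> - Q \<in> {R \<in> \<R>. p \<in> R}" using p Diff[OF full Q] by auto
    then show ?thesis unfolding atm_def by blast
  qed
  have atm_eq: "atm q = atm p" if p: "p \<in> \<Omega> \<times> \<Omega>" and q: "q \<in> atm p" for p q
  proof -
    have q': "q \<in> \<Omega> \<times> \<Omega>" using sub[OF atm_in[OF p]] q by blast
    have "atm p \<subseteq> atm q" using atom[OF p atm_in[OF q']] mem[of q] q by blast
    moreover have "atm q \<subseteq> atm p" using atom[OF q' atm_in[OF p]] mem[of q] q by blast
    ultimately show ?thesis by blast
  qed
  define S where "S = atm ` (\<Omega> \<times> \<Omega>)"
  have part: "partition_on (\<Omega> \<times> \<Omega>) S"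
  proof (rule partition_onI)
    show "\<Union>S = \<Omega> \<times> \<Omega>" unfolding S_def using mem sub[OF atm_in] by blast
    fix p q assume "p \<in> S" "q \<in> S" "p \<noteq> q"
    then obtain x y where "x \<in> \<Omega> \<times> \<Omega>" "y \<in> \<Omega> \<times> \<Omega>" "p = atm x" "q = atm y"
      by (auto simp: S_def)
    then show "disjnt p q" unfolding disjnt_def using atm_eq \<open>p \<noteq> q\<close> by (metis disjoint_iff)
  next
    show "{} \<notin> S" using mem unfolding S_def by fastforce
  qed
  have relR: "(\<exists>S0\<subseteq>S. R = \<Union>S0) \<longleftrightarrow> R \<in> \<R>" for R
  proof
    assume "\<exists>S0\<subseteq>S. R = \<Union>S0"
    then obtain S0 where S0: "S0 \<subseteq> S" "R = \<Union>S0" by blast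
    have sR: "S0 \<subseteq> \<R>" using S0 atm_in unfolding S_def by blast
    then have "finite S0" using fR finite_subset by blast
    then have "\<Union>S0 \<in> \<R>" using sR by (induction) (auto intro: Un empty)
    then show "R \<in> \<R>" using S0 by simp
  next
    assume R: "R \<in> \<R>"
    have "R = \<Union>(atm ` R)" using mem R by (auto simp: atm_def)
    moreover have "atm ` R \<subseteq> S" using sub[OF R] unfolding S_def by blast
    ultimately show "\<exists>S0\<subseteq>S. R = \<Union>S0" by blast
  qed
  have "coherent_config \<Omega> S"
    unfolding coherent_config_def
  proof (intro conjI fin part ballI allI impI)
    show "\<exists>S0\<subseteq>S. \<Union>S0 = Id_on \<Omega>" using relR[of "Id_on \<Omega>"] Id by metis
  next
    fix s assume "s \<in> S"
    then obtain p where p: "p \<in> \<Omega> \<times> \<Omega>" "s = atm p" by (auto simp: S_def)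
    obtain a b where ab: "p = (a,b)" by fastforce
    let ?q = "(b,a)"
    have q: "?q \<in> \<Omega> \<times> \<Omega>" using p ab by auto
    \<comment> \<open>The atom of the reversed pair lies in every member of \<open>\<R>\<close>
      containing that pair, in particular in the converse of \<open>s\<close>; exchanging the roles
      of the two pairs gives the other inclusion.\<close>
    have "atm ?q \<subseteq> s\<inverse>" unfolding atm_def using conv[OF atm_in[OF p(1)]] p mem[of p] ab by auto
    moreover have "atm p \<subseteq> (atm ?q)\<inverse>" unfolding atm_def[of p] using conv[OF atm_in[OF q]] mem[of ?q] ab by auto
    ultimately have "s\<inverse> = atm ?q" using p by auto
    then show "s\<inverse> \<in> S" using q unfolding S_def by blast
  next
    fix r s t a b a' b'
    assume *: "r \<in> S" "s \<in> S" "t \<in> S" "(a,b) \<in> t" "(a',b') \<in> t"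
    show "card {c. (a,c) \<in> r \<and> (c,b) \<in> s} = card {c. (a',c) \<in> r \<and> (c,b') \<in> s}"
      by (rule count[of r s t]) (use * atom atm_in in \<open>auto simp: S_def\<close>)
  qed
  then show ?thesis using that relR unfolding cc_relation_def by blast
qed

section \<open>Antisymmetric configurations and tuples\<close>

text \<open>The index set splits into pairs \<open>{t, \<sigma> t}\<close>, each contributing twice
  \<open>g t\<close>; the induction removes one pair at a time.\<close>

lemma even_sum_involution:
  fixes g :: "'b \<Rightarrow> nat"
  assumes "finite M"
    and "\<And>t. t \<in> M \<Longrightarrow> \<sigma> t \<in> M \<and> \<sigma> t \<noteq> t \<and> \<sigma> (\<sigma> t) = t \<and> g (\<sigma> t) = g t"
  shows "even (\<Sum>t\<in>M. g t)"
  using assms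
proof (induction M rule: finite_psubset_induct)
  case (psubset M)
  show ?case
  proof (cases "M = {}")
    case False
    then obtain t where t: "t \<in> M" by blast
    have st: "\<sigma> t \<in> M" "\<sigma> t \<noteq> t" "\<sigma> (\<sigma> t) = t" "g (\<sigma> t) = g t" using psubset.prems[OF t] by auto
    let ?M = "M - {t, \<sigma> t}"
    have "even (\<Sum>x\<in>?M. g x)"
    proof (rule psubset.IH)
      show "?M \<subset> M" using t by blast
      fix x assume x: "x \<in> ?M"
      then have "\<sigma> x \<noteq> t" "\<sigma> x \<noteq> \<sigma> t" using psubset.prems[of x] st by auto
      then show "\<sigma> x \<in> ?M \<and> \<sigma> x \<noteq> x \<and> \<sigma> (\<sigma> x) = x \<and> g (\<sigma> x) = g x"
        using psubset.prems[of x] x by blast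
    qed
    moreover have "(\<Sum>x\<in>M. g x) = (\<Sum>x\<in>?M. g x) + (\<Sum>x\<in>{t, \<sigma> t}. g x)"
      using sum.subset_diff[of "{t, \<sigma> t}" M g] psubset.hyps t st by auto
    ultimately show ?thesis using st by simp
  qed simp
qed

context coherent
begin

text \<open>The out-degree counts closed paths along \<open>t\<close> and back, hence it is an
  intersection number of the diagonal type \<open>s\<close>.\<close>

lemma degree_eq:
  assumes "s \<in> S" "(a,a) \<in> s" "(b,b) \<in> s" "t \<in> S"
  shows "card (t `` {a}) = card (t `` {b})"
  using basic_card[OF assms(4) basic_converse[OF assms(4)] assms(1-3)] by (simp add: Image_def)

lemma basic_Id: "t \<in> S \<Longrightarrow> (a,a) \<in> t \<Longrightarrow> t \<subseteq> Id_on \<Omega>"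
  using relD[OF rel_Id] basic_subset by blast

lemma antisymmetric_basic:
  assumes "cc_antisymmetric \<Omega> S" "t \<in> S" "(a,b) \<in> t" "(b,a) \<in> t"
  shows "a = b"
proof -
  have "t = t\<inverse>" using basic_unique[OF assms(2) basic_converse[OF assms(2)], of "(a,b)"] assms by simp
  then show ?thesis using assms unfolding cc_antisymmetric_def by blast
qed

text \<open>Suppose all pairs from outside \<open>A\<close> into \<open>A\<close> have one type
  \<open>t\<close>. Then a point \<open>x\<close> outside \<open>A\<close> has out-degree at least
  \<open>card A\<close> in \<open>t\<close>, whereas a point \<open>a\<close> of \<open>A\<close>
  has out-degree below \<open>card A\<close>. This is absurd if \<open>x\<close> and
  \<open>a\<close> lie in the same fiber, and such points exist because \<open>A\<close> is not a
  union of fibers.\<close>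

lemma two_types:
  assumes anti: "cc_antisymmetric \<Omega> S" and A: "A \<subseteq> \<Omega>" "\<not> cc_set S A"
  obtains x x' y y' where "x \<in> \<Omega> - A" "x' \<in> A" "y \<in> \<Omega> - A" "y' \<in> A"
    "\<And>t. t \<in> S \<Longrightarrow> (x,x') \<in> t \<Longrightarrow> (y,y') \<notin> t"
proof -
  note witness = that
  have "\<exists>s\<in>S. \<exists>p\<in>s. \<exists>q\<in>s. p \<in> Id_on A \<and> q \<notin> Id_on A"
  proof (rule ccontr)
    assume "\<not> ?thesis"
    then have "cc_relation S (Id_on A)" using A by (intro relI) auto
    then show False using A by (simp add: cc_set_def)
  qed
  then obtain s a q where s: "s \<in> S" "(a,a) \<in> s" "a \<in> A" "q \<in> s" "q \<notin> Id_on A" by auto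
  have "s \<subseteq> Id_on \<Omega>" using basic_Id s by blast
  then obtain x where x: "q = (x,x)" "x \<in> \<Omega>" "x \<notin> A" using s by (cases q) auto
  show ?thesis
  proof (rule ccontr)
    assume "\<not> thesis"
    then have all: "\<exists>t\<in>S. (u,u') \<in> t \<and> (v,v') \<in> t"
      if "u \<in> \<Omega> - A" "u' \<in> A" "v \<in> \<Omega> - A" "v' \<in> A" for u u' v v'
      using that witness by blast
    obtain t where t: "t \<in> S" "(x,a) \<in> t" using all[of x a x a] x s by auto
    have one: "(v,v') \<in> t" if "v \<in> \<Omega> - A" "v' \<in> A" for v v'
      using all[of x a v v'] that x s basic_unique[OF t(1) _ t(2)] by auto
    have "x \<noteq> a" using x s by auto
    have "A \<subseteq> t `` {x}" using one x by auto
    then have 1: "card A \<le> card (t `` {x})"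
      by (rule card_mono[rotated]) (rule finite_subset[OF _ finite_points], use basic_subset[OF t(1)] in auto)
    have "t `` {a} \<subseteq> A - {a}"
    proof
      fix z assume "z \<in> t `` {a}"
      then have z: "(a,z) \<in> t" by simp
      then have "z \<in> \<Omega>" using basic_subset t by auto
      have "z \<noteq> a" using z basic_Id[OF t(1)] t \<open>x \<noteq> a\<close> by auto
      moreover have "z \<in> A"
      proof (rule ccontr)
        assume "z \<notin> A"
        then have "(z,a) \<in> t" using one \<open>z \<in> \<Omega>\<close> s by blast
        then show False using antisymmetric_basic[OF anti t(1) z] \<open>z \<noteq> a\<close> by simp
      qed
      ultimately show "z \<in> A - {a}" by simp
    qed
    moreover have "finite A" using A finite_points finite_subset by blast
    ultimately have "card (t `` {a}) < card A"
      using s by (metis card_Diff1_less card_mono finite_Diff le_less_trans)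
    then show False using 1 degree_eq[OF s(1,2) _ t(1), of x] s x by simp
  qed
qed

text \<open>The non-diagonal basic relations inside \<open>\<Phi> \<times> \<Phi>\<close> pair off
  as \<open>t\<close> and its converse, which are distinct by antisymmetry and have equal degrees.
  Their degrees sum to \<open>card \<Phi> - 1\<close>, which is therefore even.\<close>

lemma antisymmetric_odd_fiber:
  assumes anti: "cc_antisymmetric \<Omega> S" and \<Phi>: "Id_on \<Phi> \<in> S"
  shows "odd (card \<Phi>)"
proof -
  have set: "cc_set S \<Phi>" using cc_relation_basic[OF \<Phi>] by (simp add: cc_set_def)
  have fin: "finite \<Phi>" using set_subset[OF set] finite_points finite_subset by blast
  obtain x where x: "x \<in> \<Phi>" using basic_nonempty[OF \<Phi>] by auto
  define M where "M = {t \<in> S. t \<subseteq> \<Phi> \<times> \<Phi> \<and> \<not> t \<subseteq> Id_on \<Omega>}"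
  have deg: "card t = card \<Phi> * card (t `` {x})" if "t \<in> S" "t \<subseteq> \<Phi> \<times> \<Phi>" for t
  proof -
    have "t = Sigma \<Phi> (\<lambda>a. t `` {a})" using that by auto
    moreover have "card (Sigma \<Phi> (\<lambda>a. t `` {a})) = (\<Sum>a\<in>\<Phi>. card (t `` {a}))"
      by (rule card_SigmaI[OF fin]) (use that in \<open>auto intro!: finite_subset[OF _ fin]\<close>)
    moreover have "\<dots> = (\<Sum>a\<in>\<Phi>. card (t `` {x}))"
      by (rule sum.cong) (use degree_eq[OF \<Phi> _ _ that(1)] x in auto)
    ultimately show ?thesis by simp
  qed
  have fM: "finite M" using finite_basic by (simp add: M_def)
  have "even (\<Sum>t\<in>M. card (t `` {x}))"
  proof (rule even_sum_involution[OF fM, where \<sigma> = converse])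
    fix t assume "t \<in> M"
    then have t: "t \<in> S" "t \<subseteq> \<Phi> \<times> \<Phi>" "\<not> t \<subseteq> Id_on \<Omega>" by (auto simp: M_def)
    have c: "t\<inverse> \<in> S" "t\<inverse> \<subseteq> \<Phi> \<times> \<Phi>" "\<not> t\<inverse> \<subseteq> Id_on \<Omega>" using basic_converse t by auto
    \<comment> \<open>Double counting: \<open>t\<close> and its converse have equally many pairs,
      and both have constant out-degree on \<open>\<Phi>\<close>.\<close>
    have "card \<Phi> * card (t\<inverse> `` {x}) = card \<Phi> * card (t `` {x})"
      using deg[OF t(1,2)] deg[OF c(1,2)] by auto
    then have "card (t\<inverse> `` {x}) = card (t `` {x})" using x fin by auto
    then show "t\<inverse> \<in> M \<and> t\<inverse> \<noteq> t \<and> (t\<inverse>)\<inverse> = t \<and> card (t\<inverse> `` {x}) = card (t `` {x})"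
      using c t anti unfolding M_def cc_antisymmetric_def by auto
  qed
  moreover have "card (\<Phi> - {x}) = (\<Sum>t\<in>M. card (t `` {x}))"
  proof -
    have "\<Phi> - {x} = (\<Union>t\<in>M. t `` {x})"
    proof (intro equalityI subsetI)
      fix y assume y: "y \<in> \<Phi> - {x}"
      then obtain t where t: "t \<in> S" "(x,y) \<in> t" using ex_basic[of "(x,y)"] x set_subset[OF set] by auto
      then have "t \<subseteq> \<Phi> \<times> \<Phi>" using relD[OF rel_Times[OF set set] t(1,2)] x y by blast
      then show "y \<in> (\<Union>t\<in>M. t `` {x})" using t y unfolding M_def by auto
    next
      fix y assume "y \<in> (\<Union>t\<in>M. t `` {x})"
      then obtain t where t: "t \<in> S" "t \<subseteq> \<Phi> \<times> \<Phi>" "\<not> t \<subseteq> Id_on \<Omega>" "(x,y) \<in> t" by (auto simp: M_def)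
      then show "y \<in> \<Phi> - {x}" using basic_Id[OF t(1)] by auto
    qed
    moreover have "card (\<Union>t\<in>M. t `` {x}) = (\<Sum>t\<in>M. card (t `` {x}))"
    proof (rule card_UN_disjoint[OF fM])
      show "\<forall>t\<in>M. finite (t `` {x})" 
      proof
        fix t assume "t \<in> M"
        then have "t `` {x} \<subseteq> \<Phi>" by (auto simp: M_def)
        then show "finite (t `` {x})" using fin finite_subset by blast
      qed
      show "\<forall>s\<in>M. \<forall>t\<in>M. s \<noteq> t \<longrightarrow> s `` {x} \<inter> t `` {x} = {}"
        using basic_unique unfolding M_def by blast
    qed
    ultimately show ?thesis by simp
  qed
  moreover have "card \<Phi> = Suc (card (\<Phi> - {x}))" using card.remove[OF fin x] .
  ultimately show ?thesis by simp
qed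

end

text \<open>The size of the symmetric difference is
  \<open>card P + card \<Phi> - 2 * card (P \<inter> \<Phi>)\<close>, which differs from
  \<open>card P\<close> in parity.\<close>

lemma card_sym_diff_odd:
  assumes "finite P" "finite \<Phi>" "odd (card \<Phi>)"
  shows "card ((P - \<Phi>) \<union> (\<Phi> - P)) \<noteq> card P"
proof
  assume eq: "card ((P - \<Phi>) \<union> (\<Phi> - P)) = card P"
  have "card ((P - \<Phi>) \<union> (\<Phi> - P)) = card (P - \<Phi>) + card (\<Phi> - P)"
    by (rule card_Un_disjoint) (use assms in auto)
  moreover have "card P = card (P - \<Phi>) + card (P \<inter> \<Phi>)"
    using card_Diff_subset_Int[of P \<Phi>] card_mono[OF assms(1), of "P \<inter> \<Phi>"] assms by simp
  moreover have "card \<Phi> = card (\<Phi> - P) + card (P \<inter> \<Phi>)"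
    using card_Diff_subset_Int[of \<Phi> P] card_mono[OF assms(2), of "P \<inter> \<Phi>"] assms by (simp add: Int_commute)
  ultimately show False using assms eq by simp
qed

section \<open>Tuples, coordinate permutations and relations of the exponentiation\<close>

lemma finite_tuples: "finite \<Gamma> \<Longrightarrow> finite (tuples m \<Gamma>)"
  by (simp add: tuples_def finite_PiE)

lemma tuples_mem: "a \<in> tuples m \<Gamma> \<Longrightarrow> i \<in> {1..m} \<Longrightarrow> a i \<in> \<Gamma>"
  by (auto simp: tuples_def PiE_def Pi_def)

lemma tuples_eqI: "a \<in> tuples m \<Gamma> \<Longrightarrow> b \<in> tuples m \<Gamma> \<Longrightarrow> (\<And>i. i \<in> {1..m} \<Longrightarrow> a i = b i) \<Longrightarrow> a = b"
  unfolding tuples_def by (rule PiE_ext)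

lemma tuples_upd: "a \<in> tuples m \<Gamma> \<Longrightarrow> i \<in> {1..m} \<Longrightarrow> x \<in> \<Gamma> \<Longrightarrow> a(i := x) \<in> tuples m \<Gamma>"
  unfolding tuples_def by (auto simp: PiE_def extensional_def Pi_def)

lemma perm_tuple_tuples:
  assumes "l permutes {1..m}" "a \<in> tuples m \<Gamma>"
  shows "perm_tuple l a \<in> tuples m \<Gamma>"
proof -
  have inv: "inv l permutes {1..m}" using assms(1) by (rule permutes_inv)
  have "a (inv l i) \<in> \<Gamma>" if "i \<in> {1..m}" for i
    using tuples_mem[OF assms(2)] permutes_in_image[OF inv] that by blast
  moreover have "a (inv l i) = undefined" if "i \<notin> {1..m}" for i
    using PiE_arb[OF assms(2)[unfolded tuples_def] that] permutes_not_in[OF inv that] by simp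
  ultimately show ?thesis unfolding tuples_def perm_tuple_def by (auto simp: PiE_def extensional_def)
qed

lemma perm_tuple_at: "l permutes {1..m} \<Longrightarrow> perm_tuple l a (l i) = a i"
  by (simp add: perm_tuple_def permutes_inverses)

lemma exp_rels_subset:
  assumes "perm_group_on m L"
  shows "exp_rels m \<Gamma> T L \<subseteq> Pow (tuples m \<Gamma> \<times> tuples m \<Gamma>)"
proof -
  have "l permutes {1..m}" if "l \<in> L" for l using assms that by (simp add: perm_group_on_def)
  then show ?thesis unfolding exp_rels_def perm_rel_def tensor_def
    by (auto intro!: perm_tuple_tuples)
qed

lemma Inv_rels_subset:
  assumes "perm_group_on m L"
  shows "Inv_rels m L \<subseteq> Pow ({1..m} \<times> {1..m})"
proof -
  have "l i \<in> {1..m}" if "l \<in> L" "i \<in> {1..m}" for l i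
    using assms that permutes_in_image[of l "{1..m}" i] by (simp add: perm_group_on_def)
  then show ?thesis unfolding Inv_rels_def by blast
qed

text \<open>Each pair of \<open>R\<close> lies in the basic relation built from the types of its
  entries, and \<open>inv\<close> keeps that basic relation inside \<open>R\<close>. Visibility in
  the exponentiation is thus reduced to a check on entry types and one permutation.\<close>

lemma exp_relI:
  assumes T: "coherent_config \<Gamma> T" and L: "perm_group_on m L"
    and sub: "R \<subseteq> tuples m \<Gamma> \<times> tuples m \<Gamma>"
    and inv: "\<And>a b a' b' l. (a,b) \<in> R \<Longrightarrow> a' \<in> tuples m \<Gamma> \<Longrightarrow> b' \<in> tuples m \<Gamma> \<Longrightarrow>
      (\<And>i. i \<in> {1..m} \<Longrightarrow> \<exists>t\<in>T. (a i, b i) \<in> t \<and> (a' i, b' i) \<in> t) \<Longrightarrow> l \<in> L \<Longrightarrow>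
      (perm_tuple l a', perm_tuple l b') \<in> R"
  shows "cc_relation (exp_rels m \<Gamma> T L) R"
proof -
  interpret Y: coherent \<Gamma> T using T by unfold_locales
  have "\<exists>s. s \<in> exp_rels m \<Gamma> T L \<and> s \<subseteq> R \<and> p \<in> s" if p: "p \<in> R" for p
  proof -
    obtain a b where ab: "p = (a,b)" by fastforce
    have m: "a \<in> tuples m \<Gamma>" "b \<in> tuples m \<Gamma>" using sub p ab by auto
    define ts where "ts i = (SOME t. t \<in> T \<and> (a i, b i) \<in> t)" for i
    have ts: "ts i \<in> T \<and> (a i, b i) \<in> ts i" if "i \<in> {1..m}" for i
    proof -
      have "(a i, b i) \<in> \<Gamma> \<times> \<Gamma>" using tuples_mem[OF m(1) that] tuples_mem[OF m(2) that] by simp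
      then have "\<exists>t. t \<in> T \<and> (a i, b i) \<in> t" using Y.ex_basic by auto
      then show ?thesis unfolding ts_def by (rule someI_ex)
    qed
    let ?s = "\<Union>l\<in>L. perm_rel l (tensor m \<Gamma> ts)"
    have "?s \<in> exp_rels m \<Gamma> T L" unfolding exp_rels_def using ts by blast
    moreover have "?s \<subseteq> R"
    proof
      fix q assume "q \<in> ?s"
      then obtain l a' b' where q: "l \<in> L" "q = (perm_tuple l a', perm_tuple l b')"
        "a' \<in> tuples m \<Gamma>" "b' \<in> tuples m \<Gamma>" "\<forall>i\<in>{1..m}. (a' i, b' i) \<in> ts i"
        unfolding perm_rel_def tensor_def by auto
      show "q \<in> R" unfolding q(2)
      proof (rule inv[of a b])
        show "(a,b) \<in> R" using p ab by simp
        fix i assume i: "i \<in> {1..m}"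
        then have "(a' i, b' i) \<in> ts i" using q(5) by blast
        then show "\<exists>t\<in>T. (a i, b i) \<in> t \<and> (a' i, b' i) \<in> t" using ts[OF i] by blast
      qed (use q in simp_all)
    qed
    \<comment> \<open>The identity of \<open>L\<close> puts \<open>p\<close> itself into the union
      over \<open>L\<close>.\<close>
    moreover have "p \<in> perm_rel id (tensor m \<Gamma> ts)"
      unfolding perm_rel_def tensor_def perm_tuple_def ab using m ts by auto
    then have "p \<in> ?s" using L by (auto simp: perm_group_on_def)
    ultimately show ?thesis by blast
  qed
  then have "R = \<Union>{s \<in> exp_rels m \<Gamma> T L. s \<subseteq> R}" by blast
  moreover have "{s \<in> exp_rels m \<Gamma> T L. s \<subseteq> R} \<subseteq> exp_rels m \<Gamma> T L" by auto
  ultimately show ?thesis unfolding cc_relation_def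
    by (intro exI[of _ "{s \<in> exp_rels m \<Gamma> T L. s \<subseteq> R}"] conjI)
qed

section \<open>Hamming distance and coordinate lines\<close>

definition hdist :: "nat \<Rightarrow> (nat \<Rightarrow> 'a) \<Rightarrow> (nat \<Rightarrow> 'a) \<Rightarrow> nat" where
  "hdist m a b = card {i \<in> {1..m}. a i \<noteq> b i}"

text \<open>For \<open>i\<close> in \<open>{1..m}\<close> the tuples related to \<open>a\<close>
  form the line through \<open>a\<close> in direction \<open>i\<close>. Equal tuples are included,
  which makes this an equivalence for each \<open>i\<close>.\<close>

definition line :: "nat \<Rightarrow> nat \<Rightarrow> (nat \<Rightarrow> 'a) \<Rightarrow> (nat \<Rightarrow> 'a) \<Rightarrow> bool" where
  "line m i a b \<longleftrightarrow> (\<forall>j\<in>{1..m}. j \<noteq> i \<longrightarrow> a j = b j)"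

lemma hdist_split:
  assumes "i \<in> {1..m}"
  shows "hdist m a b = card {j \<in> {1..m} - {i}. a j \<noteq> b j} + of_bool (a i \<noteq> b i)"
proof -
  let ?A = "{j \<in> {1..m} - {i}. a j \<noteq> b j}"
  have "{j \<in> {1..m}. a j \<noteq> b j} = (if a i \<noteq> b i then insert i ?A else ?A)" using assms by auto
  then show ?thesis unfolding hdist_def by auto
qed

text \<open>Only coordinate \<open>i\<close> changes its contribution along the line. The equation
  is additive to avoid truncated subtraction.\<close>

lemma hdist_line:
  assumes "i \<in> {1..m}" "line m i a b"
  shows "hdist m a c + of_bool (b i \<noteq> c i) = hdist m b c + of_bool (a i \<noteq> c i)"
proof -
  have "{j \<in> {1..m} - {i}. a j \<noteq> c j} = {j \<in> {1..m} - {i}. b j \<noteq> c j}"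
    using assms by (auto simp: line_def)
  then show ?thesis using hdist_split[OF assms(1), of a c] hdist_split[OF assms(1), of b c] by simp
qed

lemma hdist_commute: "hdist m a b = hdist m b a"
  unfolding hdist_def by (rule arg_cong[of _ _ card]) auto

lemma hdist_1_iff: "hdist m a b = 1 \<longleftrightarrow> (\<exists>i\<in>{1..m}. line m i a b \<and> a i \<noteq> b i)"
proof
  assume "hdist m a b = 1"
  then obtain i where i: "{i \<in> {1..m}. a i \<noteq> b i} = {i}" unfolding hdist_def by (auto simp: card_1_singleton_iff)
  have iff: "j \<in> {1..m} \<and> a j \<noteq> b j \<longleftrightarrow> j = i" for j using eqset_imp_iff[OF i, of j] by simp
  then have "i \<in> {1..m}" "a i \<noteq> b i" by auto
  moreover have "line m i a b" unfolding line_def using iff by blast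
  ultimately show "\<exists>i\<in>{1..m}. line m i a b \<and> a i \<noteq> b i" by blast
next
  assume "\<exists>i\<in>{1..m}. line m i a b \<and> a i \<noteq> b i"
  then obtain i where "i \<in> {1..m}" "line m i a b" "a i \<noteq> b i" by blast
  then have "{i \<in> {1..m}. a i \<noteq> b i} = {i}" by (auto simp: line_def)
  then show "hdist m a b = 1" by (simp add: hdist_def)
qed

lemma line_sym: "line m i a b \<Longrightarrow> line m i b a"
  and line_trans: "line m i a b \<Longrightarrow> line m i b c \<Longrightarrow> line m i a c"
  and line_refl: "line m i a a"
  and line_upd: "line m i a (a(i := x))"
  by (auto simp: line_def)

lemma line_unique:
  assumes "line m i a b" "line m j a b" "i \<in> {1..m}" "j \<in> {1..m}" "a i \<noteq> b i"
  shows "i = j"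
  using assms unfolding line_def by blast

lemma hdist_perm:
  assumes "l permutes {1..m}"
  shows "hdist m (perm_tuple l a) (perm_tuple l b) = hdist m a b"
proof -
  have "{i \<in> {1..m}. perm_tuple l a i \<noteq> perm_tuple l b i} = l ` {i \<in> {1..m}. a i \<noteq> b i}"
  proof (intro equalityI subsetI)
    fix i assume i: "i \<in> {i \<in> {1..m}. perm_tuple l a i \<noteq> perm_tuple l b i}"
    have "i = l (inv l i)" using assms by (simp add: permutes_inverses)
    moreover have "inv l i \<in> {1..m}" using i permutes_in_image[OF permutes_inv[OF assms]] by blast
    ultimately show "i \<in> l ` {i \<in> {1..m}. a i \<noteq> b i}" using i unfolding perm_tuple_def by blast
  next
    fix i assume "i \<in> l ` {i \<in> {1..m}. a i \<noteq> b i}"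
    then obtain x where x: "i = l x" "x \<in> {1..m}" "a x \<noteq> b x" by auto
    have "perm_tuple l a i \<noteq> perm_tuple l b i" unfolding x(1) perm_tuple_at[OF assms] by (rule x(3))
    moreover have "i \<in> {1..m}" unfolding x(1) permutes_in_image[OF assms] by (rule x(2))
    ultimately show "i \<in> {i \<in> {1..m}. perm_tuple l a i \<noteq> perm_tuple l b i}" by simp
  qed
  then show ?thesis unfolding hdist_def
    using card_image[OF inj_on_subset[OF permutes_inj[OF assms] subset_UNIV]] by simp
qed

section \<open>Fissions of an exponentiation\<close>

declare One_nat_def [simp del] atLeastAtMost_iff [simp del]

lemma PiE_tuples_iff:
  assumes "\<And>i. i \<in> {1..m} \<Longrightarrow> w i \<subseteq> \<Gamma>"
  shows "a \<in> PiE {1..m} w \<longleftrightarrow> a \<in> tuples m \<Gamma> \<and> (\<forall>i\<in>{1..m}. a i \<in> w i)"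
  using assms by (auto simp: tuples_def PiE_iff subset_iff)

lemma line_perm:
  assumes "l permutes {1..m}" "line m i a b"
  shows "line m (l i) (perm_tuple l a) (perm_tuple l b)"
  unfolding line_def perm_tuple_def
proof (intro ballI impI)
  fix j assume j: "j \<in> {1..m}" "j \<noteq> l i"
  have "inv l j \<in> {1..m}" using j permutes_in_image[OF permutes_inv[OF assms(1)]] by blast
  moreover have "inv l j \<noteq> i" using j permutes_inverses(1)[OF assms(1), of j] by auto
  ultimately show "a (inv l j) = b (inv l j)" using assms(2) by (simp add: line_def)
qed

locale exp_fission =
  fixes \<Gamma> :: "'a set" and T :: "'a rel set" and m :: nat and L :: "(nat \<Rightarrow> nat) set"
    and Z :: "(nat \<Rightarrow> 'a) rel set"
  assumes cc_T: "coherent_config \<Gamma> T" and group: "perm_group_on m L"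
    and fission_Z: "fission (tuples m \<Gamma>) (exp_rels m \<Gamma> T L) Z"
begin

sublocale Y: coherent \<Gamma> T
  using cc_T by unfold_locales

sublocale Z: coherent "tuples m \<Gamma>" Z
  using fission_Z by unfold_locales (simp add: fission_def)

lemma exp_relation: "cc_relation (exp_rels m \<Gamma> T L) R \<Longrightarrow> cc_relation Z R"
  using fission_Z by (simp add: fission_def)

lemma perm: "l \<in> L \<Longrightarrow> l permutes {1..m}"
  using group by (simp add: perm_group_on_def)

lemma perm_mem: "l \<in> L \<Longrightarrow> i \<in> {1..m} \<Longrightarrow> l i \<in> {1..m}"
  using permutes_in_image[OF perm] by blast

lemma same_type:
  assumes "\<exists>t\<in>T. p \<in> t \<and> q \<in> t" "cc_relation T R"
  shows "p \<in> R \<longleftrightarrow> q \<in> R"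
  using assms Y.relD by blast

lemma same_type_eq:
  assumes "\<exists>t\<in>T. (x,y) \<in> t \<and> (x',y') \<in> t"
  shows "x = y \<longleftrightarrow> x' = y'"
proof -
  have "x \<in> \<Gamma>" "x' \<in> \<Gamma>" using assms Y.basic_subset by blast+
  then show ?thesis using same_type[OF assms Y.rel_Id] by auto
qed

definition Dist :: "nat \<Rightarrow> (nat \<Rightarrow> 'a) rel" where
  "Dist n = {(a,b). a \<in> tuples m \<Gamma> \<and> b \<in> tuples m \<Gamma> \<and> hdist m a b = n}"

text \<open>The type of a pair of entries decides whether they are equal, and \<open>L\<close> only
  moves the positions where two tuples differ.\<close>

lemma rel_Dist: "cc_relation Z (Dist n)"
proof (rule exp_relation, rule exp_relI[OF cc_T group])
  show "Dist n \<subseteq> tuples m \<Gamma> \<times> tuples m \<Gamma>" by (auto simp: Dist_def)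
  fix a b a' b' l
  assume *: "(a,b) \<in> Dist n" "a' \<in> tuples m \<Gamma>" "b' \<in> tuples m \<Gamma>"
    "\<And>i. i \<in> {1..m} \<Longrightarrow> \<exists>t\<in>T. (a i, b i) \<in> t \<and> (a' i, b' i) \<in> t" "l \<in> L"
  have "{i \<in> {1..m}. a' i \<noteq> b' i} = {i \<in> {1..m}. a i \<noteq> b i}"
    using same_type_eq[OF *(4)] by auto
  then have "hdist m a' b' = n" using *(1) by (simp add: hdist_def Dist_def)
  then show "(perm_tuple l a', perm_tuple l b') \<in> Dist n"
    using * perm_tuple_tuples[OF perm[OF *(5)]] hdist_perm[OF perm[OF *(5)], of a' b'] by (auto simp: Dist_def)
qed

text \<open>The coordinate is existential because \<open>L\<close> may move it. Later this is
  intersected or composed with relations that pin the coordinate down.\<close>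

definition step :: "'a rel \<Rightarrow> (nat \<Rightarrow> 'a) rel" where
  "step R = {(a,b). a \<in> tuples m \<Gamma> \<and> b \<in> tuples m \<Gamma> \<and> (\<exists>i\<in>{1..m}. line m i a b \<and> (a i, b i) \<in> R)}"

lemma line_same_type:
  assumes "line m i a b" "\<And>i. i \<in> {1..m} \<Longrightarrow> \<exists>t\<in>T. (a i, b i) \<in> t \<and> (a' i, b' i) \<in> t"
  shows "line m i a' b'"
  using assms(1) same_type_eq[OF assms(2)] unfolding line_def by blast

lemma rel_step:
  assumes R: "cc_relation T R"
  shows "cc_relation Z (step R)"
proof (rule exp_relation, rule exp_relI[OF cc_T group])
  show "step R \<subseteq> tuples m \<Gamma> \<times> tuples m \<Gamma>" by (auto simp: step_def)
  fix a b a' b' l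
  assume *: "(a,b) \<in> step R" "a' \<in> tuples m \<Gamma>" "b' \<in> tuples m \<Gamma>"
    "\<And>i. i \<in> {1..m} \<Longrightarrow> \<exists>t\<in>T. (a i, b i) \<in> t \<and> (a' i, b' i) \<in> t" "l \<in> L"
  then obtain i where i: "i \<in> {1..m}" "line m i a b" "(a i, b i) \<in> R" by (auto simp: step_def)
  have l: "l permutes {1..m}" using perm * by simp
  have "line m (l i) (perm_tuple l a') (perm_tuple l b')"
    by (rule line_perm[OF l line_same_type[OF i(2)]]) (rule *(4))
  moreover have "(perm_tuple l a' (l i), perm_tuple l b' (l i)) \<in> R"
    unfolding perm_tuple_at[OF l] using same_type[OF *(4)[OF i(1)] R] i by simp
  moreover have "l i \<in> {1..m}" using perm_mem * i by blast
  ultimately show "(perm_tuple l a', perm_tuple l b') \<in> step R"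
    using perm_tuple_tuples[OF l *(2)] perm_tuple_tuples[OF l *(3)] unfolding step_def by blast
qed

text \<open>When \<open>R\<close> moves \<open>a\<close> along a line in direction \<open>i\<close>
  to \<open>q\<close>, coming one closer to \<open>b\<close> means that \<open>q i = b i\<close>
  while \<open>a i\<close> differs from it. So this compares the new entry with that of
  \<open>b\<close> although \<open>i\<close> is not named.\<close>

definition closer :: "(nat \<Rightarrow> 'a) rel \<Rightarrow> (nat \<Rightarrow> 'a) rel" where
  "closer R = {(a,b). a \<in> tuples m \<Gamma> \<and> b \<in> tuples m \<Gamma> \<and> (\<exists>q. (a,q) \<in> R \<and> hdist m a b = hdist m q b + 1)}"

lemma rel_closer:
  assumes R: "cc_relation Z R"
  shows "cc_relation Z (closer R)"
proof -
  have "closer R = (\<Union>n. Dist (n + 1) \<inter> (R O Dist n))"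
    using Z.rel_subset[OF R] by (auto simp: closer_def Dist_def)
  then show ?thesis using Z.rel_UN[OF Z.rel_Int[OF rel_Dist Z.rel_relcomp[OF R rel_Dist]]] by simp
qed

text \<open>For a product set \<open>W\<close> this sees whether the entry of \<open>g\<close> in the coordinate changed by the step
  from \<open>d\<close> to \<open>g\<close> lies in the corresponding factor of \<open>W\<close>.\<close>

definition pull :: "(nat \<Rightarrow> 'a) set \<Rightarrow> (nat \<Rightarrow> 'a) rel" where
  "pull W = {(d,g) \<in> Dist 1. \<exists>q\<in>W. hdist m q d = hdist m q g + 1}"

lemma rel_pull:
  assumes W: "cc_set Z W"
  shows "cc_relation Z (pull W)"
proof -
  have "pull W = Dist 1 \<inter> (\<Union>n. Dist (n + 1) O (Id_on W O Dist n))"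
  proof (intro equalityI subrelI)
    fix d g assume "(d,g) \<in> pull W"
    then obtain q where q: "(d,g) \<in> Dist 1" "q \<in> W" "hdist m q d = hdist m q g + 1"
      by (auto simp: pull_def)
    then have "(d,q) \<in> Dist (hdist m q g + 1)" "(q,g) \<in> Dist (hdist m q g)"
      using Z.set_subset[OF W] by (auto simp: Dist_def hdist_commute[of m d q])
    then show "(d,g) \<in> Dist 1 \<inter> (\<Union>n. Dist (n + 1) O (Id_on W O Dist n))" using q by blast
  next
    fix d g assume "(d,g) \<in> Dist 1 \<inter> (\<Union>n. Dist (n + 1) O (Id_on W O Dist n))"
    then obtain n q where q: "(d,g) \<in> Dist 1" "q \<in> W" "(d,q) \<in> Dist (n + 1)" "(q,g) \<in> Dist n" by auto
    then have "hdist m q d = hdist m q g + 1" by (simp add: Dist_def hdist_commute[of m d q])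
    then show "(d,g) \<in> pull W" using q unfolding pull_def by blast
  qed
  moreover have "cc_relation Z (\<Union>n. Dist (n + 1) O (Id_on W O Dist n))"
    using W unfolding cc_set_def by (intro Z.rel_UN Z.rel_relcomp rel_Dist)
  ultimately show ?thesis using Z.rel_Int[OF rel_Dist] by simp
qed

text \<open>A tuple \<open>q\<close> is closer to \<open>g\<close> than to \<open>d\<close> exactly
  when it agrees with \<open>g\<close> in the changed coordinate, and the product contains such a
  \<open>q\<close> iff that entry lies in the factor.\<close>

lemma pull_iff:
  assumes w: "\<And>i. i \<in> {1..m} \<Longrightarrow> w i \<subseteq> \<Gamma> \<and> w i \<noteq> {}"
  shows "(d,g) \<in> pull (PiE {1..m} w) \<longleftrightarrow> d \<in> tuples m \<Gamma> \<and> g \<in> tuples m \<Gamma> \<and>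
    (\<exists>i\<in>{1..m}. line m i d g \<and> d i \<noteq> g i \<and> g i \<in> w i)"
proof
  assume "(d,g) \<in> pull (PiE {1..m} w)"
  then obtain q where q: "d \<in> tuples m \<Gamma>" "g \<in> tuples m \<Gamma>" "hdist m d g = 1" "q \<in> PiE {1..m} w"
    "hdist m q d = hdist m q g + 1" by (auto simp: pull_def Dist_def)
  then obtain i where i: "i \<in> {1..m}" "line m i d g" "d i \<noteq> g i" using hdist_1_iff[of m d g] by auto
  have "hdist m q d = hdist m d q" "hdist m q g = hdist m g q" by (rule hdist_commute)+
  then have "g i = q i" using hdist_line[OF i(1,2), of q] q(5) by (cases "g i = q i"; cases "d i = q i") auto
  then have "g i \<in> w i" using q(4) i(1) by (simp add: PiE_mem)
  then show "d \<in> tuples m \<Gamma> \<and> g \<in> tuples m \<Gamma> \<and> (\<exists>i\<in>{1..m}. line m i d g \<and> d i \<noteq> g i \<and> g i \<in> w i)"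
    using q i by blast
next
  assume "d \<in> tuples m \<Gamma> \<and> g \<in> tuples m \<Gamma> \<and> (\<exists>i\<in>{1..m}. line m i d g \<and> d i \<noteq> g i \<and> g i \<in> w i)"
  then obtain i where *: "d \<in> tuples m \<Gamma>" "g \<in> tuples m \<Gamma>" "i \<in> {1..m}" "line m i d g" "d i \<noteq> g i" "g i \<in> w i"
    by blast
  have "PiE {1..m} w \<noteq> {}" using w by (simp add: PiE_eq_empty_iff)
  then obtain p where "p \<in> PiE {1..m} w" by blast
  \<comment> \<open>In a product set one coordinate may be chosen freely in its factor; the others
    are irrelevant, since \<open>d\<close> and \<open>g\<close> agree there.\<close>
  then have q: "p(i := g i) \<in> PiE {1..m} w" using * by (auto simp: PiE_iff extensional_def)
  let ?q = "p(i := g i)"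
  have "hdist m ?q d = hdist m ?q g + 1"
    using hdist_line[OF *(3,4), of ?q] *(5) by (simp add: hdist_commute[of m _ ?q])
  moreover have "hdist m d g = 1" using * hdist_1_iff[of m d g] by blast
  ultimately show "(d,g) \<in> pull (PiE {1..m} w)" using q * by (auto simp: pull_def Dist_def)
qed

end

section \<open>Tuples leaving a visible product set in exactly one coordinate\<close>

locale exp_core = exp_fission +
  fixes Q :: "nat \<Rightarrow> 'a set"
  assumes trans: "transitive_on m L"
    and Q_subset: "\<And>i. i \<in> {1..m} \<Longrightarrow> Q i \<subseteq> \<Gamma>"
    and Q_nonempty: "\<And>i. i \<in> {1..m} \<Longrightarrow> Q i \<noteq> {}"
    and Q_proper: "\<And>i. i \<in> {1..m} \<Longrightarrow> \<Gamma> - Q i \<noteq> {}"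
    and Q_set: "cc_set Z (PiE {1..m} Q)"
    and Q_types: "\<And>i j. i \<in> {1..m} \<Longrightarrow> j \<in> {1..m} \<Longrightarrow>
      \<exists>x\<in>\<Gamma> - Q i. \<exists>x'\<in>Q i. \<exists>y'\<in>Q j. \<exists>y\<in>\<Gamma> - Q j. \<forall>t\<in>T. \<not> ((x,x') \<in> t \<and> (y',y) \<in> t)"
begin

definition B :: "(nat \<Rightarrow> 'a) set" where "B = PiE {1..m} Q"

lemma B_iff: "a \<in> B \<longleftrightarrow> a \<in> tuples m \<Gamma> \<and> (\<forall>i\<in>{1..m}. a i \<in> Q i)"
  unfolding B_def by (rule PiE_tuples_iff[OF Q_subset])

lemma set_B: "cc_set Z B"
  using Q_set by (simp add: B_def)

lemma B_nonempty: "B \<noteq> {}"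
  unfolding B_def using Q_nonempty by (simp add: PiE_eq_empty_iff)

lemma B_upd: "q \<in> B \<Longrightarrow> i \<in> {1..m} \<Longrightarrow> x \<in> Q i \<Longrightarrow> q(i := x) \<in> B"
  unfolding B_def by (auto simp: PiE_iff extensional_def)

definition e :: "nat \<Rightarrow> (nat \<Rightarrow> 'a) set" where
  "e i = {a \<in> tuples m \<Gamma>. a i \<notin> Q i \<and> (\<forall>j\<in>{1..m}. j \<noteq> i \<longrightarrow> a j \<in> Q j)}"

definition E :: "(nat \<Rightarrow> 'a) set" where "E = (\<Union>i\<in>{1..m}. e i)"

lemma e_tuples: "a \<in> e i \<Longrightarrow> a \<in> tuples m \<Gamma>"
  by (simp add: e_def)

lemma e_unique: "a \<in> e i \<Longrightarrow> a \<in> e j \<Longrightarrow> i \<in> {1..m} \<Longrightarrow> j \<in> {1..m} \<Longrightarrow> i = j"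
  unfolding e_def by blast

lemma upd_e: "q \<in> B \<Longrightarrow> i \<in> {1..m} \<Longrightarrow> x \<in> \<Gamma> - Q i \<Longrightarrow> q(i := x) \<in> e i"
  unfolding e_def by (auto simp: B_iff tuples_upd)

lemma e_upd: "a \<in> e i \<Longrightarrow> i \<in> {1..m} \<Longrightarrow> x \<in> Q i \<Longrightarrow> a(i := x) \<in> B"
  unfolding B_iff using Q_subset[of i] by (auto simp: e_def intro!: tuples_upd)

lemma e_nonempty: "i \<in> {1..m} \<Longrightarrow> e i \<noteq> {}"
  using upd_e B_nonempty Q_proper by blast

lemma finite_e: "finite (e i)"
  by (rule finite_subset[OF _ Z.finite_points]) (auto simp: e_def)

lemma line_e:
  assumes "a \<in> e i" "i \<in> {1..m}" "g \<in> tuples m \<Gamma>" "line m i a g"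
  shows "g i \<in> Q i \<Longrightarrow> g \<in> B" "g i \<notin> Q i \<Longrightarrow> g \<in> e i"
proof -
  have "\<And>j. j \<in> {1..m} \<Longrightarrow> j \<noteq> i \<Longrightarrow> g j \<in> Q j" using assms unfolding e_def line_def by force
  then show "g i \<in> Q i \<Longrightarrow> g \<in> B" "g i \<notin> Q i \<Longrightarrow> g \<in> e i"
    using assms unfolding B_iff e_def by blast+
qed

text \<open>Coordinate \<open>i\<close> is the only one of \<open>a\<close> outside its factor, so
  the single change leading into \<open>B\<close> must take place there.\<close>

lemma adjacent_B:
  assumes "a \<in> e i" "i \<in> {1..m}" "q \<in> B" "hdist m a q = 1"
  shows "line m i a q" "a i \<noteq> q i"
proof -
  show n: "a i \<noteq> q i" using assms by (auto simp: e_def B_iff)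
  obtain j where "j \<in> {1..m}" "line m j a q" "a j \<noteq> q j" using assms(4) hdist_1_iff[of m a q] by auto
  moreover from this have "j = i" using n assms(2) unfolding line_def by metis
  ultimately show "line m i a q" by simp
qed

lemma upd_adjacent: "i \<in> {1..m} \<Longrightarrow> a i \<noteq> x \<Longrightarrow> hdist m a (a(i := x)) = 1"
  unfolding hdist_1_iff using line_upd by (intro bexI[of _ i]) auto

definition edge :: "(nat \<Rightarrow> 'a) rel" where "edge = Dist 1 \<inter> E \<times> B"

text \<open>A single change leaves \<open>B\<close> only by moving one entry out of its factor, so
  \<open>E\<close> consists of the neighbours of \<open>B\<close> outside \<open>B\<close>.\<close>

lemma set_E: "cc_set Z E"
proof -
  have "E = Range (Dist 1 \<inter> B \<times> tuples m \<Gamma>) - B"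
  proof (intro equalityI subsetI)
    fix a assume "a \<in> E"
    then obtain i where i: "i \<in> {1..m}" "a \<in> e i" by (auto simp: E_def)
    obtain x where x: "x \<in> Q i" using Q_nonempty i by blast
    have "a i \<noteq> x" using i x by (auto simp: e_def)
    then have "hdist m (a(i := x)) a = 1" using upd_adjacent[OF i(1)] hdist_commute by metis
    moreover have "a(i := x) \<in> B" using e_upd i x by blast
    ultimately have "(a(i := x), a) \<in> Dist 1 \<inter> B \<times> tuples m \<Gamma>"
      using e_tuples[OF i(2)] by (auto simp: Dist_def B_iff)
    moreover have "a \<notin> B" using i by (auto simp: e_def B_iff)
    ultimately show "a \<in> Range (Dist 1 \<inter> B \<times> tuples m \<Gamma>) - B" by blast
  next
    fix a assume "a \<in> Range (Dist 1 \<inter> B \<times> tuples m \<Gamma>) - B"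
    then obtain q where q: "q \<in> B" "a \<in> tuples m \<Gamma>" "a \<notin> B" "hdist m q a = 1" by (auto simp: Dist_def)
    then obtain i where i: "i \<in> {1..m}" "line m i q a" using hdist_1_iff[of m q a] by auto
    have o: "\<And>j. j \<in> {1..m} \<Longrightarrow> j \<noteq> i \<Longrightarrow> a j \<in> Q j" using q i unfolding B_iff line_def by force
    then have "a i \<notin> Q i" using q unfolding B_iff by metis
    then have "a \<in> e i" using o q by (simp add: e_def)
    then show "a \<in> E" using i by (auto simp: E_def)
  qed
  then show ?thesis
    using Z.set_Diff[OF Z.set_Range[OF Z.rel_restrict[OF set_B rel_Dist Z.set_full]] set_B] by simp
qed

lemma rel_edge: "cc_relation Z edge"
  unfolding edge_def by (rule Z.rel_restrict[OF set_E rel_Dist set_B])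

lemma edge_iff: "a \<in> e i \<Longrightarrow> i \<in> {1..m} \<Longrightarrow> (a,q) \<in> edge \<longleftrightarrow> q \<in> B \<and> line m i a q"
proof
  assume *: "a \<in> e i" "i \<in> {1..m}" "(a,q) \<in> edge"
  then show "q \<in> B \<and> line m i a q" using adjacent_B by (auto simp: edge_def Dist_def)
next
  assume *: "a \<in> e i" "i \<in> {1..m}" "q \<in> B \<and> line m i a q"
  then have "a i \<noteq> q i" by (auto simp: e_def B_iff)
  then have "hdist m a q = 1" using * hdist_1_iff[of m a q] by blast
  then show "(a,q) \<in> edge" using * e_tuples by (auto simp: edge_def Dist_def E_def B_iff)
qed

definition sim :: "(nat \<Rightarrow> 'a) rel" where "sim = (\<Union>i\<in>{1..m}. e i \<times> e i)"

text \<open>For \<open>a\<close> in \<open>e i\<close> and \<open>b\<close> in \<open>e j\<close>,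
  an edge from \<open>a\<close> replaces its entry at \<open>i\<close> by one from
  \<open>Q i\<close>. Some such edge comes closer to \<open>b\<close> iff \<open>b i\<close> lies in
  \<open>Q i\<close>, that is, iff \<open>i\<close> and \<open>j\<close> differ.\<close>

lemma rel_sim: "cc_relation Z sim"
proof -
  have "(a,b) \<in> closer edge \<longleftrightarrow> i \<noteq> j"
    if *: "a \<in> e i" "b \<in> e j" "i \<in> {1..m}" "j \<in> {1..m}" for a b i j
  proof
    assume "(a,b) \<in> closer edge"
    then obtain q where q: "(a,q) \<in> edge" "hdist m a b = hdist m q b + 1" by (auto simp: closer_def)
    then have q': "q \<in> B" "line m i a q" using edge_iff * by auto
    have "q i = b i" using hdist_line[OF *(3) q'(2), of b] q(2)
      by (cases "q i = b i"; cases "a i = b i") auto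
    then have "b i \<in> Q i" using q' *(3) by (auto simp: B_iff)
    then show "i \<noteq> j" using * by (auto simp: e_def)
  next
    assume "i \<noteq> j"
    then have b: "b i \<in> Q i" using * by (auto simp: e_def)
    let ?q = "a(i := b i)"
    have "(a,?q) \<in> edge" using edge_iff[OF *(1,3), of ?q] e_upd[OF *(1,3) b] line_upd[of m i a "b i"] by simp
    moreover have "a i \<noteq> b i" using b *(1) by (auto simp: e_def)
    then have "hdist m a b = hdist m ?q b + 1"
      using hdist_line[OF *(3) line_upd[of m i a "b i"], of b] by simp
    ultimately show "(a,b) \<in> closer edge" using e_tuples * unfolding closer_def by blast
  qed
  then have "sim = E \<times> E - closer edge" unfolding sim_def E_def by (auto; blast)
  then show ?thesis using Z.rel_Diff[OF Z.rel_Times[OF set_E set_E] rel_closer[OF rel_edge]] by simp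
qed

definition ell :: "(nat \<Rightarrow> 'a) rel" where
  "ell = {(a,g). g \<in> tuples m \<Gamma> \<and> (\<exists>i\<in>{1..m}. a \<in> e i \<and> line m i a g)}"

lemma ell_iff: "a \<in> e i \<Longrightarrow> i \<in> {1..m} \<Longrightarrow> (a,g) \<in> ell \<longleftrightarrow> g \<in> tuples m \<Gamma> \<and> line m i a g"
  unfolding ell_def using e_unique by blast

text \<open>The points in \<open>B\<close> of the line through \<open>a\<close> are its neighbours
  along \<open>edge\<close>. The others stay in the same \<open>e i\<close> and share such a
  neighbour with \<open>a\<close>.\<close>

lemma rel_ell: "cc_relation Z ell"
proof -
  have "ell = edge \<union> (sim \<inter> (edge O edge\<inverse>))"
  proof (intro equalityI subrelI)
    fix a g assume "(a,g) \<in> ell"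
    then obtain i where i: "i \<in> {1..m}" "a \<in> e i" "line m i a g" "g \<in> tuples m \<Gamma>" by (auto simp: ell_def)
    show "(a,g) \<in> edge \<union> (sim \<inter> (edge O edge\<inverse>))"
    proof (cases "g i \<in> Q i")
      case True
      then show ?thesis using line_e[OF i(2,1,4,3)] edge_iff[OF i(2,1)] i by blast
    next
      case False
      then have g: "g \<in> e i" using line_e[OF i(2,1,4,3)] by blast
      obtain x where x: "x \<in> Q i" using Q_nonempty i by blast
      have q: "a(i := x) \<in> B" using e_upd i x by blast
      have "(a, a(i := x)) \<in> edge" using edge_iff[OF i(2,1), of "a(i := x)"] q line_upd[of m i a x] by simp
      moreover have "(g, a(i := x)) \<in> edge"
        using edge_iff[OF g i(1), of "a(i := x)"] q line_trans[OF line_sym[OF i(3)] line_upd, of x] by simp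
      ultimately show ?thesis using i g unfolding sim_def by blast
    qed
  next
    fix a g assume "(a,g) \<in> edge \<union> (sim \<inter> (edge O edge\<inverse>))"
    then show "(a,g) \<in> ell"
    proof
      assume ag: "(a,g) \<in> edge"
      then obtain i where i: "i \<in> {1..m}" "a \<in> e i" by (auto simp: edge_def E_def)
      then show ?thesis using edge_iff[OF i(2,1)] ell_iff[OF i(2,1)] ag B_iff by blast
    next
      assume ag: "(a,g) \<in> sim \<inter> (edge O edge\<inverse>)"
      then obtain i where i: "i \<in> {1..m}" "a \<in> e i" "g \<in> e i" by (auto simp: sim_def)
      obtain q where "(a,q) \<in> edge" "(g,q) \<in> edge" using ag by auto
      then have "line m i a q" "line m i g q" using edge_iff i by blast+
      then show ?thesis using ell_iff[OF i(2,1)] line_trans line_sym e_tuples[OF i(3)] by blast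
    qed
  qed
  then show ?thesis
    using Z.rel_Un[OF rel_edge Z.rel_Int[OF rel_sim Z.rel_relcomp[OF rel_edge Z.rel_converse[OF rel_edge]]]] by simp
qed

section \<open>Reading sets of indices off product sets and tuples\<close>

definition G :: "(nat \<Rightarrow> 'a set) \<Rightarrow> (nat \<Rightarrow> 'a) rel" where
  "G w = ell \<inter> (ell O pull (PiE {1..m} w))"

lemma rel_G: "cc_set Z (PiE {1..m} w) \<Longrightarrow> cc_relation Z (G w)"
  unfolding G_def by (intro Z.rel_Int Z.rel_relcomp rel_ell rel_pull)

lemma ex_other: "i \<in> {1..m} \<Longrightarrow> \<exists>y\<in>\<Gamma>. y \<noteq> x"
proof -
  assume i: "i \<in> {1..m}"
  obtain y z where "y \<in> Q i" "z \<in> \<Gamma> - Q i" using Q_nonempty[OF i] Q_proper[OF i] by blast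
  then have "y \<in> \<Gamma>" "z \<in> \<Gamma>" "y \<noteq> z" using Q_subset[OF i] by auto
  then show ?thesis by metis
qed

text \<open>The detour through another point \<open>d\<close> of the line is needed because
  \<open>pull\<close> only sees a proper change; both points being on the line forces that change
  into coordinate \<open>i\<close>.\<close>

lemma G_iff:
  assumes w: "\<And>i. i \<in> {1..m} \<Longrightarrow> w i \<subseteq> \<Gamma> \<and> w i \<noteq> {}" and a: "a \<in> e i" "i \<in> {1..m}"
  shows "(a,g) \<in> G w \<longleftrightarrow> g \<in> tuples m \<Gamma> \<and> line m i a g \<and> g i \<in> w i"
proof
  assume "(a,g) \<in> G w"
  then obtain d where *: "(a,g) \<in> ell" "(a,d) \<in> ell" "(d,g) \<in> pull (PiE {1..m} w)" by (auto simp: G_def)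
  then have l: "g \<in> tuples m \<Gamma>" "line m i a g" "line m i a d" using ell_iff[OF a] by auto
  obtain j where j: "j \<in> {1..m}" "line m j d g" "d j \<noteq> g j" "g j \<in> w j" using * pull_iff[OF w] by auto
  have "line m i d g" using l line_trans line_sym by blast
  then have "j = i" using line_unique[OF j(2) _ j(1) a(2) j(3)] by blast
  then show "g \<in> tuples m \<Gamma> \<and> line m i a g \<and> g i \<in> w i" using l j by blast
next
  assume *: "g \<in> tuples m \<Gamma> \<and> line m i a g \<and> g i \<in> w i"
  \<comment> \<open>Any entry other than \<open>g i\<close> gives a starting point for a proper
    change ending in \<open>g\<close>; this also covers the case \<open>g = a\<close>.\<close>
  obtain y where y: "y \<in> \<Gamma>" "y \<noteq> g i" using ex_other[OF a(2)] by blast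
  let ?d = "g(i := y)"
  have d: "?d \<in> tuples m \<Gamma>" using tuples_upd[OF _ a(2) y(1)] * by simp
  have "line m i a ?d" using line_trans[OF _ line_upd[of m i g y], of a] * by simp
  then have "(a,?d) \<in> ell" using ell_iff[OF a, of ?d] d by simp
  moreover have "\<exists>j\<in>{1..m}. line m j ?d g \<and> ?d j \<noteq> g j \<and> g j \<in> w j"
    using * y a line_sym[OF line_upd[of m i g y]] by (intro bexI[of _ i]) auto
  then have "(?d,g) \<in> pull (PiE {1..m} w)" using pull_iff[where w = w and d = ?d and g = g, OF w] d * by simp
  ultimately show "(a,g) \<in> G w" unfolding G_def using ell_iff[OF a] * by blast
qed

text \<open>The degree in \<open>G w\<close> of a tuple in \<open>e i\<close> is the size of the
  factor \<open>w i\<close>, and degrees are visible. One product set with two factor sizes thus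
  encodes a set of indices.\<close>

lemma set_of_size:
  assumes w: "\<And>i. i \<in> {1..m} \<Longrightarrow> w i \<subseteq> \<Gamma> \<and> w i \<noteq> {}" and W: "cc_set Z (PiE {1..m} w)"
    and D: "D \<subseteq> {1..m}" "\<And>i. i \<in> {1..m} \<Longrightarrow> i \<in> D \<longleftrightarrow> card (w i) = n"
  shows "cc_set Z (\<Union>i\<in>D. e i)"
proof -
  have deg: "card (G w `` {a}) = card (w i)" if a: "a \<in> e i" "i \<in> {1..m}" for a i
  proof -
    have "G w `` {a} = (\<lambda>x. a(i := x)) ` w i"
    proof (intro equalityI subsetI)
      fix g assume "g \<in> G w `` {a}"
      then have g: "g \<in> tuples m \<Gamma>" "line m i a g" "g i \<in> w i" using G_iff[OF w a] by auto
      have "g = a(i := g i)"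
        by (rule tuples_eqI[OF g(1) tuples_upd[OF e_tuples[OF a(1)] a(2)]])
          (use g(2) tuples_mem[OF g(1) a(2)] in \<open>auto simp: line_def\<close>)
      then show "g \<in> (\<lambda>x. a(i := x)) ` w i" using g by blast
    next
      fix g assume "g \<in> (\<lambda>x. a(i := x)) ` w i"
      then obtain x where x: "x \<in> w i" "g = a(i := x)" by blast
      then have "g \<in> tuples m \<Gamma>" using tuples_upd[OF e_tuples[OF a(1)] a(2), of x] w[OF a(2)] by auto
      then show "g \<in> G w `` {a}" using G_iff[OF w a, where g = g] x line_upd[of m i a x] by simp
    qed
    moreover have "inj_on (\<lambda>x. a(i := x)) (w i)" by (rule inj_onI) (metis fun_upd_same)
    ultimately show ?thesis by (simp add: card_image)
  qed
  have "(\<Union>i\<in>D. e i) = E \<inter> {a \<in> tuples m \<Gamma>. card (G w `` {a}) = n}"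
    (is "_ = ?R")
  proof (intro equalityI subsetI)
    fix a assume "a \<in> (\<Union>i\<in>D. e i)"
    then obtain i where "i \<in> D" "a \<in> e i" by blast
    then show "a \<in> ?R" using deg[of a i] D e_tuples unfolding E_def by auto
  next
    fix a assume a: "a \<in> ?R"
    then obtain i where i: "i \<in> {1..m}" "a \<in> e i" by (auto simp: E_def)
    then have "i \<in> D" using deg[of a i] D(2)[of i] a by simp
    then show "a \<in> (\<Union>i\<in>D. e i)" using i by blast
  qed
  then show ?thesis using Z.set_Int[OF set_E Z.set_degree[OF rel_G[OF W], of "\<lambda>k. k = n"]] by simp
qed

text \<open>On the line through a tuple of \<open>e i\<close>, the points with entries
  \<open>c i\<close> and \<open>c' i\<close> are visible, and a step along \<open>R\<close> from the
  first to the second tests the pair of entries. So two visible tuples encode a set of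
  indices.\<close>

lemma set_of_pair:
  assumes R: "cc_relation T R" "R = Id_on \<Gamma> \<or> (\<forall>x. (x,x) \<notin> R)" and c: "cc_set Z {c}" and c': "cc_set Z {c'}"
    and D: "D \<subseteq> {1..m}" "\<And>i. i \<in> {1..m} \<Longrightarrow> i \<in> D \<longleftrightarrow> (c i, c' i) \<in> R"
  shows "cc_set Z (\<Union>i\<in>D. e i)"
proof -
  have t: "c \<in> tuples m \<Gamma>" "c' \<in> tuples m \<Gamma>" using Z.set_subset[OF c] Z.set_subset[OF c'] by auto
  have sing: "PiE {1..m} (\<lambda>i. {b i}) = {b}" if "b \<in> tuples m \<Gamma>" for b
    using that unfolding tuples_def by (intro PiE_singleton) (simp add: PiE_def)
  let ?w = "\<lambda>i. {c i}" and ?w' = "\<lambda>i. {c' i}"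
  have w: "?w i \<subseteq> \<Gamma> \<and> ?w i \<noteq> {}" "?w' i \<subseteq> \<Gamma> \<and> ?w' i \<noteq> {}" if "i \<in> {1..m}" for i
    using t tuples_mem that by blast+
  \<comment> \<open>A pair \<open>(a,g)\<close> belongs to this if \<open>g\<close> carries the
    entry of \<open>c\<close> and some \<open>g'\<close> on the same line carries that of
    \<open>c'\<close>, with a step along \<open>R\<close> from \<open>g\<close> to
    \<open>g'\<close>.\<close>
  let ?P = "G ?w \<inter> (G ?w' O (step R)\<inverse>)"
  have rel: "cc_relation Z ?P"
    using c c' sing[OF t(1)] sing[OF t(2)]
    by (intro Z.rel_Int Z.rel_relcomp Z.rel_converse rel_G rel_step R(1)) simp_all
  have "(\<Union>i\<in>D. e i) = Domain ?P"
  proof (intro equalityI subsetI)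
    fix a assume "a \<in> (\<Union>i\<in>D. e i)"
    then obtain i where i: "i \<in> D" "a \<in> e i" by blast
    then have im: "i \<in> {1..m}" using D by blast
    let ?g = "a(i := c i)" and ?g' = "a(i := c' i)"
    have mem: "?g \<in> tuples m \<Gamma>" "?g' \<in> tuples m \<Gamma>"
      using tuples_upd[OF e_tuples[OF i(2)] im] tuples_mem[OF t(1) im] tuples_mem[OF t(2) im] by auto
    have "(a,?g) \<in> G ?w" "(a,?g') \<in> G ?w'"
      using mem line_upd[of m i a "c i"] line_upd[of m i a "c' i"]
        G_iff[where w = ?w, OF w(1) i(2) im, where g = ?g] G_iff[where w = ?w', OF w(2) i(2) im, where g = ?g']
      by auto
    moreover have "(?g,?g') \<in> step R"
      unfolding step_def using mem D(2)[OF im] i im by (auto simp: line_def intro!: bexI[of _ i])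
    ultimately show "a \<in> Domain ?P" by blast
  next
    fix a assume "a \<in> Domain ?P"
    then obtain g g' where g: "(a,g) \<in> G ?w" "(a,g') \<in> G ?w'" "(g,g') \<in> step R" by blast
    then have "(a,g) \<in> ell" by (simp add: G_def)
    then obtain i where i: "i \<in> {1..m}" "a \<in> e i" by (auto simp: ell_def)
    have l: "line m i a g" "g i = c i" "line m i a g'" "g' i = c' i"
      using g G_iff[where w = ?w, OF w(1) i(2,1)] G_iff[where w = ?w', OF w(2) i(2,1)] by auto
    obtain j where j: "j \<in> {1..m}" "line m j g g'" "(g j, g' j) \<in> R" using g(3) by (auto simp: step_def)
    have gg: "line m i g g'" using l line_trans line_sym by blast
    have "(c i, c' i) \<in> R"
    proof (cases "j = i")
      case True then show ?thesis using j l by simp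
    next
      case False
      \<comment> \<open>A step in a foreign coordinate \<open>j\<close> is possible only between
        equal entries. This excludes irreflexive \<open>R\<close>, and for the identity it still
        yields equality at \<open>i\<close>.\<close>
      have eq: "g j = g' j" using gg j(1) False by (simp add: line_def)
      then have Id: "R = Id_on \<Gamma>" using R(2) j(3) by auto
      have "g i = g' i" using j(2) i(1) False by (simp add: line_def)
      then show ?thesis using l Id tuples_mem[OF t(1) i(1)] by auto
    qed
    then show "a \<in> (\<Union>i\<in>D. e i)" using D(2)[OF i(1)] i by blast
  qed
  then show ?thesis using Z.set_Domain[OF rel] by simp
qed

end

section \<open>The induced configuration on the indices\<close>

context exp_core
begin

text \<open>The blow-up of a relation on indices, with the block \<open>e i\<close> in place of the
  index \<open>i\<close>.\<close>

definition lift :: "nat rel \<Rightarrow> (nat \<Rightarrow> 'a) rel" where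
  "lift R = {(a,b). \<exists>(i,j)\<in>R. a \<in> e i \<and> b \<in> e j}"

lemma lift_iff:
  assumes "R \<subseteq> {1..m} \<times> {1..m}" "a \<in> e i" "b \<in> e j" "i \<in> {1..m}" "j \<in> {1..m}"
  shows "(a,b) \<in> lift R \<longleftrightarrow> (i,j) \<in> R"
proof
  assume "(a,b) \<in> lift R"
  then obtain i' j' where *: "(i',j') \<in> R" "a \<in> e i'" "b \<in> e j'" by (auto simp: lift_def)
  then have "i' \<in> {1..m}" "j' \<in> {1..m}" using assms(1) by auto
  then have "i' = i" "j' = j" using e_unique * assms by blast+
  then show "(i,j) \<in> R" using * by simp
qed (use assms in \<open>auto simp: lift_def\<close>)

lemma lift_subset: "R \<subseteq> {1..m} \<times> {1..m} \<Longrightarrow> lift R \<subseteq> E \<times> E"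
  by (auto simp: lift_def E_def)

lemma lift_eqI:
  assumes "R \<subseteq> {1..m} \<times> {1..m}" "M \<subseteq> E \<times> E"
    "\<And>a b i j. a \<in> e i \<Longrightarrow> b \<in> e j \<Longrightarrow> i \<in> {1..m} \<Longrightarrow> j \<in> {1..m} \<Longrightarrow> (a,b) \<in> M \<longleftrightarrow> (i,j) \<in> R"
  shows "lift R = M"
proof (intro equalityI subrelI)
  fix a b assume ab: "(a,b) \<in> lift R"
  then obtain i j where "a \<in> e i" "b \<in> e j" "i \<in> {1..m}" "j \<in> {1..m}"
    using lift_subset[OF assms(1)] unfolding E_def by blast
  then show "(a,b) \<in> M" using lift_iff[OF assms(1)] assms(3) ab by blast
next
  fix a b assume ab: "(a,b) \<in> M"
  then obtain i j where "a \<in> e i" "b \<in> e j" "i \<in> {1..m}" "j \<in> {1..m}"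
    using assms(2) unfolding E_def by blast
  then show "(a,b) \<in> lift R" using lift_iff[OF assms(1)] assms(3) ab by blast
qed

lemma sim_iff:
  assumes "a \<in> e i" "b \<in> e j" "i \<in> {1..m}" "j \<in> {1..m}"
  shows "(a,b) \<in> sim \<longleftrightarrow> i = j"
  unfolding sim_def using assms e_unique by blast

lemma sim_subset: "sim \<subseteq> E \<times> E"
  unfolding sim_def E_def by blast

lemma lift_Id: "lift (Id_on {1..m}) = sim"
  by (rule lift_eqI) (use sim_iff sim_subset in auto)

text \<open>A pair of distinct types \<open>u\<close>, \<open>v\<close> tells the two positions in which \<open>a\<close> and \<open>b\<close> differ apart,
  so an ordered orbit of \<open>L\<close> becomes visible.\<close>

definition orbital :: "nat \<Rightarrow> nat \<Rightarrow> 'a rel \<Rightarrow> 'a rel \<Rightarrow> (nat \<Rightarrow> 'a) rel" where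
  "orbital i j u v = {(a,b). a \<in> tuples m \<Gamma> \<and> b \<in> tuples m \<Gamma> \<and> (\<exists>l\<in>L. (a (l i), b (l i)) \<in> u \<and>
     (a (l j), b (l j)) \<in> v \<and> (\<forall>k\<in>{1..m}. k \<noteq> l i \<longrightarrow> k \<noteq> l j \<longrightarrow> a k = b k))}"

text \<open>A permutation \<open>p\<close> turns the witness \<open>l\<close> into
  \<open>p \<circ> l\<close>; all conditions on entries depend on their types only.\<close>

lemma rel_orbital:
  assumes u: "cc_relation T u" and v: "cc_relation T v" and ij: "i \<in> {1..m}" "j \<in> {1..m}"
  shows "cc_relation Z (orbital i j u v)"
proof (rule exp_relation, rule exp_relI[OF cc_T group])
  show "orbital i j u v \<subseteq> tuples m \<Gamma> \<times> tuples m \<Gamma>" by (auto simp: orbital_def)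
  fix a b a' b' p
  assume *: "(a,b) \<in> orbital i j u v" "a' \<in> tuples m \<Gamma>" "b' \<in> tuples m \<Gamma>"
    "\<And>i. i \<in> {1..m} \<Longrightarrow> \<exists>t\<in>T. (a i, b i) \<in> t \<and> (a' i, b' i) \<in> t" "p \<in> L"
  then obtain l where l: "l \<in> L" "(a (l i), b (l i)) \<in> u" "(a (l j), b (l j)) \<in> v"
    "\<forall>k\<in>{1..m}. k \<noteq> l i \<longrightarrow> k \<noteq> l j \<longrightarrow> a k = b k" by (auto simp: orbital_def)
  have p: "p permutes {1..m}" using perm * by simp
  have pl: "p \<circ> l \<in> L" using group * l by (simp add: perm_group_on_def)
  have "(perm_tuple p a' ((p \<circ> l) i), perm_tuple p b' ((p \<circ> l) i)) \<in> u"
    unfolding comp_apply perm_tuple_at[OF p] using same_type[OF *(4)[OF perm_mem[OF l(1) ij(1)]] u] l by simp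
  moreover have "(perm_tuple p a' ((p \<circ> l) j), perm_tuple p b' ((p \<circ> l) j)) \<in> v"
    unfolding comp_apply perm_tuple_at[OF p] using same_type[OF *(4)[OF perm_mem[OF l(1) ij(2)]] v] l by simp
  moreover have "perm_tuple p a' k = perm_tuple p b' k"
    if k: "k \<in> {1..m}" "k \<noteq> (p \<circ> l) i" "k \<noteq> (p \<circ> l) j" for k
  proof -
    let ?k = "inv p k"
    have pk: "p ?k = k" using permutes_inverses(1)[OF p] by simp
    have "?k \<in> {1..m}" using k permutes_in_image[OF permutes_inv[OF p]] by blast
    moreover have "?k \<noteq> l i" "?k \<noteq> l j" using k pk by auto
    ultimately show ?thesis using same_type_eq[OF *(4), of ?k] l(4) by (simp add: perm_tuple_def)
  qed
  ultimately show "(perm_tuple p a', perm_tuple p b') \<in> orbital i j u v"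
    using pl perm_tuple_tuples[OF p *(2)] perm_tuple_tuples[OF p *(3)] unfolding orbital_def by blast
qed

text \<open>For equal indices, transitivity gives the diagonal. Otherwise join \<open>a\<close> in
  \<open>e x\<close> to \<open>b\<close> in \<open>e y\<close> through \<open>B\<close> by steps of
  distinct types \<open>u\<close> and \<open>v\<close>. Then \<open>a\<close> and \<open>b\<close>
  differ exactly at \<open>x\<close> and \<open>y\<close>, with these types, and membership in
  \<open>orbital\<close> says that this ordered pair is \<open>(l i, l j)\<close> for some
  \<open>l\<close>.\<close>

lemma rel_lift_orbit:
  assumes ij: "i \<in> {1..m}" "j \<in> {1..m}"
  shows "cc_relation Z (lift {(l i, l j) | l. l \<in> L})"
proof (cases "i = j")
  case True
  have "{(l i, l j) | l. l \<in> L} = Id_on {1..m}"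
  proof (intro equalityI subrelI)
    fix x y assume "(x,y) \<in> {(l i, l j) | l. l \<in> L}"
    then show "(x,y) \<in> Id_on {1..m}" using True perm_mem ij by auto
  next
    fix x y assume "(x,y) \<in> Id_on {1..m}"
    then obtain l where "l \<in> L" "l i = x" "y = x" using trans ij by (auto simp: transitive_on_def)
    then show "(x,y) \<in> {(l i, l j) | l. l \<in> L}" using True by auto
  qed
  then show ?thesis using lift_Id rel_sim by simp
next
  case False
  let ?O = "{(l i, l j) | l. l \<in> L}"
  have O: "?O \<subseteq> {1..m} \<times> {1..m}" using perm_mem ij by blast
  \<comment> \<open>The path through \<open>B\<close> attaches \<open>u\<close> to the block of
    \<open>a\<close> and \<open>v\<close> to the block of \<open>b\<close>; \<open>orbital\<close>
    attaches \<open>u\<close> to \<open>l i\<close> and \<open>v\<close> to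
    \<open>l j\<close>.\<close>
  define W where "W u v = (orbital i j u v \<inter> E \<times> E) \<inter> ((step u \<inter> edge) O (edge\<inverse> \<inter> step v))" for u v
  define P where "P = {(u,v) \<in> T \<times> T. u \<noteq> v}"
  define WW where "WW = (\<Union>(u,v)\<in>P. W u v)"
  have rel: "cc_relation Z WW"
  proof -
    have "cc_relation Z (W u v)" if "(u,v) \<in> P" for u v
    proof -
      have "cc_relation T u" "cc_relation T v" using that cc_relation_basic by (auto simp: P_def)
      then show ?thesis unfolding W_def
        by (intro Z.rel_Int Z.rel_restrict Z.rel_relcomp Z.rel_converse rel_edge rel_step rel_orbital ij set_E)
    qed
    then show ?thesis unfolding WW_def by (intro Z.rel_UN) auto
  qed
  \<comment> \<open>The step leaves its coordinate open, but an edge from \<open>e i\<close>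
    certainly changes coordinate \<open>i\<close>.\<close>
  have step_e: "(a i, q i) \<in> u" if st: "(a,q) \<in> step u" "(a,q) \<in> edge" "a \<in> e i" "i \<in> {1..m}" for a q i u
  proof -
    obtain k where k: "k \<in> {1..m}" "line m k a q" "(a k, q k) \<in> u" using st(1) by (auto simp: step_def)
    have "line m i a q" "q \<in> B" using edge_iff that by auto
    then have "a i \<noteq> q i" using that by (auto simp: e_def B_iff)
    then have "k = i" using k that unfolding line_def by metis
    then show ?thesis using k by simp
  qed
  have step_e': "(q j, b j) \<in> v" if st: "(q,b) \<in> step v" "(b,q) \<in> edge" "b \<in> e j" "j \<in> {1..m}" for b q j v
  proof -
    obtain k where k: "k \<in> {1..m}" "line m k q b" "(q k, b k) \<in> v" using st(1) by (auto simp: step_def)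
    have "line m j b q" "q \<in> B" using edge_iff that by auto
    then have "b j \<noteq> q j" using that by (auto simp: e_def B_iff)
    then have "k = j" using k that unfolding line_def by metis
    then show ?thesis using k by simp
  qed
  have sound: "(x,y) \<in> ?O" if st: "(a,b) \<in> WW" "a \<in> e x" "b \<in> e y" "x \<in> {1..m}" "y \<in> {1..m}" for a b x y
  proof -
    obtain u v where uv: "u \<in> T" "v \<in> T" "u \<noteq> v" "(a,b) \<in> W u v" using st(1) by (auto simp: WW_def P_def)
    then obtain q where q: "(a,q) \<in> step u" "(a,q) \<in> edge" "(b,q) \<in> edge" "(q,b) \<in> step v"
      and o: "(a,b) \<in> orbital i j u v" by (auto simp: W_def)
    obtain l where l: "l \<in> L" "(a (l i), b (l i)) \<in> u" "(a (l j), b (l j)) \<in> v"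
      "\<forall>k\<in>{1..m}. k \<noteq> l i \<longrightarrow> k \<noteq> l j \<longrightarrow> a k = b k" using o by (auto simp: orbital_def)
    have axq: "line m x a q" "q \<in> B" using edge_iff q that by auto
    have byq: "line m y b q" using edge_iff q that by auto
    have aq: "(a x, q x) \<in> u" using step_e q that by blast
    have qb: "(q y, b y) \<in> v" using step_e' q that by blast
    have qx: "q x \<in> Q x" "q y \<in> Q y" using axq that by (auto simp: B_iff)
    have ax: "a x \<notin> Q x" "b y \<notin> Q y" using that by (auto simp: e_def)
    have "a x \<noteq> q x" "q y \<noteq> b y" using qx ax by auto
    then have "(a x, q x) \<notin> Id_on \<Gamma>" "(q y, b y) \<notin> Id_on \<Gamma>" by auto
    then have irr: "(c,c) \<notin> u" "(c,c) \<notin> v" for c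
      using Y.basic_Id[OF uv(1), of c] Y.basic_Id[OF uv(2), of c] subsetD[OF _ aq] subsetD[OF _ qb] by metis+
    have lm: "l i \<in> {1..m}" "l j \<in> {1..m}" using perm_mem l ij by auto
    have neq: "a (l i) \<noteq> b (l i)" "a (l j) \<noteq> b (l j)" using l irr by metis+
    have "inj l" using permutes_inj[OF perm[OF l(1)]] .
    then have lij: "l i \<noteq> l j" using False by (auto dest: injD)
    \<comment> \<open>Otherwise \<open>a\<close> and \<open>b\<close> lie on one line, although they
      differ at the two positions \<open>l i\<close> and \<open>l j\<close>.\<close>
    have "x \<noteq> y"
    proof
      assume "x = y"
      then have "line m x a b" using axq byq line_trans line_sym by metis
      then show False using neq lij lm unfolding line_def by metis
    qed
    then have abx: "(a x, b x) \<in> u" using byq that(4) aq by (simp add: line_def)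
    have aby: "(a y, b y) \<in> v" using axq that(5) qb \<open>x \<noteq> y\<close> by (simp add: line_def)
    \<comment> \<open>All positions where \<open>a\<close> and \<open>b\<close> differ are among
      \<open>l i\<close> and \<open>l j\<close>; distinctness of \<open>u\<close> and
      \<open>v\<close> then fixes the order.\<close>
    have "x = l i \<or> x = l j" "y = l i \<or> y = l j" using l(4) abx aby irr st(4,5) by metis+
    moreover have "x \<noteq> l j" using abx l(3) Y.basic_unique[OF uv(1,2)] uv(3) by blast
    ultimately have "x = l i" "y = l j" using \<open>x \<noteq> y\<close> by auto
    then show ?thesis using l by blast
  qed
  have complete: "\<exists>a\<in>e x. \<exists>b\<in>e y. (a,b) \<in> WW" if st: "(x,y) \<in> ?O" for x y
  proof -
    obtain l where l: "l \<in> L" "x = l i" "y = l j" using st by blast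
    have xm: "x \<in> {1..m}" "y \<in> {1..m}" using O that by auto
    have "inj l" using permutes_inj[OF perm[OF l(1)]] .
    then have xy: "x \<noteq> y" using False l by (auto dest: injD)
    \<comment> \<open>Here \<open>Q_types\<close> is essential: the entry pair coming into
      \<open>Q x\<close> and the one going out of \<open>Q y\<close> get different types, so a
      suitable pair \<open>u\<close>, \<open>v\<close> exists for every pair of the orbit.\<close>
    obtain c c' d' d where cd: "c \<in> \<Gamma> - Q x" "c' \<in> Q x" "d' \<in> Q y" "d \<in> \<Gamma> - Q y"
      "\<forall>t\<in>T. \<not> ((c,c') \<in> t \<and> (d',d) \<in> t)" using Q_types[OF xm] by blast
    have mem: "c' \<in> \<Gamma>" "d' \<in> \<Gamma>" using cd Q_subset xm by auto
    obtain u where u: "u \<in> T" "(c,c') \<in> u" using Y.ex_basic[of "(c,c')"] cd mem by auto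
    obtain v where v: "v \<in> T" "(d',d) \<in> v" using Y.ex_basic[of "(d',d)"] cd mem by auto
    have "u \<noteq> v" using cd u v by blast
    obtain q0 where "q0 \<in> B" using B_nonempty by blast
    define q where "q = q0(x := c', y := d')"
    have q: "q \<in> B" unfolding q_def using \<open>q0 \<in> B\<close> cd xm by (intro B_upd)
    have qv: "q x = c'" "q y = d'" using xy by (auto simp: q_def)
    let ?a = "q(x := c)" and ?b = "q(y := d)"
    have ab: "?a \<in> e x" "?b \<in> e y" using upd_e q xm cd by blast+
    have t: "?a \<in> tuples m \<Gamma>" "?b \<in> tuples m \<Gamma>" "q \<in> tuples m \<Gamma>" using ab e_tuples q B_iff by blast+
    have lines: "line m x ?a q" "line m y ?b q" "line m y q ?b" by (auto simp: line_def)
    have edges: "(?a,q) \<in> edge" "(?b,q) \<in> edge"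
      using edge_iff[OF ab(1) xm(1), of q] edge_iff[OF ab(2) xm(2), of q] lines q by auto
    have "\<exists>k\<in>{1..m}. line m k ?a q \<and> (?a k, q k) \<in> u" "\<exists>k\<in>{1..m}. line m k q ?b \<and> (q k, ?b k) \<in> v"
      using lines u v qv xm by (intro bexI[of _ x] bexI[of _ y]; simp)+
    then have steps: "(?a,q) \<in> step u" "(q,?b) \<in> step v" using t unfolding step_def by auto
    have "(?a x, ?b x) \<in> u" "(?a y, ?b y) \<in> v" "\<forall>k\<in>{1..m}. k \<noteq> x \<longrightarrow> k \<noteq> y \<longrightarrow> ?a k = ?b k"
      using u v qv xy by auto
    then have "\<exists>l\<in>L. (?a (l i), ?b (l i)) \<in> u \<and> (?a (l j), ?b (l j)) \<in> v \<and>
      (\<forall>k\<in>{1..m}. k \<noteq> l i \<longrightarrow> k \<noteq> l j \<longrightarrow> ?a k = ?b k)"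
      using l by (intro bexI[of _ l]) auto
    then have "(?a,?b) \<in> orbital i j u v" using t unfolding orbital_def by auto
    moreover have "?a \<in> E" "?b \<in> E" using ab xm unfolding E_def by auto
    ultimately have "(?a,?b) \<in> W u v" unfolding W_def using edges steps by auto
    then have "(?a,?b) \<in> WW" using u v \<open>u \<noteq> v\<close> unfolding WW_def P_def by auto
    then show ?thesis using ab by blast
  qed
  \<comment> \<open>One witness per pair of blocks is enough, since composing with
    \<open>sim\<close> on both sides fills the blocks.\<close>
  have "lift ?O = sim O WW O sim"
  proof (rule lift_eqI[OF O])
    show "sim O WW O sim \<subseteq> E \<times> E" using sim_subset by auto
    fix a b x y assume ab: "a \<in> e x" "b \<in> e y" and xm: "x \<in> {1..m}" "y \<in> {1..m}"
    show "(a,b) \<in> sim O WW O sim \<longleftrightarrow> (x,y) \<in> ?O"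
    proof
      assume "(a,b) \<in> sim O WW O sim"
      then obtain a' b' where *: "(a,a') \<in> sim" "(a',b') \<in> WW" "(b',b) \<in> sim" by auto
      then obtain x' y' where "x' \<in> {1..m}" "y' \<in> {1..m}" "a' \<in> e x'" "b' \<in> e y'"
        using sim_subset unfolding E_def by blast
      then have "a' \<in> e x" "b' \<in> e y" using * sim_iff ab xm by blast+
      then show "(x,y) \<in> ?O" using sound * xm by blast
    next
      assume "(x,y) \<in> ?O"
      then obtain a' b' where "a' \<in> e x" "b' \<in> e y" "(a',b') \<in> WW" using complete by blast
      then show "(a,b) \<in> sim O WW O sim" using sim_iff ab xm by blast
    qed
  qed
  then show ?thesis using rel rel_sim by (simp add: Z.rel_relcomp)
qed

lemma sim_Image: "a \<in> e i \<Longrightarrow> i \<in> {1..m} \<Longrightarrow> sim `` {a} = e i"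
  unfolding sim_def using e_unique by blast

text \<open>The relations on indices with visible blow-up are those of a coherent configuration, a
  fission of \<open>Inv(L)\<close> by \<open>rel_lift_orbit\<close>. The members of
  \<open>DD\<close> are visible in it, so it is complete, and a visible index is a visible
  block.\<close>

lemma set_e:
  assumes base: "generalized_base {1..m} (Inv_rels m L) DD"
    and DD: "\<And>D. D \<in> DD \<Longrightarrow> cc_set Z (\<Union>i\<in>D. e i)" and i: "i \<in> {1..m}"
  shows "cc_set Z (e i)"
proof -
  define \<R> where "\<R> = {R. R \<subseteq> {1..m} \<times> {1..m} \<and> cc_relation Z (lift R)}"
  have full: "{1..m} \<times> {1..m} \<in> \<R>"
  proof -
    have "lift ({1..m} \<times> {1..m}) = E \<times> E" by (rule lift_eqI) (auto simp: E_def)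
    then show ?thesis using Z.rel_Times[OF set_E set_E] by (simp add: \<R>_def)
  qed
  obtain S where S: "coherent_config {1..m} S" "\<And>R. cc_relation S R \<longleftrightarrow> R \<in> \<R>"
  proof (rule coherent_of_algebra[of "{1..m}" \<R>])
    show "Id_on {1..m} \<in> \<R>" using rel_sim lift_Id by (auto simp: \<R>_def)
    fix R R' assume R: "R \<in> \<R>" "R' \<in> \<R>"
    then have sub: "R \<subseteq> {1..m} \<times> {1..m}" "R' \<subseteq> {1..m} \<times> {1..m}" by (auto simp: \<R>_def)
    have "lift (R - R') = lift R - lift R'"
    proof (rule lift_eqI)
      show "lift R - lift R' \<subseteq> E \<times> E" using lift_subset[OF sub(1)] by auto
      fix a b x y assume "a \<in> e x" "b \<in> e y" "x \<in> {1..m}" "y \<in> {1..m}"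
      then show "(a,b) \<in> lift R - lift R' \<longleftrightarrow> (x,y) \<in> R - R'" using lift_iff sub by simp
    qed (use sub in auto)
    then show "R - R' \<in> \<R>" using R Z.rel_Diff by (auto simp: \<R>_def)
  next
    fix R assume R: "R \<in> \<R>"
    have "lift (R\<inverse>) = (lift R)\<inverse>" by (auto simp: lift_def)
    then show "R\<inverse> \<in> \<R>" using R Z.rel_converse by (auto simp: \<R>_def)
  next
    fix R R' t x y x' y'
    assume R: "R \<in> \<R>" "R' \<in> \<R>" "t \<in> \<R>"
      and R_atom: "\<And>Q. Q \<in> \<R> \<Longrightarrow> R \<subseteq> Q \<or> R \<inter> Q = {}"
      and t_atom: "\<And>Q. Q \<in> \<R> \<Longrightarrow> t \<subseteq> Q \<or> t \<inter> Q = {}" and xy: "(x,y) \<in> t" "(x',y') \<in> t"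
    define N where "N x y = {k. (x,k) \<in> R \<and> (k,y) \<in> R'}" for x y
    have sub: "R \<subseteq> {1..m} \<times> {1..m}" "R' \<subseteq> {1..m} \<times> {1..m}" "t \<subseteq> {1..m} \<times> {1..m}"
      and rel: "cc_relation Z (lift R)" "cc_relation Z (lift R')"
      using R by (auto simp: \<R>_def)
    show "card {k. (x,k) \<in> R \<and> (k,y) \<in> R'} = card {k. (x',k) \<in> R \<and> (k,y') \<in> R'}"
    proof (cases "R = {}")
      case False
      then obtain z k where zk: "(z,k) \<in> R" by auto
      then have k: "z \<in> {1..m}" "k \<in> {1..m}" using sub by auto
      \<comment> \<open>Blocks may differ in size, which would spoil the comparison of counts of
        tuples with counts of indices. For an atom \<open>R\<close>, however, all target blocks have
        the same size \<open>w\<close>, because block sizes are visible as degrees in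
        \<open>sim\<close>.\<close>
      define w where "w = card (e k)"
      have w: "w > 0" using e_nonempty[OF k(2)] finite_e by (simp add: w_def card_gt_0_iff)
      have "{1..m} \<times> {k \<in> {1..m}. card (e k) = w} \<in> \<R>"
      proof -
        have "lift ({1..m} \<times> {k \<in> {1..m}. card (e k) = w})
            = E \<times> (E \<inter> {a \<in> tuples m \<Gamma>. card (sim `` {a}) = w})"
          by (rule lift_eqI) (use sim_Image e_tuples in \<open>auto simp: E_def\<close>)
        then show ?thesis
          using Z.rel_Times[OF set_E Z.set_Int[OF set_E Z.set_degree[OF rel_sim, of "\<lambda>n. n = w"]]]
          by (auto simp: \<R>_def)
      qed
      from R_atom[OF this] have Rw: "R \<subseteq> {1..m} \<times> {k \<in> {1..m}. card (e k) = w}" using zk k w_def by blast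
      have count: "card {g. (a,g) \<in> lift R \<and> (g,b) \<in> lift R'} = w * card (N x y)"
        if "a \<in> e x" "b \<in> e y" "x \<in> {1..m}" "y \<in> {1..m}" for a b x y
      proof -
        have "{g. (a,g) \<in> lift R \<and> (g,b) \<in> lift R'} = (\<Union>k\<in>N x y. e k)"
        proof (intro equalityI subsetI)
          fix g assume g: "g \<in> {g. (a,g) \<in> lift R \<and> (g,b) \<in> lift R'}"
          then obtain k where k: "k \<in> {1..m}" "g \<in> e k" using lift_subset[OF sub(1)] unfolding E_def by blast
          have "(x,k) \<in> R" "(k,y) \<in> R'"
            using g lift_iff[OF sub(1) that(1) k(2) that(3) k(1)] lift_iff[OF sub(2) k(2) that(2) k(1) that(4)]
            by simp_all
          then show "g \<in> (\<Union>k\<in>N x y. e k)" using k unfolding N_def by blast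
        next
          fix g assume "g \<in> (\<Union>k\<in>N x y. e k)"
          then obtain k where "(x,k) \<in> R" "(k,y) \<in> R'" "g \<in> e k" by (auto simp: N_def)
          then show "g \<in> {g. (a,g) \<in> lift R \<and> (g,b) \<in> lift R'}" using that unfolding lift_def by blast
        qed
        moreover have Nm: "N x y \<subseteq> {1..m}" using sub unfolding N_def by blast
        have "card (\<Union>k\<in>N x y. e k) = (\<Sum>k\<in>N x y. card (e k))"
        proof (rule card_UN_disjoint)
          show "finite (N x y)" using Nm finite_subset by blast
          show "\<forall>k\<in>N x y. \<forall>k'\<in>N x y. k \<noteq> k' \<longrightarrow> e k \<inter> e k' = {}" using e_unique Nm by blast
        qed (simp add: finite_e)
        moreover have "(\<Sum>k\<in>N x y. card (e k)) = (\<Sum>k\<in>N x y. w)"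
          by (rule sum.cong) (use Rw in \<open>auto simp: N_def\<close>)
        ultimately show ?thesis by simp
      qed
      \<comment> \<open>The index pairs with the same count as \<open>(x,y)\<close> form a member of
        \<open>\<R>\<close>; as it meets the atom \<open>t\<close>, it contains
        \<open>t\<close>.\<close>
      define P where "P = {(p,q) \<in> {1..m} \<times> {1..m}. card (N p q) = card (N x y)}"
      have "lift P = (E \<times> E) \<inter> {(a,b). a \<in> tuples m \<Gamma> \<and> b \<in> tuples m \<Gamma> \<and>
          card {g. (a,g) \<in> lift R \<and> (g,b) \<in> lift R'} = w * card (N x y)}" (is "_ = _ \<inter> ?C")
      proof (rule lift_eqI)
        fix a b p q assume *: "a \<in> e p" "b \<in> e q" "p \<in> {1..m}" "q \<in> {1..m}"
        then have "a \<in> E" "b \<in> E" "a \<in> tuples m \<Gamma>" "b \<in> tuples m \<Gamma>" using e_tuples unfolding E_def by blast+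
        then show "(a,b) \<in> (E \<times> E) \<inter> ?C \<longleftrightarrow> (p,q) \<in> P" using count[OF *] * w by (simp add: P_def)
      qed (auto simp: P_def)
      then have "cc_relation Z (lift P)"
        using Z.rel_Int[OF Z.rel_Times[OF set_E set_E] Z.rel_count[OF rel, of "\<lambda>n. n = w * card (N x y)"]] by simp
      then have "P \<in> \<R>" by (auto simp: \<R>_def P_def)
      then have "t \<subseteq> P" using t_atom[of P] xy sub(3) by (auto simp: P_def)
      then have "card (N x' y') = card (N x y)" using xy by (auto simp: P_def)
      then show ?thesis by (simp add: N_def)
    qed simp
  qed (use full in \<open>auto simp: \<R>_def\<close>)
  interpret S: coherent "{1..m}" S using S by unfold_locales
  have fis: "fission {1..m} (Inv_rels m L) S"
    unfolding fission_def
  proof (intro conjI allI impI S(1))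
    fix r assume "cc_relation (Inv_rels m L) r"
    then obtain S0 where S0: "S0 \<subseteq> Inv_rels m L" "r = \<Union>S0" by (auto simp: cc_relation_def)
    have "cc_relation S s" if "s \<in> S0" for s
    proof -
      have "s \<in> Inv_rels m L" using S0 that by blast
      then obtain x y where "x \<in> {1..m}" "y \<in> {1..m}" "s = {(l x, l y) | l. l \<in> L}" by (auto simp: Inv_rels_def)
      moreover have "s \<subseteq> {1..m} \<times> {1..m}" using Inv_rels_subset[OF group] \<open>s \<in> Inv_rels m L\<close> by blast
      ultimately show ?thesis using rel_lift_orbit unfolding S(2) \<R>_def by simp
    qed
    then show "cc_relation S r" unfolding S0(2) by (rule cc_relation_Union)
  qed
  have "cc_set S D" if D: "D \<in> DD" for D
  proof -
    have Dm: "D \<subseteq> {1..m}" using base D by (auto simp: generalized_base_def)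
    have "lift (Id_on D) = sim \<inter> (\<Union>i\<in>D. e i) \<times> (\<Union>i\<in>D. e i)"
    proof (rule lift_eqI)
      show "Id_on D \<subseteq> {1..m} \<times> {1..m}" using Dm by auto
      show "sim \<inter> (\<Union>i\<in>D. e i) \<times> (\<Union>i\<in>D. e i) \<subseteq> E \<times> E" using sim_subset by auto
      fix a b x y assume *: "a \<in> e x" "b \<in> e y" "x \<in> {1..m}" "y \<in> {1..m}"
      have "a \<in> (\<Union>i\<in>D. e i) \<longleftrightarrow> x \<in> D" "b \<in> (\<Union>i\<in>D. e i) \<longleftrightarrow> y \<in> D" using * e_unique Dm by blast+
      then show "(a,b) \<in> sim \<inter> (\<Union>i\<in>D. e i) \<times> (\<Union>i\<in>D. e i) \<longleftrightarrow> (x,y) \<in> Id_on D"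
        using sim_iff[OF *] by auto
    qed
    then have "cc_relation Z (lift (Id_on D))" using Z.rel_restrict[OF DD[OF D] rel_sim DD[OF D]] by simp
    then show ?thesis unfolding cc_set_def S(2) \<R>_def using Dm by auto
  qed
  then have "cc_complete S"
    using base fis unfolding generalized_base_iff[OF finite_atLeastAtMost Inv_rels_subset[OF group]] by blast
  then have "cc_set S {i}" using S.complete_iff i by blast
  then have "cc_relation Z (lift (Id_on {i}))" unfolding cc_set_def S(2) \<R>_def by blast
  moreover have "e i = Domain (lift (Id_on {i}))" by (auto simp: lift_def)
  ultimately show ?thesis using Z.set_Domain by metis
qed

end

section \<open>The induced configurations on the coordinates\<close>

context exp_core
begin

text \<open>An edge from \<open>B\<close> into \<open>e i\<close> changes the entry at
  \<open>i\<close> to one outside \<open>Q i\<close>. It comes closer to \<open>a\<close> iff the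
  new entry is \<open>a i\<close>, so the tuples approached by such edges are those with an entry
  outside \<open>Q i\<close>.\<close>

lemma set_coordinate:
  assumes i: "i \<in> {1..m}" and ei: "cc_set Z (e i)"
  shows "cc_set Z {a \<in> tuples m \<Gamma>. a i \<notin> Q i}"
proof -
  let ?R = "Dist 1 \<inter> B \<times> e i"
  have lineD: "line m i q f \<and> q i \<in> Q i \<and> f i \<notin> Q i" if "(q,f) \<in> ?R" for q f
  proof -
    have *: "q \<in> B" "f \<in> e i" "hdist m f q = 1" using that hdist_commute[of m q f] by (auto simp: Dist_def)
    show ?thesis using line_sym[OF adjacent_B(1)[OF *(2) i *(1,3)]] * i by (auto simp: B_iff e_def)
  qed
  have "{a \<in> tuples m \<Gamma>. a i \<notin> Q i} = Range (closer ?R)"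
  proof (intro equalityI subsetI)
    fix a assume "a \<in> {a \<in> tuples m \<Gamma>. a i \<notin> Q i}"
    then have a: "a \<in> tuples m \<Gamma>" "a i \<in> \<Gamma> - Q i" using tuples_mem i by auto
    obtain q where q: "q \<in> B" using B_nonempty by blast
    \<comment> \<open>Copying the entry of \<open>a\<close> at \<open>i\<close> into a tuple of
      \<open>B\<close> gives an element of \<open>e i\<close> that is one closer to
      \<open>a\<close>.\<close>
    let ?f = "q(i := a i)"
    have f: "?f \<in> e i" using upd_e[OF q i a(2)] .
    have n: "q i \<noteq> a i" using q a i by (auto simp: B_iff)
    have t: "q \<in> tuples m \<Gamma>" "?f \<in> tuples m \<Gamma>" using q f e_tuples by (auto simp: B_iff)
    have "(q,?f) \<in> ?R" using q f t upd_adjacent[OF i, of q "a i"] n by (simp add: Dist_def)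
    moreover have "hdist m q a = hdist m ?f a + 1"
      using hdist_line[OF i line_upd[of m i q "a i"], of a] n by simp
    ultimately have "\<exists>f. (q,f) \<in> ?R \<and> hdist m q a = hdist m f a + 1" by (intro exI[of _ ?f] conjI)
    then have "(q,a) \<in> closer ?R" using t a unfolding closer_def by blast
    then show "a \<in> Range (closer ?R)" by blast
  next
    fix a assume "a \<in> Range (closer ?R)"
    then obtain q f where *: "a \<in> tuples m \<Gamma>" "(q,f) \<in> ?R" "hdist m q a = hdist m f a + 1"
      by (auto simp: closer_def)
    have l: "line m i q f" "f i \<notin> Q i" using lineD *(2) by auto
    have "f i = a i" using hdist_line[OF i l(1), of a] *(3) by (cases "f i = a i"; cases "q i = a i") auto
    then show "a \<in> {a \<in> tuples m \<Gamma>. a i \<notin> Q i}" using l * by simp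
  qed
  then show ?thesis using Z.set_Range[OF rel_closer[OF Z.rel_restrict[OF set_B rel_Dist ei]]] by simp
qed

end

section \<open>Coordinates made visible by one proper cylinder in each of them\<close>

locale exp_coord = exp_fission +
  fixes C :: "nat \<Rightarrow> 'a set"
  assumes C_subset: "\<And>i. i \<in> {1..m} \<Longrightarrow> C i \<subseteq> \<Gamma>"
    and C_nonempty: "\<And>i. i \<in> {1..m} \<Longrightarrow> C i \<noteq> {}"
    and C_proper: "\<And>i. i \<in> {1..m} \<Longrightarrow> \<Gamma> - C i \<noteq> {}"
    and C_set: "\<And>i. i \<in> {1..m} \<Longrightarrow> cc_set Z {a \<in> tuples m \<Gamma>. a i \<in> C i}"
begin

definition K :: "nat \<Rightarrow> (nat \<Rightarrow> 'a) rel" where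
  "K i = {(a,b). a \<in> tuples m \<Gamma> \<and> b \<in> tuples m \<Gamma> \<and> line m i a b}"

text \<open>Two tuples at distance one on different sides of the cylinder over \<open>C i\<close>
  must differ at \<open>i\<close>. One such crossing joins points of the line on opposite sides, two
  crossings join points on the same side.\<close>

lemma rel_K:
  assumes i: "i \<in> {1..m}"
  shows "cc_relation Z (K i)"
proof -
  let ?A = "{a \<in> tuples m \<Gamma>. a i \<in> C i}"
  let ?A' = "tuples m \<Gamma> - ?A"
  define F where "F = (Dist 1 \<inter> ?A \<times> ?A') \<union> (Dist 1 \<inter> ?A' \<times> ?A)"
  have A': "cc_set Z ?A'" using Z.set_Diff[OF Z.set_full C_set[OF i]] .
  have rel: "cc_relation Z F" unfolding F_def
    using C_set[OF i] A' rel_Dist by (intro Z.rel_Un Z.rel_restrict)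
  have F_iff: "(a,b) \<in> F \<longleftrightarrow> (a,b) \<in> K i \<and> (a i \<in> C i) \<noteq> (b i \<in> C i)" for a b
  proof
    assume "(a,b) \<in> F"
    then have *: "a \<in> tuples m \<Gamma>" "b \<in> tuples m \<Gamma>" "hdist m a b = 1" "(a i \<in> C i) \<noteq> (b i \<in> C i)"
      by (auto simp: F_def Dist_def)
    obtain j where j: "j \<in> {1..m}" "line m j a b" using *(3) hdist_1_iff[of m a b] by auto
    have "a i \<noteq> b i" using * by auto
    then have "j = i" using j i unfolding line_def by metis
    then show "(a,b) \<in> K i \<and> (a i \<in> C i) \<noteq> (b i \<in> C i)" using * j by (simp add: K_def)
  next
    assume *: "(a,b) \<in> K i \<and> (a i \<in> C i) \<noteq> (b i \<in> C i)"
    then have "a i \<noteq> b i" by auto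
    then have "hdist m a b = 1" using * i hdist_1_iff[of m a b] by (auto simp: K_def)
    then show "(a,b) \<in> F" using * by (auto simp: F_def Dist_def K_def)
  qed
  have "K i = Id_on (tuples m \<Gamma>) \<union> F \<union> F O F"
  proof (intro equalityI subrelI)
    fix a b assume ab: "(a,b) \<in> K i"
    then have *: "a \<in> tuples m \<Gamma>" "b \<in> tuples m \<Gamma>" "line m i a b" by (auto simp: K_def)
    show "(a,b) \<in> Id_on (tuples m \<Gamma>) \<union> F \<union> F O F"
    proof (cases "(a i \<in> C i) = (b i \<in> C i)")
      case True
      \<comment> \<open>An entry on the other side of \<open>C i\<close> exists because
        \<open>C i\<close> is neither empty nor all of \<open>\<Gamma>\<close>.\<close>
      obtain x where x: "x \<in> \<Gamma>" "(x \<in> C i) \<noteq> (a i \<in> C i)"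
        using C_nonempty[OF i] C_proper[OF i] C_subset[OF i] by (cases "a i \<in> C i") auto
      let ?g = "a(i := x)"
      have g: "?g \<in> tuples m \<Gamma>" using tuples_upd[OF *(1) i x(1)] .
      have l: "line m i a ?g" "line m i ?g b" using *(3) by (auto simp: line_def)
      have "(a,?g) \<in> F" "(?g,b) \<in> F" unfolding F_iff using * g l x True by (auto simp: K_def)
      then have "(a,b) \<in> F O F" by (rule relcompI)
      then show ?thesis by simp
    next
      case False
      then show ?thesis using ab F_iff by blast
    qed
  next
    fix a b assume "(a,b) \<in> Id_on (tuples m \<Gamma>) \<union> F \<union> F O F"
    then consider "a = b" "a \<in> tuples m \<Gamma>" | "(a,b) \<in> F" | g where "(a,g) \<in> F" "(g,b) \<in> F" by auto
    then show "(a,b) \<in> K i"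
    proof cases
      case 1 then show ?thesis by (simp add: K_def line_refl)
    next
      case 2 then show ?thesis using F_iff by blast
    next
      case 3
      then have "(a,g) \<in> K i" "(g,b) \<in> K i" using F_iff by blast+
      then show ?thesis using line_trans[of m i a g b] by (simp add: K_def)
    qed
  qed
  then show ?thesis using Z.rel_Un[OF Z.rel_Un[OF Z.rel_Id rel] Z.rel_relcomp[OF rel rel]] by simp
qed

lemma ex_other: "i \<in> {1..m} \<Longrightarrow> \<exists>y\<in>\<Gamma>. y \<noteq> x"
proof -
  assume i: "i \<in> {1..m}"
  obtain y z where "y \<in> C i" "z \<in> \<Gamma> - C i" using C_nonempty[OF i] C_proper[OF i] by blast
  then have "y \<in> \<Gamma>" "z \<in> \<Gamma>" "y \<noteq> z" using C_subset[OF i] by auto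
  then show ?thesis by metis
qed

text \<open>Restricting \<open>pull\<close> to the lines in direction \<open>i\<close> forces the
  tested change into that coordinate, so each factor is recovered separately.\<close>

lemma set_coordinate_of_product:
  assumes w: "\<And>i. i \<in> {1..m} \<Longrightarrow> w i \<subseteq> \<Gamma> \<and> w i \<noteq> {}" and W: "cc_set Z (PiE {1..m} w)"
    and i: "i \<in> {1..m}"
  shows "cc_set Z {a \<in> tuples m \<Gamma>. a i \<in> w i}"
proof -
  have "{a \<in> tuples m \<Gamma>. a i \<in> w i} = Range (pull (PiE {1..m} w) \<inter> K i)"
  proof (intro equalityI subsetI)
    fix g assume g: "g \<in> {a \<in> tuples m \<Gamma>. a i \<in> w i}"
    obtain y where y: "y \<in> \<Gamma>" "y \<noteq> g i" using ex_other[OF i] by blast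
    let ?d = "g(i := y)"
    have d: "?d \<in> tuples m \<Gamma>" using tuples_upd[OF _ i y(1)] g by simp
    have l: "line m i ?d g" by (simp add: line_def)
    then have "\<exists>j\<in>{1..m}. line m j ?d g \<and> ?d j \<noteq> g j \<and> g j \<in> w j"
      using g y i by (intro bexI[of _ i]) auto
    then have "(?d,g) \<in> pull (PiE {1..m} w)" using pull_iff[where w = w and d = ?d and g = g, OF w] d g by simp
    moreover have "(?d,g) \<in> K i" using d g l by (simp add: K_def)
    ultimately show "g \<in> Range (pull (PiE {1..m} w) \<inter> K i)" by blast
  next
    fix g assume "g \<in> Range (pull (PiE {1..m} w) \<inter> K i)"
    then obtain d where d: "(d,g) \<in> pull (PiE {1..m} w)" "(d,g) \<in> K i" by blast
    obtain j where j: "g \<in> tuples m \<Gamma>" "j \<in> {1..m}" "line m j d g" "d j \<noteq> g j" "g j \<in> w j"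
      using pull_iff[where w = w and d = d and g = g, OF w] d(1) by auto
    have "line m i d g" using d by (simp add: K_def)
    then have "j = i" using line_unique[OF j(3) _ j(2) i j(4)] by blast
    then show "g \<in> {a \<in> tuples m \<Gamma>. a i \<in> w i}" using j by simp
  qed
  then show ?thesis using Z.set_Range[OF Z.rel_Int[OF rel_pull[OF W] rel_K[OF i]]] by simp
qed

definition V :: "nat \<Rightarrow> 'a rel \<Rightarrow> (nat \<Rightarrow> 'a) rel" where
  "V i R = {(a,b) \<in> K i. (a i, b i) \<in> R}"

lemma V_Id_on: "i \<in> {1..m} \<Longrightarrow> V i (Id_on P) = Id_on {a \<in> tuples m \<Gamma>. a i \<in> P}"
proof (intro equalityI subrelI)
  fix a b assume i: "i \<in> {1..m}" and "(a,b) \<in> V i (Id_on P)"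
  then have *: "a \<in> tuples m \<Gamma>" "b \<in> tuples m \<Gamma>" "line m i a b" "a i = b i" "a i \<in> P" by (auto simp: V_def K_def)
  have "a = b" by (rule tuples_eqI[OF *(1,2)]) (use *(3,4) in \<open>auto simp: line_def\<close>)
  then show "(a,b) \<in> Id_on {a \<in> tuples m \<Gamma>. a i \<in> P}" using * by auto
qed (auto simp: V_def K_def line_refl)

text \<open>For irreflexive \<open>R\<close> a step along \<open>R\<close> on a line in direction
  \<open>i\<close> can only happen at \<open>i\<close>. The diagonal part needs a separate argument,
  as a step between equal tuples does not reveal its coordinate.\<close>

lemma rel_V:
  assumes i: "i \<in> {1..m}" and R: "cc_relation T R"
  shows "cc_relation Z (V i R)"
proof -
  have irr: "cc_relation Z (V i R)" if R: "cc_relation T R" "\<And>x. (x,x) \<notin> R" for R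
  proof -
    have "V i R = K i \<inter> step R"
    proof (intro equalityI subrelI)
      fix a b assume "(a,b) \<in> V i R"
      then show "(a,b) \<in> K i \<inter> step R" using i by (auto simp: V_def K_def step_def)
    next
      fix a b assume ab: "(a,b) \<in> K i \<inter> step R"
      then obtain j where j: "j \<in> {1..m}" "line m j a b" "(a j, b j) \<in> R" by (auto simp: step_def)
      have "a j \<noteq> b j" using R(2) j(3) by metis
      then have "j = i" using line_unique[OF j(2) _ j(1) i] ab by (simp add: K_def)
      then show "(a,b) \<in> V i R" using ab j by (simp add: V_def)
    qed
    then show ?thesis using Z.rel_Int[OF rel_K[OF i] rel_step[OF R(1)]] by simp
  qed
  define \<Psi> where "\<Psi> = {x. (x,x) \<in> R}"
  have Id: "Id_on \<Psi> = R \<inter> Id_on \<Gamma>" using Y.rel_subset[OF R] by (auto simp: \<Psi>_def)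
  have \<Psi>: "cc_set T \<Psi>" unfolding cc_set_def Id by (rule Y.rel_Int[OF R Y.rel_Id])
  \<comment> \<open>An irreflexive relation that starts exactly at the points of
    \<open>\<Psi>\<close>, so its domain on the lines is the cylinder over
    \<open>\<Psi>\<close>.\<close>
  let ?R0 = "\<Psi> \<times> \<Gamma> - Id_on \<Gamma>"
  have R0: "cc_relation T ?R0" using Y.rel_Diff[OF Y.rel_Times[OF \<Psi> Y.set_full] Y.rel_Id] .
  have "(x,x) \<notin> ?R0" for x by auto
  from irr[OF R0 this] have "cc_set Z (Domain (V i ?R0))" by (rule Z.set_Domain)
  moreover have "Domain (V i ?R0) = {a \<in> tuples m \<Gamma>. a i \<in> \<Psi>}"
  proof (intro equalityI subsetI)
    fix a assume a: "a \<in> {a \<in> tuples m \<Gamma>. a i \<in> \<Psi>}"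
    obtain y where y: "y \<in> \<Gamma>" "y \<noteq> a i" using ex_other[OF i] by blast
    have "a(i := y) \<in> tuples m \<Gamma>" using tuples_upd[OF _ i y(1)] a by simp
    then have "(a, a(i := y)) \<in> V i ?R0" using a y by (auto simp: V_def K_def line_def)
    then show "a \<in> Domain (V i ?R0)" by blast
  qed (auto simp: V_def K_def)
  ultimately have "cc_relation Z (V i (Id_on \<Psi>))" unfolding cc_set_def V_Id_on[OF i] by simp
  moreover have "cc_relation Z (V i (R - Id_on \<Gamma>))"
    by (rule irr[OF Y.rel_Diff[OF R Y.rel_Id]]) (use Y.rel_subset[OF R] in auto)
  moreover have "V i R = V i (Id_on \<Psi>) \<union> V i (R - Id_on \<Gamma>)" unfolding Id by (auto simp: V_def)
  ultimately show ?thesis using Z.rel_Un by simp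
qed

lemma set_coordinate_of_set:
  assumes "i \<in> {1..m}" "cc_set T P"
  shows "cc_set Z {a \<in> tuples m \<Gamma>. a i \<in> P}"
  using rel_V[OF assms(1) assms(2)[unfolded cc_set_def]] unfolding cc_set_def V_Id_on[OF assms(1)] .

text \<open>The relations on \<open>\<Gamma>\<close> that are visible along the lines in direction
  \<open>i\<close> form a coherent fission of \<open>T\<close>. It sees the generalized base, so it
  is complete and sees every point.\<close>

lemma set_coordinate_point:
  assumes base: "generalized_base \<Gamma> T PP" and i: "i \<in> {1..m}" and x: "x \<in> \<Gamma>"
    and PP: "\<And>P. P \<in> PP \<Longrightarrow> cc_set Z {a \<in> tuples m \<Gamma>. a i \<in> P}"
  shows "cc_set Z {a \<in> tuples m \<Gamma>. a i = x}"
proof -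
  define \<R> where "\<R> = {R. R \<subseteq> \<Gamma> \<times> \<Gamma> \<and> cc_relation Z (V i R)}"
  have T_R: "R \<in> \<R>" if "cc_relation T R" for R using rel_V[OF i that] Y.rel_subset[OF that] by (simp add: \<R>_def)
  obtain S where S: "coherent_config \<Gamma> S" "\<And>R. cc_relation S R \<longleftrightarrow> R \<in> \<R>"
  proof (rule coherent_of_algebra[of \<Gamma> \<R>])
    show "finite \<Gamma>" by (rule Y.finite_points)
    show "\<Gamma> \<times> \<Gamma> \<in> \<R>" "Id_on \<Gamma> \<in> \<R>" using T_R Y.rel_full Y.rel_Id by auto
    fix R R' assume R: "R \<in> \<R>" "R' \<in> \<R>"
    have "V i (R - R') = V i R - V i R'" by (auto simp: V_def)
    then show "R - R' \<in> \<R>" using R Z.rel_Diff by (auto simp: \<R>_def)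
  next
    fix R assume R: "R \<in> \<R>"
    have "V i (R\<inverse>) = (V i R)\<inverse>" using line_sym by (auto simp: V_def K_def)
    then show "R\<inverse> \<in> \<R>" using R Z.rel_converse by (auto simp: \<R>_def)
  next
    fix R R' t x y x' y'
    assume R: "R \<in> \<R>" "R' \<in> \<R>" "t \<in> \<R>"
      and t_atom: "\<And>Q. Q \<in> \<R> \<Longrightarrow> t \<subseteq> Q \<or> t \<inter> Q = {}" and xy: "(x,y) \<in> t" "(x',y') \<in> t"
    define N where "N x y = {k. (x,k) \<in> R \<and> (k,y) \<in> R'}" for x y
    have sub: "R \<subseteq> \<Gamma> \<times> \<Gamma>" "R' \<subseteq> \<Gamma> \<times> \<Gamma>" "t \<subseteq> \<Gamma> \<times> \<Gamma>"
      and rel: "cc_relation Z (V i R)" "cc_relation Z (V i R')"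
      using R by (auto simp: \<R>_def)
    have count: "card {g. (a,g) \<in> V i R \<and> (g,b) \<in> V i R'} = card (N (a i) (b i))" if ab: "(a,b) \<in> K i" for a b
    proof -
      have *: "a \<in> tuples m \<Gamma>" "b \<in> tuples m \<Gamma>" "line m i a b" using ab by (auto simp: K_def)
      \<comment> \<open>All intermediate tuples lie on the line of \<open>a\<close> and are given by
        their entry at \<open>i\<close>, so counts in \<open>Z\<close> and in
        \<open>\<Gamma>\<close> agree.\<close>
      have "{g. (a,g) \<in> V i R \<and> (g,b) \<in> V i R'} = (\<lambda>z. a(i := z)) ` N (a i) (b i)"
      proof (intro equalityI subsetI)
        fix g assume "g \<in> {g. (a,g) \<in> V i R \<and> (g,b) \<in> V i R'}"
        then have g: "g \<in> tuples m \<Gamma>" "line m i a g" "g i \<in> N (a i) (b i)" by (auto simp: V_def K_def N_def)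
        have "g = a(i := g i)"
          by (rule tuples_eqI[OF g(1) tuples_upd[OF *(1) i]])
            (use g(2) tuples_mem[OF g(1) i] in \<open>auto simp: line_def\<close>)
        then show "g \<in> (\<lambda>z. a(i := z)) ` N (a i) (b i)" using g by blast
      next
        fix g assume "g \<in> (\<lambda>z. a(i := z)) ` N (a i) (b i)"
        then obtain z where z: "g = a(i := z)" "(a i, z) \<in> R" "(z, b i) \<in> R'" by (auto simp: N_def)
        then have "g \<in> tuples m \<Gamma>" using tuples_upd[OF *(1) i, of z] sub by auto
        moreover have "line m i a g" "line m i g b" using *(3) z(1) by (auto simp: line_def)
        ultimately show "g \<in> {g. (a,g) \<in> V i R \<and> (g,b) \<in> V i R'}" using * z by (simp add: V_def K_def)
      qed
      moreover have "inj_on (\<lambda>z. a(i := z)) (N (a i) (b i))" by (rule inj_onI) (metis fun_upd_same)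
      ultimately show ?thesis by (simp add: card_image)
    qed
    define P where "P = {(p,q) \<in> \<Gamma> \<times> \<Gamma>. card (N p q) = card (N x y)}"
    have "V i P = K i \<inter> {(a,b). a \<in> tuples m \<Gamma> \<and> b \<in> tuples m \<Gamma> \<and>
        card {g. (a,g) \<in> V i R \<and> (g,b) \<in> V i R'} = card (N x y)}"
    proof (intro equalityI subrelI)
      fix a b assume "(a,b) \<in> V i P"
      then show "(a,b) \<in> K i \<inter> {(a,b). a \<in> tuples m \<Gamma> \<and> b \<in> tuples m \<Gamma> \<and>
        card {g. (a,g) \<in> V i R \<and> (g,b) \<in> V i R'} = card (N x y)}"
        using count[of a b] by (auto simp: V_def P_def K_def)
    next
      fix a b assume ab: "(a,b) \<in> K i \<inter> {(a,b). a \<in> tuples m \<Gamma> \<and> b \<in> tuples m \<Gamma> \<and>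
        card {g. (a,g) \<in> V i R \<and> (g,b) \<in> V i R'} = card (N x y)}"
      then have "a i \<in> \<Gamma>" "b i \<in> \<Gamma>" using tuples_mem i by auto
      then show "(a,b) \<in> V i P" using count[of a b] ab by (auto simp: V_def P_def)
    qed
    then have "cc_relation Z (V i P)"
      using Z.rel_Int[OF rel_K[OF i] Z.rel_count[OF rel, of "\<lambda>n. n = card (N x y)"]] by simp
    then have "P \<in> \<R>" by (auto simp: \<R>_def P_def)
    then have "t \<subseteq> P" using t_atom[of P] xy sub(3) by (auto simp: P_def)
    then have "card (N x' y') = card (N x y)" using xy by (auto simp: P_def)
    then show "card {k. (x,k) \<in> R \<and> (k,y) \<in> R'} = card {k. (x',k) \<in> R \<and> (k,y') \<in> R'}" by (simp add: N_def)
  qed (auto simp: \<R>_def)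
  interpret S: coherent \<Gamma> S using S by unfold_locales
  have "fission \<Gamma> T S" unfolding fission_def using S T_R by blast
  moreover have "cc_set S P" if "P \<in> PP" for P
  proof -
    have "P \<subseteq> \<Gamma>" using base that by (auto simp: generalized_base_def)
    then show ?thesis using PP[OF that] unfolding cc_set_def S(2) \<R>_def V_Id_on[OF i, symmetric] by auto
  qed
  moreover have "T \<subseteq> Pow (\<Gamma> \<times> \<Gamma>)" using Y.basic_subset by blast
  ultimately have "cc_complete S"
    using base unfolding generalized_base_iff[OF Y.finite_points \<open>T \<subseteq> Pow (\<Gamma> \<times> \<Gamma>)\<close>] by blast
  then have "cc_set S {x}" using S.complete_iff x by blast
  then have "cc_relation Z (V i (Id_on {x}))" unfolding cc_set_def S(2) \<R>_def by blast
  then show ?thesis unfolding V_Id_on[OF i] cc_set_def by simp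
qed

text \<open>Each tuple is the intersection of the cylinders over its entries, all of which are
  visible by \<open>set_coordinate_point\<close>.\<close>

lemma complete:
  assumes base: "generalized_base \<Gamma> T PP"
    and PP: "\<And>i P. i \<in> {1..m} \<Longrightarrow> P \<in> PP \<Longrightarrow> cc_set Z {a \<in> tuples m \<Gamma>. a i \<in> P}"
  shows "cc_complete Z"
  unfolding Z.complete_iff
proof
  fix a assume a: "a \<in> tuples m \<Gamma>"
  have "cc_set Z {b \<in> tuples m \<Gamma>. \<forall>i\<in>I. b i = a i}" if "finite I" "I \<subseteq> {1..m}" for I
    using that
  proof (induction I)
    case empty
    then show ?case using Z.set_full by simp
  next
    case (insert i I)
    then have i: "i \<in> {1..m}" and IH: "cc_set Z {b \<in> tuples m \<Gamma>. \<forall>i\<in>I. b i = a i}" by auto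
    have "cc_set Z {b \<in> tuples m \<Gamma>. b i = a i}"
      by (rule set_coordinate_point[OF base i tuples_mem[OF a i] PP[OF i]])
    moreover have "{b \<in> tuples m \<Gamma>. \<forall>i\<in>insert i I. b i = a i}
        = {b \<in> tuples m \<Gamma>. b i = a i} \<inter> {b \<in> tuples m \<Gamma>. \<forall>i\<in>I. b i = a i}" by auto
    ultimately show ?case using Z.set_Int IH by simp
  qed
  from this[of "{1..m}"] have "cc_set Z {b \<in> tuples m \<Gamma>. \<forall>i\<in>{1..m}. b i = a i}" by simp
  moreover have "{b \<in> tuples m \<Gamma>. \<forall>i\<in>{1..m}. b i = a i} = {a}" using a tuples_eqI by blast
  ultimately show "cc_set Z {a}" by simp
qed

end

section \<open>Bases of an exponentiation\<close>

text \<open>Lists a family along a prescribed number of places, with \<open>c\<close> as padding, so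
  that two families of different sizes can be encoded place by place.\<close>

lemma ex_enumeration:
  assumes "finite A" "card A \<le> K"
  obtains f :: "nat \<Rightarrow> 'b" where "A \<subseteq> f ` {..<K}" "\<And>k. f k \<in> insert c A"
proof -
  obtain h where h: "bij_betw h {0..<card A} A" using ex_bij_betw_nat_finite[OF assms(1)] by blast
  define f where "f k = (if k < card A then h k else c)" for k
  have "A \<subseteq> f ` {..<K}"
  proof
    fix x assume "x \<in> A"
    then have "x \<in> h ` {0..<card A}" using h by (simp add: bij_betw_def)
    then obtain k where "k < card A" "x = h k" by auto
    then show "x \<in> f ` {..<K}" using assms(2) by (intro image_eqI[of _ _ k]) (auto simp: f_def)
  qed
  moreover have "f k \<in> insert c A" for k using h by (auto simp: f_def bij_betw_def)
  ultimately show ?thesis using that by blast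
qed

lemma fission_set: "fission \<Omega> S S' \<Longrightarrow> cc_set S A \<Longrightarrow> cc_set S' A"
  by (simp add: fission_def cc_set_def)

lemma (in coherent) set_empty: "cc_set S {}"
  using rel_empty by (simp add: cc_set_def)

lemma (in coherent) rels_subset: "S \<subseteq> Pow (\<Omega> \<times> \<Omega>)"
  using basic_subset by blast

lemma (in coherent) complete_if_trivial: "\<Omega> \<subseteq> {p} \<Longrightarrow> cc_complete S"
  unfolding complete_iff using set_full by (metis insert_absorb insert_subset singletonD subset_singletonD empty_iff)

lemma (in coherent) fission_refl: "fission \<Omega> S S"
  using coherent by (simp add: fission_def)

text \<open>Unions of fibers remain so in every fission, hence prescribing them imposes
  nothing.\<close>

lemma (in coherent) generalized_base_drop:
  assumes "generalized_base \<Omega> S PP" "PP0 \<subseteq> PP" "\<And>P. P \<in> PP - PP0 \<Longrightarrow> cc_set S P"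
  shows "generalized_base \<Omega> S PP0"
  unfolding generalized_base_iff[OF finite_points rels_subset]
proof (intro conjI allI impI)
  show "PP0 \<subseteq> Pow \<Omega>" using assms(1,2) by (auto simp: generalized_base_def)
  fix Z assume Z: "fission \<Omega> S Z \<and> (\<forall>P\<in>PP0. cc_set Z P)"
  have "cc_set Z P" if "P \<in> PP" for P
    using Z assms(3)[of P] fission_set[of \<Omega> S Z P] that by (cases "P \<in> PP0") auto
  then show "cc_complete Z"
    using assms(1) Z unfolding generalized_base_iff[OF finite_points rels_subset] by blast
qed

lemma (in coherent) complete_iff_empty_base: "cc_complete S \<longleftrightarrow> generalized_base \<Omega> S {}"
proof
  assume c: "cc_complete S"
  show "generalized_base \<Omega> S {}"
    unfolding generalized_base_iff[OF finite_points rels_subset]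
  proof (intro conjI allI impI)
    fix Z assume Z: "fission \<Omega> S Z \<and> (\<forall>P\<in>{}. cc_set Z P)"
    interpret Z: coherent \<Omega> Z using Z by unfold_locales (simp add: fission_def)
    show "cc_complete Z" using c Z fission_set unfolding complete_iff Z.complete_iff by blast
  qed simp
next
  assume "generalized_base \<Omega> S {}"
  then show "cc_complete S"
    using fission_refl unfolding generalized_base_iff[OF finite_points rels_subset] by blast
qed

text \<open>By \<open>two_types\<close> at least two types occur among the pairs entering
  \<open>A\<close>, so one of them differs from the type of any chosen pair leaving
  \<open>B\<close>. This provides \<open>Q_types\<close> in \<open>exp_core\<close>.\<close>

lemma (in coherent) types_of_nonsets:
  assumes anti: "cc_antisymmetric \<Omega> S" and A: "A \<subseteq> \<Omega>" "\<not> cc_set S A"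
    and B: "B \<subseteq> \<Omega>" "\<not> cc_set S B"
  shows "\<exists>x\<in>\<Omega> - A. \<exists>x'\<in>A. \<exists>y'\<in>B. \<exists>y\<in>\<Omega> - B. \<forall>t\<in>S. \<not> ((x,x') \<in> t \<and> (y',y) \<in> t)"
proof -
  obtain w' where w': "w' \<in> B" using B set_empty by fastforce
  have "B \<noteq> \<Omega>" using B set_full by auto
  then obtain w where w: "w \<in> \<Omega> - B" using B by auto
  obtain x x' y y' where *: "x \<in> \<Omega> - A" "x' \<in> A" "y \<in> \<Omega> - A" "y' \<in> A"
    "\<And>t. t \<in> S \<Longrightarrow> (x,x') \<in> t \<Longrightarrow> (y,y') \<notin> t" using two_types[OF anti A] by metis
  obtain t where t: "t \<in> S" "(w',w) \<in> t" using ex_basic[of "(w',w)"] w w' B by auto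
  have uniq: "t' = t" if "t' \<in> S" "(w',w) \<in> t'" for t' using basic_unique that t by blast
  show ?thesis
  proof (cases "(x,x') \<in> t")
    case True
    then have "\<forall>t'\<in>S. \<not> ((y,y') \<in> t' \<and> (w',w) \<in> t')" using *(5)[OF t(1)] uniq by blast
    then show ?thesis using * w w' by blast
  next
    case False
    then have "\<forall>t'\<in>S. \<not> ((x,x') \<in> t' \<and> (w',w) \<in> t')" using uniq by blast
    then show ?thesis using * w w' by blast
  qed
qed

lemma (in exp_core) exp_coord:
  assumes "generalized_base {1..m} (Inv_rels m L) DD" "\<And>D. D \<in> DD \<Longrightarrow> cc_set Z (\<Union>i\<in>D. e i)"
  shows "exp_coord \<Gamma> T m L Z (\<lambda>i. \<Gamma> - Q i)"
proof
  fix i assume i: "i \<in> {1..m}"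
  show "\<Gamma> - (\<Gamma> - Q i) \<noteq> {}" using Q_nonempty[OF i] Q_subset[OF i] by blast
  show "\<Gamma> - Q i \<noteq> {}" by (rule Q_proper[OF i])
  have "{a \<in> tuples m \<Gamma>. a i \<in> \<Gamma> - Q i} = {a \<in> tuples m \<Gamma>. a i \<notin> Q i}" using tuples_mem i by blast
  then show "cc_set Z {a \<in> tuples m \<Gamma>. a i \<in> \<Gamma> - Q i}" using set_coordinate[OF i set_e[OF assms i]] by simp
qed auto

text \<open>All factors are equal, so permuting coordinates preserves the product.\<close>

lemma (in exp_fission) set_power:
  assumes P: "cc_set T P"
  shows "cc_set Z (PiE {1..m} (\<lambda>_. P))"
  unfolding cc_set_def
proof (rule exp_relation, rule exp_relI[OF cc_T group])
  have P': "P \<subseteq> \<Gamma>" using Y.set_subset[OF P] .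
  have iff: "a \<in> PiE {1..m} (\<lambda>_. P) \<longleftrightarrow> a \<in> tuples m \<Gamma> \<and> (\<forall>i\<in>{1..m}. a i \<in> P)" for a
    using PiE_tuples_iff[of m "\<lambda>_. P" \<Gamma> a] P' by simp
  show "Id_on (PiE {1..m} (\<lambda>_. P)) \<subseteq> tuples m \<Gamma> \<times> tuples m \<Gamma>" using iff by auto
  fix a b a' b' l
  assume *: "(a,b) \<in> Id_on (PiE {1..m} (\<lambda>_. P))" "a' \<in> tuples m \<Gamma>" "b' \<in> tuples m \<Gamma>"
    "\<And>i. i \<in> {1..m} \<Longrightarrow> \<exists>t\<in>T. (a i, b i) \<in> t \<and> (a' i, b' i) \<in> t" "l \<in> L"
  have l: "l permutes {1..m}" using perm * by simp
  have diag: "(a' i, b' i) \<in> Id_on P" if i: "i \<in> {1..m}" for i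
  proof -
    have "(a i, b i) \<in> Id_on P" using *(1) i iff by auto
    then show ?thesis using same_type[OF *(4)[OF i] P[unfolded cc_set_def]] by simp
  qed
  have pt: "a' i \<in> P" "a' i = b' i" if "i \<in> {1..m}" for i using diag[OF that] by auto
  have a': "\<And>i. i \<in> {1..m} \<Longrightarrow> a' i \<in> P" "a' = b'" using pt tuples_eqI[OF *(2,3)] by simp_all
  have "perm_tuple l a' i \<in> P" if "i \<in> {1..m}" for i
    unfolding perm_tuple_def by (rule a'(1)) (use that permutes_in_image[OF permutes_inv[OF l]] in blast)
  then show "(perm_tuple l a', perm_tuple l b') \<in> Id_on (PiE {1..m} (\<lambda>_. P))"
    using a'(2) perm_tuple_tuples[OF l *(2)] iff by auto
qed

text \<open>In a complete \<open>T\<close> the product of copies of \<open>{y}\<close> is visible at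
  no cost and serves as the core. Only a generalized base of \<open>Inv(L)\<close> has to be
  encoded, and no base of \<open>T\<close> is required afterwards.\<close>

lemma gb_exp_le_complete:
  fixes \<Gamma> :: "'a set"
  assumes cT: "coherent_config \<Gamma> T" and grp: "perm_group_on m L" and tr: "transitive_on m L"
    and compl: "cc_complete T"
  shows "gb (tuples m \<Gamma>) (exp_rels m \<Gamma> T L) \<le> gb {1..m} (Inv_rels m L)"
proof -
  interpret Y: coherent \<Gamma> T using cT by unfold_locales
  note iff = generalized_base_iff[OF finite_tuples[OF Y.finite_points] exp_rels_subset[OF grp]]
  show ?thesis
  proof (cases "\<exists>x y. x \<in> \<Gamma> \<and> y \<in> \<Gamma> \<and> x \<noteq> y")
    case False
    have "\<exists>p. tuples m \<Gamma> \<subseteq> {p}"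
    proof (cases "tuples m \<Gamma> = {}")
      case False
      then obtain p where p: "p \<in> tuples m \<Gamma>" by blast
      have "q = p" if "q \<in> tuples m \<Gamma>" for q
        by (rule tuples_eqI[OF that p])
          (use tuples_mem[OF that] tuples_mem[OF p] \<open>\<not> (\<exists>x y. x \<in> \<Gamma> \<and> y \<in> \<Gamma> \<and> x \<noteq> y)\<close> in blast)
      then show ?thesis by blast
    qed auto
    then obtain p where p: "tuples m \<Gamma> \<subseteq> {p}" by blast
    have "generalized_base (tuples m \<Gamma>) (exp_rels m \<Gamma> T L) {}"
      unfolding iff
    proof (intro conjI allI impI)
      fix Z assume Z: "fission (tuples m \<Gamma>) (exp_rels m \<Gamma> T L) Z \<and> (\<forall>P\<in>{}. cc_set Z P)"
      interpret Z: coherent "tuples m \<Gamma>" Z using Z by unfold_locales (simp add: fission_def)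
      show "cc_complete Z" using Z.complete_if_trivial[OF p] .
    qed simp
    from gb_le[OF this] show ?thesis by simp
  next
    case True
    then obtain x y where xy: "x \<in> \<Gamma>" "y \<in> \<Gamma>" "x \<noteq> y" by blast
    obtain DD where DD: "generalized_base {1..m} (Inv_rels m L) DD" "card DD = gb {1..m} (Inv_rels m L)"
      using gb_attained[OF finite_atLeastAtMost Inv_rels_subset[OF grp]] by metis
    have Dm: "D \<subseteq> {1..m}" if "D \<in> DD" for D using DD(1) that by (auto simp: generalized_base_def)
    then have finDD: "finite DD" by (intro finite_subset[of DD "Pow {1..m}"]) auto
    \<comment> \<open>The factor has size one exactly on \<open>D\<close>, because
      \<open>\<Gamma>\<close> has at least two points; \<open>set_of_size\<close> then recovers
      \<open>D\<close>.\<close>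
    define w where "w D i = (if i \<in> D then {x} else \<Gamma>)" for D and i :: nat
    have w: "w D i \<subseteq> \<Gamma> \<and> w D i \<noteq> {}" for D i using xy by (auto simp: w_def)
    have card_w: "i \<in> D \<longleftrightarrow> card (w D i) = 1" for D i
    proof -
      have "card \<Gamma> \<noteq> 1"
      proof
        assume "card \<Gamma> = 1"
        then obtain z where "\<Gamma> = {z}" by (rule card_1_singletonE)
        then show False using xy by simp
      qed
      then show ?thesis by (simp add: w_def)
    qed
    let ?PP = "(\<lambda>D. PiE {1..m} (w D)) ` DD"
    have "generalized_base (tuples m \<Gamma>) (exp_rels m \<Gamma> T L) ?PP"
      unfolding iff
    proof (intro conjI allI impI)
      show "?PP \<subseteq> Pow (tuples m \<Gamma>)" using PiE_tuples_iff[of m _ \<Gamma>] w by blast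
      fix Z assume Z: "fission (tuples m \<Gamma>) (exp_rels m \<Gamma> T L) Z \<and> (\<forall>P\<in>?PP. cc_set Z P)"
      interpret F: exp_fission \<Gamma> T m L Z using Z cT grp by unfold_locales auto
      interpret C: exp_core \<Gamma> T m L Z "\<lambda>_. {y}"
      proof
        show "cc_set Z (PiE {1..m} (\<lambda>_. {y}))" using F.set_power compl xy Y.complete_iff by blast
        \<comment> \<open>In a complete configuration \<open>(x,y)\<close> and \<open>(y,x)\<close>
          are distinct singleton types.\<close>
        show "\<exists>u\<in>\<Gamma> - {y}. \<exists>x'\<in>{y}. \<exists>y'\<in>{y}. \<exists>v\<in>\<Gamma> - {y}. \<forall>t\<in>T. \<not> ((u,x') \<in> t \<and> (y',v) \<in> t)"
        proof -
          have "\<not> ((x,y) \<in> t \<and> (y,x) \<in> t)" if "t \<in> T" for t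
          proof
            assume xt: "(x,y) \<in> t \<and> (y,x) \<in> t"
            obtain p where "t = {p}" using compl \<open>t \<in> T\<close> unfolding cc_complete_def by blast
            then show False using xt xy(3) by auto
          qed
          then show ?thesis
            by - (rule bexI[of _ x], rule bexI[of _ y], rule bexI[of _ y], rule bexI[of _ x], use xy in auto)
        qed
      qed (use tr xy in auto)
      have vis: "cc_set Z (\<Union>i\<in>D. C.e i)" if D: "D \<in> DD" for D
        by (rule C.set_of_size[of "w D" D 1]) (use w Dm D Z card_w in auto)
      interpret K: exp_coord \<Gamma> T m L Z "\<lambda>i. \<Gamma> - {y}" by (rule C.exp_coord[OF DD(1) vis])
      show "cc_complete Z" by (rule K.complete[of "{}"]) (use Y.complete_iff_empty_base compl in auto)
    qed
    then have "gb (tuples m \<Gamma>) (exp_rels m \<Gamma> T L) \<le> card ?PP" by (rule gb_le)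
    also have "\<dots> \<le> card DD" by (rule card_image_le[OF finDD])
    finally show ?thesis using DD(2) by simp
  qed
qed

text \<open>A generalized base of \<open>T\<close> and one of \<open>Inv(L)\<close> are listed along
  the same \<open>N\<close> places, and one product set per place encodes both members. The product
  at place \<open>0\<close> also serves as the core.\<close>

lemma gb_exp_le_incomplete:
  fixes \<Gamma> :: "'a set"
  assumes cT: "coherent_config \<Gamma> T" and anti: "cc_antisymmetric \<Gamma> T"
    and grp: "perm_group_on m L" and tr: "transitive_on m L" and incompl: "\<not> cc_complete T"
  shows "gb (tuples m \<Gamma>) (exp_rels m \<Gamma> T L) \<le> max (gb \<Gamma> T) (gb {1..m} (Inv_rels m L))"
proof -
  interpret Y: coherent \<Gamma> T using cT by unfold_locales
  note iff = generalized_base_iff[OF finite_tuples[OF Y.finite_points] exp_rels_subset[OF grp]]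
  define N where "N = max (gb \<Gamma> T) (gb {1..m} (Inv_rels m L))"
  obtain DD where DD: "generalized_base {1..m} (Inv_rels m L) DD" "card DD = gb {1..m} (Inv_rels m L)"
    using gb_attained[OF finite_atLeastAtMost Inv_rels_subset[OF grp]] by metis
  obtain PP where PP: "generalized_base \<Gamma> T PP" "card PP = gb \<Gamma> T"
    using gb_attained[OF Y.finite_points Y.rels_subset] by metis
  have PP_sub: "PP \<subseteq> Pow \<Gamma>" and DD_sub: "DD \<subseteq> Pow {1..m}"
    using PP(1) DD(1) by (auto simp: generalized_base_def)
  have finPP: "finite PP" using finite_subset[OF PP_sub] Y.finite_points by simp
  have finDD: "finite DD" using finite_subset[OF DD_sub] by simp
  \<comment> \<open>Only members that are not unions of fibers can be factors of the core. They
    still form a generalized base, and it is non-empty because \<open>T\<close> is not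
    complete.\<close>
  define PP0 where "PP0 = {P \<in> PP. \<not> cc_set T P}"
  have base0: "generalized_base \<Gamma> T PP0"
    by (rule Y.generalized_base_drop[OF PP(1)]) (auto simp: PP0_def)
  have "PP0 \<noteq> {}" using base0 incompl Y.complete_iff_empty_base by auto
  then obtain P0 where P0: "P0 \<in> PP0" by blast
  have fin0: "finite PP0" and card0: "card PP0 \<le> N"
    using finPP card_mono[OF finPP, of PP0] PP(2) by (auto simp: PP0_def N_def)
  obtain f where f: "PP0 \<subseteq> f ` {..<N}" "\<And>k. f k \<in> insert P0 PP0"
    using ex_enumeration[OF fin0 card0] by metis
  have f0: "f k \<in> PP0" for k using f(2)[of k] P0 by auto
  \<comment> \<open>Padding with the empty set of indices is harmless: the factor is then the
    symmetric difference in every coordinate.\<close>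
  obtain g where g: "DD \<subseteq> g ` {..<N}" "\<And>k. g k \<in> insert {} DD"
    using ex_enumeration[OF finDD, of N "{}"] DD(2) by (metis N_def max.cobounded2)
  have gm: "g k \<subseteq> {1..m}" for k using g(2)[of k] DD_sub by auto
  have "\<Gamma> \<noteq> {}" using P0 PP_sub Y.set_empty by (auto simp: PP0_def)
  then obtain z where "z \<in> \<Gamma>" by blast
  then obtain s where s: "s \<in> T" "(z,z) \<in> s" using Y.ex_basic[of "(z,z)"] by auto
  define \<Phi> where "\<Phi> = Domain s"
  have "s = Id_on \<Phi>" using Y.basic_Id[OF s] by (auto simp: \<Phi>_def)
  then have fib: "Id_on \<Phi> \<in> T" using s by simp
  have set\<Phi>: "cc_set T \<Phi>" using cc_relation_basic[OF fib] by (simp add: cc_set_def)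
  have odd: "odd (card \<Phi>)" by (rule Y.antisymmetric_odd_fiber[OF anti fib])
  define sd where "sd P = (P - \<Phi>) \<union> (\<Phi> - P)" for P
  have sd_sd: "sd (sd P) = P" for P by (auto simp: sd_def)
  have sd_set: "cc_set T P \<Longrightarrow> cc_set T (sd P)" for P
    unfolding sd_def using set\<Phi> by (intro Y.set_Un Y.set_Diff)
  define w where "w k i = (if i \<in> g k then f k else sd (f k))" for k i
  \<comment> \<open>Since \<open>\<Phi>\<close> is a fiber and \<open>sd\<close> is an involution,
    \<open>sd\<close> preserves the property of not being a union of fibers.\<close>
  have w_not: "\<not> cc_set T (w k i)" for k i
    using f0[of k] sd_set[of "sd (f k)"] sd_sd by (auto simp: w_def PP0_def)
  have w_sub: "w k i \<subseteq> \<Gamma>" for k i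
    using f0[of k] PP_sub Y.set_subset[OF set\<Phi>] by (auto simp: w_def sd_def PP0_def)
  have w_ne: "w k i \<noteq> {}" "\<Gamma> - w k i \<noteq> {}" for k i
    using w_not[of k i] Y.set_empty Y.set_full w_sub[of k i] by auto
  have w: "w k i \<subseteq> \<Gamma> \<and> w k i \<noteq> {}" for k i using w_sub w_ne by simp
  \<comment> \<open>The odd size of \<open>\<Phi>\<close> makes the two possible factors at place
    \<open>k\<close> differ in size.\<close>
  have card_w: "i \<in> g k \<longleftrightarrow> card (w k i) = card (f k)" for i k
  proof -
    have "f k \<subseteq> \<Gamma>" using f0[of k] PP_sub by (auto simp: PP0_def)
    then have "card (sd (f k)) \<noteq> card (f k)" unfolding sd_def
      using card_sym_diff_odd[OF _ _ odd] Y.finite_points Y.set_subset[OF set\<Phi>] finite_subset by metis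
    then show ?thesis by (simp add: w_def)
  qed
  let ?W = "(\<lambda>k. PiE {1..m} (w k)) ` {..<N}"
  have "generalized_base (tuples m \<Gamma>) (exp_rels m \<Gamma> T L) ?W"
    unfolding iff
  proof (intro conjI allI impI)
    show "?W \<subseteq> Pow (tuples m \<Gamma>)" using PiE_tuples_iff[of m _ \<Gamma>] w by blast
    fix Z assume Z: "fission (tuples m \<Gamma>) (exp_rels m \<Gamma> T L) Z \<and> (\<forall>P\<in>?W. cc_set Z P)"
    interpret F: exp_fission \<Gamma> T m L Z using Z cT grp by unfold_locales auto
    have Wset: "cc_set Z (PiE {1..m} (w k))" if "k < N" for k using Z that by blast
    have "N > 0" using P0 f(1) by auto
    interpret C: exp_core \<Gamma> T m L Z "w 0"
      by unfold_locales (use tr w_sub w_ne Wset[OF \<open>N > 0\<close>] Y.types_of_nonsets[OF anti w_sub w_not w_sub w_not] in auto)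
    have vis: "cc_set Z (\<Union>i\<in>D. C.e i)" if D: "D \<in> DD" for D
    proof -
      obtain k where k: "k < N" "D = g k" using g(1) D by auto
      show ?thesis
        by (rule C.set_of_size[of "w k" D "card (f k)"]) (use w gm k Wset card_w in auto)
    qed
    interpret K: exp_coord \<Gamma> T m L Z "\<lambda>i. \<Gamma> - w 0 i" by (rule C.exp_coord[OF DD(1) vis])
    show "cc_complete Z"
    proof (rule K.complete[OF base0])
      fix i P assume i: "i \<in> {1..m}" and "P \<in> PP0"
      then obtain k where k: "k < N" "P = f k" using f(1) by auto
      have s: "cc_set Z {a \<in> tuples m \<Gamma>. a i \<in> w k i}"
        by (rule K.set_coordinate_of_product[OF w Wset[OF k(1)] i])
      show "cc_set Z {a \<in> tuples m \<Gamma>. a i \<in> P}"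
      proof (cases "i \<in> g k")
        case True then show ?thesis using s k by (simp add: w_def)
      next
        case False
        let ?A = "{a \<in> tuples m \<Gamma>. a i \<in> w k i}" and ?B = "{a \<in> tuples m \<Gamma>. a i \<in> \<Phi>}"
        \<comment> \<open>Off \<open>g k\<close> the factor is the symmetric difference with
          \<open>\<Phi>\<close>; the cylinder over \<open>\<Phi>\<close> is visible, so the
          difference can be undone.\<close>
        have "P = sd (w k i)" using False k sd_sd by (simp add: w_def)
        then have "{a \<in> tuples m \<Gamma>. a i \<in> P} = (?A - ?B) \<union> (?B - ?A)" by (auto simp: sd_def)
        then show ?thesis
          using s K.set_coordinate_of_set[OF i set\<Phi>] F.Z.set_Un F.Z.set_Diff by simp
      qed
    qed
  qed
  then have "gb (tuples m \<Gamma>) (exp_rels m \<Gamma> T L) \<le> card ?W" by (rule gb_le)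
  also have "\<dots> \<le> N" using card_image_le[of "{..<N}"] by simp
  finally show ?thesis by (simp add: N_def)
qed

text \<open>A minimum base of \<open>T\<close> gives \<open>k\<close> tuples whose entries in each
  coordinate run through the whole base. Swapping the two base points of a pair off a set of indices
  encodes that set at no cost, which handles \<open>k div 2\<close> members of a generalized base of
  \<open>Inv(L)\<close>; every further member costs one tuple.\<close>

lemma bnum_exp_le:
  fixes \<Gamma> :: "'a set"
  assumes cT: "coherent_config \<Gamma> T" and anti: "cc_antisymmetric \<Gamma> T"
    and grp: "perm_group_on m L" and tr: "transitive_on m L" and incompl: "\<not> cc_complete T"
  shows "bnum (tuples m \<Gamma>) (exp_rels m \<Gamma> T L)
    \<le> bnum \<Gamma> T + (gb {1..m} (Inv_rels m L) - bnum \<Gamma> T div 2)"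
proof -
  interpret Y: coherent \<Gamma> T using cT by unfold_locales
  note iff = generalized_base_iff[OF finite_tuples[OF Y.finite_points] exp_rels_subset[OF grp]]
  define b where "b = gb {1..m} (Inv_rels m L)"
  define k where "k = bnum \<Gamma> T"
  define h where "h = k div 2"
  obtain DD where DD: "generalized_base {1..m} (Inv_rels m L) DD" "card DD = b"
    using gb_attained[OF finite_atLeastAtMost Inv_rels_subset[OF grp]] b_def by metis
  have DD_sub: "DD \<subseteq> Pow {1..m}" using DD(1) by (auto simp: generalized_base_def)
  then have finDD: "finite DD" using finite_subset by auto
  obtain D where D: "DD \<subseteq> D ` {..<b}" "\<And>j. D j \<in> insert {} DD"
    using ex_enumeration[OF finDD, of b "{}"] DD(2) by (metis order_refl)
  have Dm: "D j \<subseteq> {1..m}" for j using D(2)[of j] DD_sub by auto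
  obtain A where A: "cc_base \<Gamma> T A" "card A = k"
    using bnum_attained[OF Y.finite_points Y.rels_subset] k_def by metis
  have A_sub: "A \<subseteq> \<Gamma>" and baseA: "generalized_base \<Gamma> T ((\<lambda>x. {x}) ` A)" using A(1) by (auto simp: cc_base_def)
  have finA: "finite A" using finite_subset[OF A_sub Y.finite_points] .
  \<comment> \<open>By minimality of the base: a point that is already visible could be
    dropped.\<close>
  have nonset: "\<not> cc_set T {x}" if x: "x \<in> A" for x
  proof
    assume "cc_set T {x}"
    then have "generalized_base \<Gamma> T ((\<lambda>x. {x}) ` (A - {x}))"
      by (intro Y.generalized_base_drop[OF baseA]) auto
    then have "cc_base \<Gamma> T (A - {x})" using A_sub by (auto simp: cc_base_def)
    then have "k \<le> card (A - {x})" unfolding k_def by (rule bnum_le)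
    moreover have "card (A - {x}) < card A" by (rule card_Diff1_less[OF finA x])
    ultimately show False using A(2) by simp
  qed
  have "A \<noteq> {}" using baseA incompl Y.complete_iff_empty_base by auto
  then have k0: "k > 0" using A(2) finA by (auto simp: card_gt_0_iff)
  obtain \<beta> where \<beta>: "bij_betw \<beta> {0..<k} A" using ex_bij_betw_nat_finite[OF finA] A(2) by metis
  have \<beta>A: "\<beta> j \<in> A" if "j < k" for j using \<beta> that by (auto simp: bij_betw_def)
  have \<beta>inj: "\<beta> i \<noteq> \<beta> j" if "i < k" "j < k" "i \<noteq> j" for i j
    using \<beta> that by (auto simp: bij_betw_def inj_on_def)
  have h: "2 * h \<le> k" by (simp add: h_def)
  \<comment> \<open>The partner within the pair \<open>{2 * n, 2 * n + 1}\<close>; the subtraction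
    is only used at odd \<open>j\<close>, so it does not truncate.\<close>
  define pt where "pt j = (if even j then j + 1 else j - 1)" for j :: nat
  have pt: "pt j < 2 * h" "pt j div 2 = j div 2" "pt (pt j) = j" if "j < 2 * h" for j
    using that by (auto simp: pt_def elim!: evenE oddE)
  \<comment> \<open>Places \<open>2 * n\<close> and \<open>2 * n + 1\<close> carry their own base
    points on \<open>D n\<close> and each other's elsewhere. If \<open>k\<close> is odd, the last
    tuple is constant.\<close>
  define a where "a j = restrict (\<lambda>i. if j < 2 * h \<and> i \<notin> D (j div 2) then \<beta> (pt j) else \<beta> j) {1..m}" for j
  have aA: "a j i \<in> A" if "j < k" "i \<in> {1..m}" for i j
    using \<beta>A[OF that(1)] \<beta>A[of "pt j"] pt(1)[of j] h that(2) by (auto simp: a_def)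
  have at: "a j \<in> tuples m \<Gamma>" if "j < k" for j
  proof -
    have "a j \<in> extensional {1..m}" by (simp add: a_def)
    then show ?thesis using aA[OF that] A_sub unfolding tuples_def PiE_iff by blast
  qed
  \<comment> \<open>The swaps only permute base points within a coordinate, so none is lost.\<close>
  have cover: "\<exists>j<k. a j i = x" if x: "x \<in> A" and i: "i \<in> {1..m}" for x i
  proof -
    obtain j where j: "j < k" "\<beta> j = x" using \<beta> x by (auto simp: bij_betw_def)
    show ?thesis
    proof (cases "j < 2 * h \<and> i \<notin> D (j div 2)")
      case True
      then have "a (pt j) i = x" using pt[of j] j i by (simp add: a_def)
      then show ?thesis using pt(1)[of j] True h by (intro exI[of _ "pt j"]) auto
    next
      case False
      then have "a j i = x" using j i by (auto simp: a_def)
      then show ?thesis using j by blast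
    qed
  qed
  have "\<exists>y\<in>\<Gamma>. y \<noteq> x" if "x \<in> A" for x
  proof (rule ccontr)
    assume "\<not> ?thesis"
    then have "\<Gamma> \<subseteq> {x}" by blast
    then show False using Y.complete_if_trivial incompl by blast
  qed
  then obtain \<delta> where \<delta>: "\<And>x. x \<in> A \<Longrightarrow> \<delta> x \<in> \<Gamma> \<and> \<delta> x \<noteq> x" by metis
  \<comment> \<open>Agrees with \<open>a 0\<close> exactly on \<open>D j\<close>. Only the places
    from \<open>h\<close> up to \<open>b\<close> are used, of which there are none if
    \<open>b \<le> h\<close>.\<close>
  define c where "c j = restrict (\<lambda>i. if i \<in> D j then a 0 i else \<delta> (a 0 i)) {1..m}" for j
  have ct: "c j \<in> tuples m \<Gamma>" for j
  proof -
    have "c j \<in> extensional {1..m}" by (simp add: c_def)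
    moreover have "c j i \<in> \<Gamma>" if "i \<in> {1..m}" for i
      using aA[OF k0 that] \<delta>[OF aA[OF k0 that]] A_sub that by (auto simp: c_def)
    ultimately show ?thesis unfolding tuples_def PiE_iff by blast
  qed
  define BB where "BB = a ` {..<k} \<union> c ` {h..<b}"
  have cardBB: "card BB \<le> k + (b - h)"
  proof -
    have "card BB \<le> card (a ` {..<k}) + card (c ` {h..<b})" unfolding BB_def by (rule card_Un_le)
    also have "\<dots> \<le> k + (b - h)"
      using card_image_le[of "{..<k}" a] card_image_le[of "{h..<b}" c] by simp
    finally show ?thesis .
  qed
  have BB_sub: "BB \<subseteq> tuples m \<Gamma>" using at ct by (auto simp: BB_def)
  have "generalized_base (tuples m \<Gamma>) (exp_rels m \<Gamma> T L) ((\<lambda>x. {x}) ` BB)"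
    unfolding iff
  proof (intro conjI allI impI)
    show "(\<lambda>x. {x}) ` BB \<subseteq> Pow (tuples m \<Gamma>)" using BB_sub by auto
    fix Z assume Z: "fission (tuples m \<Gamma>) (exp_rels m \<Gamma> T L) Z \<and> (\<forall>P\<in>(\<lambda>x. {x}) ` BB. cc_set Z P)"
    interpret F: exp_fission \<Gamma> T m L Z using Z cT grp by unfold_locales auto
    have aset: "cc_set Z {a j}" if "j < k" for j using Z that by (auto simp: BB_def)
    have cset: "cc_set Z {c j}" if "h \<le> j" "j < b" for j using Z that by (auto simp: BB_def)
    have prod: "PiE {1..m} (\<lambda>i. {a j i}) = {a j}" if "j < k" for j
      using at[OF that] unfolding tuples_def by (intro PiE_singleton) (simp add: PiE_def)
    have a_sub: "{a j i} \<subseteq> \<Gamma>" if "j < k" "i \<in> {1..m}" for i j using aA[OF that] A_sub by auto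
    interpret C: exp_core \<Gamma> T m L Z "\<lambda>i. {a 0 i}"
    proof
      show "cc_set Z (PiE {1..m} (\<lambda>i. {a 0 i}))" using prod[OF k0] aset[OF k0] by simp
      fix i assume i: "i \<in> {1..m}"
      show "{a 0 i} \<subseteq> \<Gamma>" by (rule a_sub[OF k0 i])
      show "\<Gamma> - {a 0 i} \<noteq> {}" using \<delta>[OF aA[OF k0 i]] by blast
      fix j assume j: "j \<in> {1..m}"
      show "\<exists>x\<in>\<Gamma> - {a 0 i}. \<exists>x'\<in>{a 0 i}. \<exists>y'\<in>{a 0 j}. \<exists>y\<in>\<Gamma> - {a 0 j}.
          \<forall>t\<in>T. \<not> ((x,x') \<in> t \<and> (y',y) \<in> t)"
        by (rule Y.types_of_nonsets[OF anti a_sub[OF k0 i] nonset[OF aA[OF k0 i]]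
              a_sub[OF k0 j] nonset[OF aA[OF k0 j]]])
    qed (use tr in auto)
    have vis: "cc_set Z (\<Union>i\<in>D'. C.e i)" if D': "D' \<in> DD" for D'
    proof -
      obtain j where j: "j < b" "D' = D j" using D(1) D' by auto
      show ?thesis
      proof (cases "j < h")
        case True
        then have jk: "2 * j < k" "2 * j + 1 < k" using h by auto
        have "(\<beta> (2 * j), \<beta> (2 * j + 1)) \<in> \<Gamma> \<times> \<Gamma>" using \<beta>A jk A_sub by auto
        then obtain s where s: "s \<in> T" "(\<beta> (2 * j), \<beta> (2 * j + 1)) \<in> s" using Y.ex_basic by blast
        have ne: "\<beta> (2 * j) \<noteq> \<beta> (2 * j + 1)" using \<beta>inj jk by simp
        \<comment> \<open>Antisymmetry separates the type of the pair of base points from that of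
          the reversed pair, so membership in \<open>s\<close> tells where the swap
          occurred.\<close>
        have s': "(\<beta> (2 * j + 1), \<beta> (2 * j)) \<notin> s" using Y.antisymmetric_basic[OF anti s] ne by auto
        have "\<not> s \<subseteq> Id_on \<Gamma>" using s(2) ne by auto
        then have irr: "\<forall>x. (x,x) \<notin> s" using Y.basic_Id[OF s(1)] by blast
        have "a (2 * j) i = (if i \<in> D j then \<beta> (2 * j) else \<beta> (2 * j + 1))"
          "a (2 * j + 1) i = (if i \<in> D j then \<beta> (2 * j + 1) else \<beta> (2 * j))" if "i \<in> {1..m}" for i
          using that True by (auto simp: a_def pt_def)
        then have "i \<in> D j \<longleftrightarrow> (a (2 * j) i, a (2 * j + 1) i) \<in> s" if "i \<in> {1..m}" for i
          using that s(2) s' by simp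
        then show ?thesis unfolding j(2)
          using C.set_of_pair[OF cc_relation_basic[OF s(1)] disjI2[OF irr] aset[OF jk(1)] aset[OF jk(2)] Dm]
          by blast
      next
        case False
        \<comment> \<open>Here equality of entries plays the role of the type: off
          \<open>D j\<close> the entry of \<open>c j\<close> was moved away by
          \<open>\<delta>\<close>.\<close>
        have "i \<in> D j \<longleftrightarrow> (a 0 i, c j i) \<in> Id_on \<Gamma>" if i: "i \<in> {1..m}" for i
          using i \<delta>[OF aA[OF k0 i]] a_sub[OF k0 i] by (auto simp: c_def)
        moreover have "cc_set Z {c j}" using cset False j(1) by simp
        ultimately show ?thesis unfolding j(2)
          using C.set_of_pair[OF Y.rel_Id disjI1[OF refl] aset[OF k0] _ Dm] by blast
      qed
    qed
    interpret K: exp_coord \<Gamma> T m L Z "\<lambda>i. \<Gamma> - {a 0 i}" by (rule C.exp_coord[OF DD(1) vis])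
    show "cc_complete Z"
    proof (rule K.complete[OF baseA])
      fix i P assume i: "i \<in> {1..m}" and "P \<in> (\<lambda>x. {x}) ` A"
      then obtain x where x: "x \<in> A" "P = {x}" by blast
      obtain j where j: "j < k" "a j i = x" using cover[OF x(1) i] by blast
      have "cc_set Z {b \<in> tuples m \<Gamma>. b i \<in> {a j i}}"
        by (rule K.set_coordinate_of_product[OF _ _ i]) (use a_sub[OF j(1)] prod aset j in auto)
      then show "cc_set Z {b \<in> tuples m \<Gamma>. b i \<in> P}" using j x by simp
    qed
  qed
  then have "cc_base (tuples m \<Gamma>) (exp_rels m \<Gamma> T L) BB" using BB_sub by (simp add: cc_base_def)
  from bnum_le[OF this] cardBB show ?thesis by (simp add: b_def k_def h_def)
qed

text \<open>For \<open>k = 2 * h\<close> the fraction is \<open>h - 1/2\<close>, which rounds up to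
  \<open>h\<close>; for \<open>k = 2 * h + 1\<close> it is \<open>h\<close> itself.\<close>

lemma ceiling_half_pred: "\<lceil>(real k - 1) / 2\<rceil> = int (k div 2)"
proof (cases "even k")
  case True
  then obtain h where "k = 2 * h" by (elim evenE)
  then show ?thesis by (intro ceiling_unique) (auto simp: field_simps)
next
  case False
  then obtain h where "k = 2 * h + 1" by (elim oddE)
  then show ?thesis by simp
qed

theorem theorem7p1:
  fixes \<Gamma> :: "'a set" and T :: "'a rel set" and m :: nat and L :: "(nat \<Rightarrow> nat) set"
  assumes "coherent_config \<Gamma> T"
    and "cc_antisymmetric \<Gamma> T"
    and "perm_group_on m L"
    and "transitive_on m L"
    and "odd (card L)"
  shows "gb (tuples m \<Gamma>) (exp_rels m \<Gamma> T L) \<le> max (gb \<Gamma> T) (gb {1..m} (Inv_rels m L))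
    \<and> (\<not> cc_complete T \<longrightarrow>
        int (bnum (tuples m \<Gamma>) (exp_rels m \<Gamma> T L))
          \<le> int (bnum \<Gamma> T) + max 0 (int (gb {1..m} (Inv_rels m L))
                 - ceiling ((real (bnum \<Gamma> T) - 1) / 2)))"
proof (intro conjI impI)
  show "gb (tuples m \<Gamma>) (exp_rels m \<Gamma> T L) \<le> max (gb \<Gamma> T) (gb {1..m} (Inv_rels m L))"
    using gb_exp_le_complete[OF assms(1,3,4)] gb_exp_le_incomplete[OF assms(1-4)]
    by (cases "cc_complete T") (auto intro: max.coboundedI2)
next
  assume "\<not> cc_complete T"
  from bnum_exp_le[OF assms(1-4) this]
  show "int (bnum (tuples m \<Gamma>) (exp_rels m \<Gamma> T L))
    \<le> int (bnum \<Gamma> T) + max 0 (int (gb {1..m} (Inv_rels m L)) - ceiling ((real (bnum \<Gamma> T) - 1) / 2))"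
    \<comment> \<open>The truncated subtraction of natural numbers in \<open>bnum_exp_le\<close>
      becomes the maximum with \<open>0\<close> over the integers.\<close>
    unfolding ceiling_half_pred by linarith
qed

end
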